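(* Let $p$ and $q$ be different primes and $v\ge 1$ an integer. The group of Miller and Moreno with parameters $p,q$ and $v$ is determined by its endomorphism semigroup in the class of all groups if and only if the order of $p$ in the group of units of the residue-class ring $Z_q$ modulo $q$ is odd.
   Context: A Schmidt group is a non-nilpotent finite group in which each proper subgroup is nilpotent. Every Schmidt group $G$ is a semidirect product of its derived subgroup $G'$ (normal), which is a $p$-group, and a cyclic group $\langle b\rangle$ of order $q^v$, for some different primes $p,q$ and some integer $v\ge 1$; these $p,q,v$ are called the parameters of $G$. A group of Miller and Moreno is a non-abelian finite group in which each proper subgroup is abelian. For given parameters $p,q,v$ there is, up to isomorphism, exactly one Schmidt group with parameters $p,q,v$ that is also a group of Miller and Moreno; it is called the group of Miller and Moreno with parameters $p,q$ and $v$. $\mathrm{End}(G)$ is the semigroup of all endomorphisms of $G$ under composition (maps written on the right, so $xy$ means first $x$, then $y$). A group $G$ is determined by its endomorphism semigroup in the class of all groups if, for every group $H$, an isomorphism of semigroups $\mathrm{End}(G)\cong\mathrm{End}(H)$ implies $G\cong H$. *)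

theory Defs
  imports "HOL-Algebra.Algebra" "HOL-Number_Theory.Residues"
begin

text \<open>
  Term number \<open>n\<close> of the sequence below is the term usually written \<open>\<gamma>\<close> with index \<open>n + 1\<close>.
  The commutator convention is that of \<^const>\<open>derived\<close>, so that term \<open>1\<close> is
  \<open>derived G (carrier G)\<close>.
\<close>

primrec lower_central :: "('a, 'm) monoid_scheme \<Rightarrow> nat \<Rightarrow> 'a set" where
  "lower_central G 0 = carrier G"
| "lower_central G (Suc n) =
     generate G (\<Union>x \<in> lower_central G n. \<Union>y \<in> carrier G.
       {x \<otimes>\<^bsub>G\<^esub> y \<otimes>\<^bsub>G\<^esub> inv\<^bsub>G\<^esub> x \<otimes>\<^bsub>G\<^esub> inv\<^bsub>G\<^esub> y})"

definition nilpotent_group :: "('a, 'm) monoid_scheme \<Rightarrow> bool" where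
  "nilpotent_group G \<longleftrightarrow> group G \<and> (\<exists>n. lower_central G n = {\<one>\<^bsub>G\<^esub>})"

definition schmidt_group :: "('a, 'm) monoid_scheme \<Rightarrow> bool" where
  "schmidt_group G \<longleftrightarrow>
     group G \<and> finite (carrier G) \<and> \<not> nilpotent_group G \<and>
     (\<forall>H. subgroup H G \<and> H \<noteq> carrier G \<longrightarrow> nilpotent_group (G\<lparr>carrier := H\<rparr>))"

definition miller_moreno_group :: "('a, 'm) monoid_scheme \<Rightarrow> bool" where
  "miller_moreno_group G \<longleftrightarrow>
     group G \<and> finite (carrier G) \<and> \<not> comm_group G \<and>
     (\<forall>H. subgroup H G \<and> H \<noteq> carrier G \<longrightarrow> comm_group (G\<lparr>carrier := H\<rparr>))"

definition internal_semidirect :: "('a, 'm) monoid_scheme \<Rightarrow> 'a set \<Rightarrow> 'a set \<Rightarrow> bool" where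
  "internal_semidirect G N K \<longleftrightarrow>
     N \<lhd> G \<and> subgroup K G \<and> N \<inter> K = {\<one>\<^bsub>G\<^esub>} \<and> N <#>\<^bsub>G\<^esub> K = carrier G"

definition schmidt_group_with_parameters ::
  "('a, 'm) monoid_scheme \<Rightarrow> nat \<Rightarrow> nat \<Rightarrow> nat \<Rightarrow> bool" where
  "schmidt_group_with_parameters G p q v \<longleftrightarrow>
     schmidt_group G \<and> Factorial_Ring.prime p \<and> Factorial_Ring.prime q \<and> p \<noteq> q \<and> v \<ge> 1 \<and>
     (\<exists>n. card (derived G (carrier G)) = p ^ n) \<and>
     (\<exists>b \<in> carrier G. card (generate G {b}) = q ^ v \<and>
        internal_semidirect G (derived G (carrier G)) (generate G {b}))"

definition miller_moreno_with_parameters ::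
  "('a, 'm) monoid_scheme \<Rightarrow> nat \<Rightarrow> nat \<Rightarrow> nat \<Rightarrow> bool" where
  "miller_moreno_with_parameters G p q v \<longleftrightarrow>
     schmidt_group_with_parameters G p q v \<and> miller_moreno_group G"

text \<open>
  Endomorphisms are taken extensional, so that each of them is represented by exactly one
  function. Maps act on the right: the product \<open>f g\<close> applies \<open>f\<close> first, whereas
  \<^const>\<open>compose\<close> applies its last argument first. The isomorphisms of \<^const>\<open>is_iso\<close> are the
  bijections that preserve multiplication, so \<open>End G \<cong> End H\<close> is isomorphism of semigroups.
\<close>

definition End :: "('a, 'm) monoid_scheme \<Rightarrow> ('a \<Rightarrow> 'a) monoid" where
  "End G =
     \<lparr>carrier = hom G G \<inter> extensional (carrier G),
      monoid.mult = (\<lambda>f g. compose (carrier G) g f),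
      one = (\<lambda>x \<in> carrier G. x)\<rparr>"

text \<open>
  HOL cannot quantify over types inside a formula, so the class of all groups is rendered by the
  groups whose elements come from a type \<open>'b\<close>. Every group is isomorphic to one over some
  infinite type, hence a result for all infinite \<open>'b\<close> covers all groups. For finite \<open>'b\<close> the
  notion is not meaningful, as too few groups live on such a type.
\<close>

definition determined_by_End :: "('a, 'm) monoid_scheme \<Rightarrow> 'b itself \<Rightarrow> bool" where
  "determined_by_End G (_ :: 'b itself) \<longleftrightarrow>
     (\<forall>H :: 'b monoid. group H \<longrightarrow> End G \<cong> End H \<longrightarrow> G \<cong> H)"

end

theory Submission
  imports Defs
begin

text \<open>
  Let \<open>P\<close> be the derived subgroup of \<open>G\<close>. All proper subgroups of \<open>G\<close> are abelian, so \<open>\<langle>b\<rangle>\<close> acts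
  irreducibly on \<open>P\<close>, without fixed points and with \<open>b\<^sup>q\<close> acting trivially. By Schur's lemma the
  endomorphisms of \<open>P\<close> that commute with this action form a field, and \<open>P\<close> is a one-dimensional
  vector space over it. Hence \<open>P\<close> itself becomes the additive group of a finite field \<open>F\<close>, and \<open>b\<close>
  acts on it as multiplication by an element \<open>\<zeta>\<close> of order \<open>q\<close> that generates \<open>F\<close>
  (\<open>miller_moreno_field\<close>). If \<open>F\<close> has \<open>p\<^sup>n\<close> elements, then \<open>n\<close> is the order of \<open>p\<close> modulo \<open>q\<close>
  (\<open>n_is_order\<close>), so the theorem is about the parity of \<open>n\<close>. In both directions it matters that an
  endomorphism of \<open>G\<close> is either injective or trivial on \<open>F\<close> (\<open>hom_kill_or_inj\<close>).

  If \<open>n\<close> is even, \<open>F\<close> has an automorphism \<open>\<eta>\<close> of order two with \<open>\<zeta> \<eta>(\<zeta>) = 1\<close>. The cocycle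
  \<open>(x, y) \<mapsto> x \<eta>(y)\<close> then defines a proper central extension \<open>H\<close> of \<open>G\<close>; its part over \<open>F\<close> is a
  Sylow subgroup of a unitary group, and for the alternating group of degree four \<open>H\<close> is the binary
  tetrahedral group. Every endomorphism of \<open>H\<close> induces one of \<open>G\<close>, since the kernel consists of
  commutators of \<open>p\<close>-elements. Up to an inner automorphism, an endomorphism of \<open>G\<close> is
  \<open>x \<mapsto> l \<tau>(x)\<close>, \<open>b \<mapsto> b\<^sup>k\<close> for a field endomorphism \<open>\<tau>\<close>, and such a map is compatible with the
  cocycle, so it lifts; the lift is unique. Thus \<open>H\<close> and \<open>G\<close> have isomorphic endomorphism semigroups
  but different orders (\<open>not_determined\<close>).

  Let now \<open>n\<close> be odd and let \<open>H\<close> be any group with an isomorphism from \<open>End G\<close> to \<open>End H\<close>. The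
  projection \<open>e\<close> of \<open>G\<close> onto \<open>\<langle>b\<rangle>\<close> goes to an idempotent \<open>\<epsilon>\<close> of \<open>End H\<close>. The endomorphisms of the image
  of \<open>\<epsilon>\<close> form the multiplicative monoid of the integers modulo \<open>q\<^sup>v\<close>, which forces that image to be
  cyclic of order \<open>q\<^sup>v\<close> (\<open>cyclic_of_End_cyclic\<close>). An inner automorphism of \<open>H\<close> corresponds to an
  endomorphism of \<open>G\<close> over \<open>e\<close>, that is, to an affine map \<open>x \<mapsto> \<Lambda> x + t\<close> of \<open>F\<close>. So \<open>H\<close> modulo its centre
  embeds into the affine group of \<open>F\<close>, and by irreducibility all translations occur in the image.

  Let \<open>K\<close> be the kernel of \<open>\<epsilon>\<close>. Every endomorphism of \<open>H\<close> that is not injective is trivial on \<open>K\<close>.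
  Applied to a power map with values in the centre this bounds the exponent of \<open>K\<close>; applied to
  homomorphisms onto subgroups of prime order it shows that \<open>K\<close> is contained in the derived subgroup
  of \<open>H\<close> (\<open>K_derived\<close>). Hence \<open>\<Lambda> = 1\<close> on \<open>K\<close>, and commutators in \<open>K\<close> define an alternating biadditive
  form on \<open>F\<close> that is invariant under \<open>\<zeta>\<close>. If this form were not trivial, taking adjoints would give an
  automorphism of \<open>F\<close> of order two, and \<open>n\<close> would be even (\<open>odd_form_trivial\<close>). So \<open>K\<close> is abelian, the
  coordinate \<open>t\<close> identifies it with \<open>F\<close>, and \<open>H\<close> is isomorphic to \<open>G\<close>.
\<close>

section \<open>Powers, commutators and homomorphisms onto subgroups of prime order\<close>

context group
begin

lemma inv_mult_cancel_left:
  assumes "x \<in> carrier G" "y \<in> carrier G"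
  shows "inv x \<otimes> (x \<otimes> y) = y" and "x \<otimes> (inv x \<otimes> y) = y"
  using assms by (simp_all flip: m_assoc)

lemmas group_normalize = m_assoc inv_mult_group inv_mult_cancel_left

lemma pow_commute:
  assumes "x \<in> carrier G" "y \<in> carrier G" "x \<otimes> y = y \<otimes> x"
  shows "x [^] (n::nat) \<otimes> y = y \<otimes> x [^] n"
proof (induction n)
  case (Suc n)
  have "x [^] Suc n \<otimes> y = x [^] n \<otimes> (x \<otimes> y)" using assms by (simp add: m_assoc)
  also have "\<dots> = (x [^] n \<otimes> y) \<otimes> x" using assms by (simp add: m_assoc)
  also have "\<dots> = y \<otimes> x [^] Suc n" using assms Suc by (simp add: m_assoc)
  finally show ?case .
qed (use assms in simp)

lemma pow_cong:
  assumes "a \<in> carrier G" "a [^] (r::nat) = \<one>" "[i = j] (mod r)"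
  shows "a [^] (i::nat) = a [^] j"
proof -
  have "a [^] i = a [^] (i mod r)" for i :: nat
  proof -
    have "a [^] i = a [^] (r * (i div r)) \<otimes> a [^] (i mod r)" using assms(1) by (simp add: nat_pow_mult)
    then show ?thesis using assms(1,2) by (simp flip: nat_pow_pow)
  qed
  then show ?thesis using assms(3) unfolding unique_euclidean_semiring_class.cong_def by metis
qed

lemma pow_eq_iff_cong_ord:
  assumes "a \<in> carrier G"
  shows "a [^] (i::nat) = a [^] j \<longleftrightarrow> [i = j] (mod ord a)"
proof -
  have "a [^] i = a [^] j \<longleftrightarrow> int (ord a) dvd int j - int i"
    using int_pow_eq[OF assms, of "int i" "int j"] by (simp add: int_pow_int)
  also have "\<dots> \<longleftrightarrow> [int i = int j] (mod int (ord a))" by (simp add: cong_iff_dvd_diff dvd_diff_commute)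
  finally show ?thesis by (simp add: cong_int_iff)
qed

lemma pow_mult_central_commutator:
  assumes x: "x \<in> carrier G" and y: "y \<in> carrier G" and z: "z \<in> carrier G"
    and zx: "z \<otimes> x = x \<otimes> z" and zy: "z \<otimes> y = y \<otimes> z"
    and yx: "y \<otimes> x = x \<otimes> y \<otimes> z"
  shows "y \<otimes> x [^] (n::nat) = x [^] n \<otimes> y \<otimes> z [^] n"
    and "\<exists>k. 2 * k = n * (n - 1) \<and> (x \<otimes> y) [^] n = x [^] n \<otimes> y [^] n \<otimes> z [^] k"
proof -
  have zp: "z [^] (k::nat) \<otimes> x = x \<otimes> z [^] k" "z [^] k \<otimes> y = y \<otimes> z [^] k" for k
    using pow_commute x y z zx zy by auto
  have zp': "z [^] (k::nat) \<otimes> (x \<otimes> w) = x \<otimes> (z [^] k \<otimes> w)"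
    "z [^] k \<otimes> (y \<otimes> w) = y \<otimes> (z [^] k \<otimes> w)" if "w \<in> carrier G" for k w
    using zp x y z that by (simp_all flip: m_assoc)
  have yx': "y \<otimes> (x \<otimes> w) = x \<otimes> (y \<otimes> (z \<otimes> w))" if "w \<in> carrier G" for w
    using yx x y z that by (simp flip: m_assoc)
  show 1: "y \<otimes> x [^] (n::nat) = x [^] n \<otimes> y \<otimes> z [^] n" for n
  proof (induction n)
    case (Suc n)
    have "y \<otimes> x [^] Suc n = (y \<otimes> x [^] n) \<otimes> x" using x y by (simp add: m_assoc)
    also have "\<dots> = x [^] n \<otimes> y \<otimes> (z [^] n \<otimes> x)" using x y z Suc by (simp add: m_assoc)
    also have "\<dots> = x [^] n \<otimes> (y \<otimes> x) \<otimes> z [^] n" using x y z by (simp add: zp m_assoc)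
    also have "\<dots> = x [^] Suc n \<otimes> y \<otimes> (z \<otimes> z [^] n)" using x y z by (simp add: yx m_assoc)
    also have "z \<otimes> z [^] n = z [^] Suc n" using z by (simp add: pow_commute)
    finally show ?case .
  qed (use x y in simp)
  have 2: "y [^] n \<otimes> x = x \<otimes> y [^] n \<otimes> z [^] n" for n :: nat
  proof (induction n)
    case (Suc n)
    have "y [^] Suc n \<otimes> x = y [^] n \<otimes> (y \<otimes> x)" using x y by (simp add: m_assoc)
    also have "\<dots> = (y [^] n \<otimes> x) \<otimes> y \<otimes> z" using x y z by (simp add: yx m_assoc)
    also have "\<dots> = x \<otimes> y [^] n \<otimes> (z [^] n \<otimes> y) \<otimes> z" using x y z Suc by (simp add: m_assoc)
    also have "\<dots> = x \<otimes> y [^] Suc n \<otimes> z [^] Suc n" using x y z zp by (simp add: m_assoc)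
    finally show ?case .
  qed (use x in simp)
  show "\<exists>k. 2 * k = n * (n - 1) \<and> (x \<otimes> y) [^] n = x [^] n \<otimes> y [^] n \<otimes> z [^] k"
  proof (induction n)
    case 0 show ?case by simp
  next
    case (Suc n)
    then obtain k where k: "2 * k = n * (n - 1)" "(x \<otimes> y) [^] n = x [^] n \<otimes> y [^] n \<otimes> z [^] k"
      by blast
    have "(x \<otimes> y) [^] Suc n = x [^] n \<otimes> y [^] n \<otimes> (z [^] k \<otimes> x) \<otimes> y"
      using x y z k by (simp add: m_assoc)
    also have "\<dots> = x [^] n \<otimes> (y [^] n \<otimes> x) \<otimes> (z [^] k \<otimes> y)" using x y z by (simp add: zp m_assoc)
    also have "\<dots> = x [^] Suc n \<otimes> y [^] n \<otimes> (z [^] n \<otimes> y) \<otimes> z [^] k"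
      using x y z by (simp add: 2 zp zp' m_assoc)
    also have "\<dots> = x [^] Suc n \<otimes> y [^] Suc n \<otimes> z [^] (n + k)"
      using x y z by (simp add: zp zp' m_assoc nat_pow_mult)
    finally have "(x \<otimes> y) [^] Suc n = x [^] Suc n \<otimes> y [^] Suc n \<otimes> z [^] (n + k)" .
    moreover have "2 * (n + k) = Suc n * (Suc n - 1)" using k(1) by (cases n) auto
    ultimately show ?case by blast
  qed
qed

text \<open>
  If \<open>x\<close> and \<open>y\<close> generate a group of class two and \<open>x\<^sup>m\<close> is central in it, then the commutator \<open>z\<close> has
  order dividing \<open>m\<close>. The factor two in the exponent makes \<open>m\<close> divide the triangular number that is the
  exponent of \<open>z\<close> in the expansion of the power of \<open>x \<otimes> y\<close>, whatever the parity of \<open>m\<close>.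
\<close>

lemma pow_mult_class_two:
  assumes x: "x \<in> carrier G" and y: "y \<in> carrier G" and z: "z \<in> carrier G"
    and zx: "z \<otimes> x = x \<otimes> z" and zy: "z \<otimes> y = y \<otimes> z"
    and yx: "y \<otimes> x = x \<otimes> y \<otimes> z" and xm: "y \<otimes> x [^] (m::nat) = x [^] m \<otimes> y"
  shows "(x \<otimes> y) [^] (2 * m) = x [^] (2 * m) \<otimes> y [^] (2 * m)"
proof -
  have "x [^] m \<otimes> y \<otimes> z [^] m = x [^] m \<otimes> y"
    using pow_mult_central_commutator(1)[OF x y z zx zy yx, of m] xm by simp
  then have zm: "z [^] m = \<one>" using x y z by simp
  obtain k where k: "2 * k = 2 * m * (2 * m - 1)"
    "(x \<otimes> y) [^] (2 * m) = x [^] (2 * m) \<otimes> y [^] (2 * m) \<otimes> z [^] k"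
    using pow_mult_central_commutator(2)[OF x y z zx zy yx, of "2 * m"] by blast
  then have "k = m * (2 * m - 1)" by simp
  then have "z [^] k = \<one>" using z zm by (simp flip: nat_pow_pow)
  then show ?thesis using k(2) x y by simp
qed

end

text \<open>
  An abelian group of prime exponent is a vector space. Zorn's lemma gives a subgroup \<open>M\<close> maximal
  among those without \<open>x\<close>. It is a hyperplane: every element is a power of \<open>x\<close> times an element of \<open>M\<close>,
  so the required linear functional can be read off from the exponent of \<open>x\<close>. The group need not be
  finite, which is why a maximality argument is used.
\<close>

lemma (in comm_group) exists_hom_of_prime_exponent:
  fixes H :: "('c, 'd) monoid_scheme" and r :: nat
  assumes r: "Factorial_Ring.prime r" and expo: "\<And>a. a \<in> carrier G \<Longrightarrow> a [^] r = \<one>"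
    and x: "x \<in> carrier G" "x \<noteq> \<one>" and H: "group H"
    and w: "w \<in> carrier H" "w [^]\<^bsub>H\<^esub> r = \<one>\<^bsub>H\<^esub>"
  shows "\<exists>f \<in> hom G H. f x = w \<and> (\<forall>a \<in> carrier G. \<exists>i::nat. f a = w [^]\<^bsub>H\<^esub> i)"
proof -
  interpret H: group H by fact
  define S where "S = {M. subgroup M G \<and> x \<notin> M}"
  have "\<exists>M\<in>S. \<forall>N\<in>S. M \<subseteq> N \<longrightarrow> N = M"
  proof (rule subset_Zorn_nonempty)
    have "{\<one>} \<in> S" unfolding S_def using x triv_subgroup by auto
    then show "S \<noteq> {}" by blast
  next
    fix C assume C: "C \<noteq> {}" "subset.chain S C"
    have CS: "\<And>M. M \<in> C \<Longrightarrow> subgroup M G \<and> x \<notin> M"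
      using C(2) unfolding subset_chain_def S_def by auto
    have tot: "\<And>M N. M \<in> C \<Longrightarrow> N \<in> C \<Longrightarrow> M \<subseteq> N \<or> N \<subseteq> M"
      using C(2) unfolding subset_chain_def by simp
    have "subgroup (\<Union>C) G"
    proof (rule subgroupI)
      show "\<Union>C \<subseteq> carrier G" using CS subgroup.subset by (intro Union_least) auto
      obtain M where "M \<in> C" using C(1) by blast
      then have "\<one> \<in> M" using CS[of M] subgroup.one_closed[of M G] by simp
      with \<open>M \<in> C\<close> show "\<Union>C \<noteq> {}" by (metis UnionI empty_iff)
    next
      fix a assume "a \<in> \<Union>C"
      then obtain M where "M \<in> C" "a \<in> M" by (rule UnionE)
      then show "inv a \<in> \<Union>C" using CS[of M] subgroup.m_inv_closed[of M G a] by (intro UnionI) simp_all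
    next
      fix a b assume "a \<in> \<Union>C" "b \<in> \<Union>C"
      then obtain M N where "M \<in> C" "N \<in> C" "a \<in> M" "b \<in> N" by (auto elim!: UnionE)
      from tot[OF \<open>M \<in> C\<close> \<open>N \<in> C\<close>] show "a \<otimes> b \<in> \<Union>C"
      proof
        assume "M \<subseteq> N"
        then have "a \<otimes> b \<in> N" using CS[OF \<open>N \<in> C\<close>] \<open>a \<in> M\<close> \<open>b \<in> N\<close> subgroup.m_closed[of N G a b] by (simp add: subsetD)
        then show ?thesis by (rule UnionI[OF \<open>N \<in> C\<close>])
      next
        assume "N \<subseteq> M"
        then have "a \<otimes> b \<in> M" using CS[OF \<open>M \<in> C\<close>] \<open>a \<in> M\<close> \<open>b \<in> N\<close> subgroup.m_closed[of M G a b] by (simp add: subsetD)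
        then show ?thesis by (rule UnionI[OF \<open>M \<in> C\<close>])
      qed
    qed
    moreover have "x \<notin> \<Union>C" using CS by auto
    ultimately show "\<Union>C \<in> S" unfolding S_def by simp
  qed
  then obtain M where M: "subgroup M G" "x \<notin> M" and
    max: "\<And>N. subgroup N G \<Longrightarrow> x \<notin> N \<Longrightarrow> M \<subseteq> N \<Longrightarrow> N = M" unfolding S_def by blast
  interpret M: subgroup M G by (rule M)
  have Mc: "m \<in> M \<Longrightarrow> m \<in> carrier G" for m by (rule M.mem_carrier)
  have coprime_pow: "\<exists>j. [i * j = 1] (mod r)" if "\<not> r dvd i" for i :: nat
    using that r cong_solve_coprime_nat[of i r] prime_imp_coprime[OF r that]
    by (auto simp: coprime_commute)
  have red: "a [^] i = a [^] j" if "a \<in> carrier G" "[i = j] (mod r)" for a and i j :: nat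
    using that expo pow_cong by blast
  have dec: "\<exists>i::nat. \<exists>m\<in>M. a = x [^] i \<otimes> m" if a: "a \<in> carrier G" for a
  proof (cases "a \<in> M")
    case True then show ?thesis using a by (intro exI[of _ 0] bexI[of _ a]) auto
  next
    case False
    define N where "N = {a [^] (i::nat) \<otimes> m |i m. m \<in> M}"
    have "subgroup N G"
    proof (rule subgroupI)
      show "N \<subseteq> carrier G" unfolding N_def using a Mc by auto
      show "N \<noteq> {}" unfolding N_def using M.one_closed by blast
    next
      fix u assume "u \<in> N"
      then obtain i m where u: "u = a [^] (i::nat) \<otimes> m" "m \<in> M" unfolding N_def by blast
      have "inv (a [^] i) = a [^] ((r - 1) * i)"
      proof (rule inv_equality)
        have "(r - 1) * i + i = r * i" using prime_gt_0_nat[OF r]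
          by (metis Suc_diff_1 add.commute mult_Suc)
        then show "a [^] ((r - 1) * i) \<otimes> a [^] i = \<one>"
          using a expo by (metis nat_pow_mult nat_pow_one nat_pow_pow)
      qed (use a in auto)
      then have "inv u = a [^] ((r - 1) * i) \<otimes> inv m" using u a Mc by (simp add: inv_mult)
      then show "inv u \<in> N" unfolding N_def using M.m_inv_closed[OF u(2)] by (intro CollectI exI conjI)
    next
      fix u u' assume "u \<in> N" "u' \<in> N"
      then obtain i m i' m' where u: "u = a [^] (i::nat) \<otimes> m" "m \<in> M" "u' = a [^] (i'::nat) \<otimes> m'" "m' \<in> M"
        unfolding N_def by blast
      have "u \<otimes> u' = a [^] (i + i') \<otimes> (m \<otimes> m')" using u a Mc
        by (simp add: nat_pow_mult[symmetric] m_ac)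
      then show "u \<otimes> u' \<in> N" unfolding N_def using M.m_closed[OF u(2,4)] by (intro CollectI exI conjI)
    qed
    moreover have "M \<subseteq> N"
    proof
      fix m assume "m \<in> M"
      then have "m = a [^] (0::nat) \<otimes> m" using Mc by simp
      then show "m \<in> N" unfolding N_def using \<open>m \<in> M\<close> by (intro CollectI exI conjI)
    qed
    moreover have "a \<in> N"
    proof -
      have "a = a [^] (1::nat) \<otimes> \<one>" using a by simp
      then show ?thesis unfolding N_def using M.one_closed by (intro CollectI exI conjI)
    qed
    ultimately have "x \<in> N" using max[of N] False by blast
    then obtain i m where xi: "x = a [^] (i::nat) \<otimes> m" "m \<in> M" unfolding N_def by blast
    have "\<not> r dvd i"
    proof
      assume "r dvd i"
      then have "a [^] i = \<one>" using a expo by (metis dvdE nat_pow_one nat_pow_pow)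
      then show False using xi M(2) Mc by simp
    qed
    then obtain j where j: "[i * j = 1] (mod r)" using coprime_pow by blast
    have "x [^] j = a [^] (i * j) \<otimes> m [^] j" using xi a Mc by (simp add: nat_pow_distrib nat_pow_pow)
    also have "a [^] (i * j) = a" using red[OF a j] a by simp
    finally have "a = x [^] j \<otimes> inv (m [^] j)" using xi a Mc x by (simp add: m_assoc)
    moreover have "m [^] j \<in> M" using xi(2)
      by (induction j) auto
    ultimately show ?thesis using M.m_inv_closed by blast
  qed
  have uniq: "w [^]\<^bsub>H\<^esub> i = w [^]\<^bsub>H\<^esub> j"
    if eq: "x [^] i \<otimes> m = x [^] j \<otimes> m'" and m: "m \<in> M" "m' \<in> M" for i j :: nat and m m'
  proof -
    have *: "[i = j] (mod r)" if le: "i \<le> j" and eq: "x [^] i \<otimes> m = x [^] j \<otimes> m'"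
      and m: "m \<in> M" "m' \<in> M" for i j :: nat and m m'
    proof (rule ccontr)
      assume "\<not> [i = j] (mod r)"
      then have "\<not> r dvd (j - i)" using le cong_altdef_nat[of i j r] by (simp add: cong_sym_eq)
      then obtain k where k: "[(j - i) * k = 1] (mod r)" using coprime_pow by blast
      have "x [^] j = x [^] i \<otimes> x [^] (j - i)" using le x by (simp add: nat_pow_mult)
      then have "m = x [^] (j - i) \<otimes> m'" using eq x Mc m by (simp add: m_assoc)
      then have "x [^] (j - i) = m \<otimes> inv m'" using x Mc m by (simp add: m_assoc)
      then have "x [^] (j - i) \<in> M" using m by simp
      then have "(x [^] (j - i)) [^] k \<in> M" by (induction k) auto
      then have "x \<in> M" using red[OF x(1) k] x by (simp add: nat_pow_pow)
      then show False using M by blast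
    qed
    then have "[i = j] (mod r)" using *[of i j] *[of j i m' m] eq m
      by (metis cong_sym nat_le_linear)
    then show ?thesis using w H.pow_cong by blast
  qed
  define g where "g = (\<lambda>a. SOME i::nat. \<exists>m\<in>M. a = x [^] i \<otimes> m)"
  have g: "\<exists>m\<in>M. a = x [^] (g a) \<otimes> m" if "a \<in> carrier G" for a
    unfolding g_def using someI_ex[OF dec[OF that]] .
  define f where "f = (\<lambda>a. w [^]\<^bsub>H\<^esub> (g a))"
  have fI: "f a = w [^]\<^bsub>H\<^esub> i" if "a = x [^] i \<otimes> m" "m \<in> M" for a and i :: nat and m
  proof -
    have "a \<in> carrier G" using that x Mc by simp
    then obtain m' where "m' \<in> M" "a = x [^] (g a) \<otimes> m'" using g by blast
    then show ?thesis unfolding f_def using that uniq by metis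
  qed
  have "f \<in> hom G H"
  proof (rule homI)
    fix a assume "a \<in> carrier G" then show "f a \<in> carrier H" unfolding f_def using w by simp
  next
    fix a b assume ab: "a \<in> carrier G" "b \<in> carrier G"
    obtain m m' where m: "m \<in> M" "a = x [^] (g a) \<otimes> m" "m' \<in> M" "b = x [^] (g b) \<otimes> m'"
      using g ab by metis
    have "a \<otimes> b = (x [^] (g a) \<otimes> m) \<otimes> (x [^] (g b) \<otimes> m')" using m by metis
    also have "\<dots> = x [^] (g a + g b) \<otimes> (m \<otimes> m')" using m(1,3) x Mc
      by (simp add: nat_pow_mult[symmetric] m_ac)
    finally have "f (a \<otimes> b) = w [^]\<^bsub>H\<^esub> (g a + g b)" using fI m by blast
    then show "f (a \<otimes> b) = f a \<otimes>\<^bsub>H\<^esub> f b" unfolding f_def using w by (simp add: H.nat_pow_mult)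
  qed
  moreover have "f x = w" using fI[of x 1 \<one>] x w M.one_closed by simp
  moreover have "\<forall>a \<in> carrier G. \<exists>i::nat. f a = w [^]\<^bsub>H\<^esub> i" unfolding f_def by blast
  ultimately show ?thesis by blast
qed

text \<open>
  This supplies endomorphisms of a group that is not known to be finite: they detect a given element
  outside a suitable subgroup and have an image of prime order.
\<close>

lemma (in group) exists_hom_of_prime_quotient:
  fixes r :: nat
  assumes r: "Factorial_Ring.prime r" and M: "subgroup M G"
    and comm: "\<And>a b. a \<in> carrier G \<Longrightarrow> b \<in> carrier G \<Longrightarrow> a \<otimes> b \<otimes> inv a \<otimes> inv b \<in> M"
    and pow: "\<And>a. a \<in> carrier G \<Longrightarrow> a [^] r \<in> M"
    and x: "x \<in> carrier G" "x \<notin> M" and w: "w \<in> carrier G" "w [^] r = \<one>"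
  shows "\<exists>f \<in> hom G G. f x = w \<and> (\<forall>a \<in> carrier G. \<exists>i::nat. f a = w [^] i)"
proof -
  interpret M: subgroup M G by (rule M)
  have "M \<lhd> G"
  proof (rule normal_invI[OF M])
    fix a m assume am: "a \<in> carrier G" "m \<in> M"
    have "a \<otimes> m \<otimes> inv a = (a \<otimes> m \<otimes> inv a \<otimes> inv m) \<otimes> m" using am by (simp add: m_assoc)
    then show "a \<otimes> m \<otimes> inv a \<in> M"
      using M.m_closed[OF comm[of a m], of m] am by (metis M.mem_carrier)
  qed
  then interpret M: normal M G .
  let ?Q = "G Mod M"
  interpret Q: group ?Q by (rule M.factorgroup_is_group)
  have h: "(#>) M \<in> hom G ?Q" by (rule M.r_coset_hom_Mod)
  then interpret h: group_hom G ?Q "(#>) M" by unfold_locales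
  have surj: "\<exists>a\<in>carrier G. A = M #> a" if "A \<in> carrier ?Q" for A
    using that unfolding FactGroup_def RCOSETS_def by auto
  have one_iff: "M #> a = \<one>\<^bsub>?Q\<^esub> \<longleftrightarrow> a \<in> M" if "a \<in> carrier G" for a
  proof -
    have "\<one>\<^bsub>?Q\<^esub> = M" unfolding FactGroup_def by simp
    then show ?thesis using that M coset_join1 coset_join2 M.subset by metis
  qed
  have Qc: "comm_group ?Q"
  proof (rule Q.group_comm_groupI)
    fix A B assume "A \<in> carrier ?Q" "B \<in> carrier ?Q"
    then obtain a b where ab: "a \<in> carrier G" "b \<in> carrier G" "A = M #> a" "B = M #> b" using surj by metis
    let ?A = "M #> a" and ?B = "M #> b"
    have Ac: "?A \<in> carrier ?Q" "?B \<in> carrier ?Q" using ab by auto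
    have "M #> (a \<otimes> b \<otimes> inv a \<otimes> inv b) = \<one>\<^bsub>?Q\<^esub>" using one_iff[THEN iffD2, OF _ comm[OF ab(1,2)]] ab(1,2) by blast
    then have "?A \<otimes>\<^bsub>?Q\<^esub> ?B \<otimes>\<^bsub>?Q\<^esub> inv\<^bsub>?Q\<^esub> ?A \<otimes>\<^bsub>?Q\<^esub> inv\<^bsub>?Q\<^esub> ?B = \<one>\<^bsub>?Q\<^esub>"
      using ab(1,2) by (metis h.hom_mult h.hom_inv m_closed inv_closed)
    then show "A \<otimes>\<^bsub>?Q\<^esub> B = B \<otimes>\<^bsub>?Q\<^esub> A" unfolding ab(3,4) using Ac
      by (metis Q.inv_closed Q.inv_equality Q.inv_inv Q.inv_mult_group Q.m_assoc Q.m_closed)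
  qed
  interpret Q: comm_group ?Q by (rule Qc)
  have "\<exists>f \<in> hom ?Q G. f (M #> x) = w \<and> (\<forall>a \<in> carrier ?Q. \<exists>i::nat. f a = w [^] i)"
  proof (rule Q.exists_hom_of_prime_exponent[OF r])
    fix A assume "A \<in> carrier ?Q"
    then obtain a where "a \<in> carrier G" "A = M #> a" using surj by blast
    then show "A [^]\<^bsub>?Q\<^esub> r = \<one>\<^bsub>?Q\<^esub>" using one_iff pow h.hom_nat_pow by (metis nat_pow_closed)
  qed (use x w one_iff h.hom_closed is_group in auto)
  then obtain f where f: "f \<in> hom ?Q G" "f (M #> x) = w" "\<And>a. a \<in> carrier ?Q \<Longrightarrow> \<exists>i::nat. f a = w [^] i"
    by blast
  have "f \<circ> (#>) M \<in> hom G G" using h f(1) unfolding hom_def by (auto simp: Pi_iff)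
  then show ?thesis using f h.hom_closed by (intro bexI[of _ "f \<circ> (#>) M"]) auto
qed

lemma (in comm_group) commutator_one:
  assumes ad: "a \<in> carrier G" "d \<in> carrier G"
  shows "a \<otimes> d \<otimes> inv a \<otimes> inv d = \<one>"
  unfolding m_comm[OF ad] using ad by (simp add: group_normalize)

text \<open>
  Modulo the subgroup of all \<open>[k, b]\<close> with \<open>k\<close> in \<open>K\<close>, the element \<open>b\<close> commutes with \<open>K\<close>, so the
  quotient is abelian.
\<close>

lemma (in group) derived_of_cyclic_by_abelian:
  assumes K: "K \<lhd> G" and Kc: "\<And>x y. x \<in> K \<Longrightarrow> y \<in> K \<Longrightarrow> x \<otimes> y = y \<otimes> x"
    and b: "b \<in> carrier G" and dec: "\<And>g. g \<in> carrier G \<Longrightarrow> \<exists>k\<in>K. \<exists>i::nat. g = k \<otimes> b [^] i"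
  shows "derived G (carrier G) \<subseteq> {k \<otimes> b \<otimes> inv k \<otimes> inv b |k. k \<in> K}"
proof -
  interpret K: normal K G by (rule K)
  note Kcar = K.mem_carrier
  define s where "s = (\<lambda>k. k \<otimes> b \<otimes> inv k \<otimes> inv b)"
  have s_alt: "s k = k \<otimes> (b \<otimes> inv k \<otimes> inv b)" if "k \<in> K" for k
    unfolding s_def using that b Kcar by (simp add: m_assoc)
  have conj: "g \<otimes> k \<otimes> inv g \<in> K" if "g \<in> carrier G" "k \<in> K" for g k using K.inv_op_closed2 that by blast
  have sK: "s k \<in> K" if "k \<in> K" for k using s_alt that conj b by simp
  have s_mult: "s (k \<otimes> l) = s k \<otimes> s l" if kl: "k \<in> K" "l \<in> K" for k l
  proof -
    let ?c = "\<lambda>k. b \<otimes> inv k \<otimes> inv b"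
    have c: "?c k \<in> K" "?c l \<in> K" using conj b kl by auto
    have cm: "?c (k \<otimes> l) = ?c l \<otimes> ?c k" using kl b Kcar by (simp add: group_normalize)
    have "s (k \<otimes> l) = k \<otimes> (l \<otimes> ?c l) \<otimes> ?c k" using s_alt[of "k \<otimes> l"] cm kl c Kcar b by (simp add: m_assoc)
    also have "\<dots> = k \<otimes> (?c k \<otimes> (l \<otimes> ?c l))" using Kc[of "l \<otimes> ?c l" "?c k"] kl c Kcar b by (simp add: m_assoc)
    also have "\<dots> = s k \<otimes> s l" using s_alt kl c Kcar b by (simp add: m_assoc)
    finally show ?thesis .
  qed
  define S where "S = {s k |k. k \<in> K}"
  have s1: "s \<one> = \<one>" unfolding s_def using b by simp
  have SK: "S \<subseteq> K" unfolding S_def using sK by blast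
  have Smult: "x \<otimes> y \<in> S" if xy: "x \<in> S" "y \<in> S" for x y
  proof -
    obtain k l where "k \<in> K" "x = s k" "l \<in> K" "y = s l" using xy unfolding S_def by auto
    then have "x \<otimes> y = s (k \<otimes> l)" "k \<otimes> l \<in> K" using s_mult by auto
    then show ?thesis unfolding S_def by blast
  qed
  have Sinv: "inv x \<in> S" if "x \<in> S" for x
  proof -
    obtain k where k: "k \<in> K" "x = s k" using \<open>x \<in> S\<close> unfolding S_def by blast
    have "s (inv k) \<otimes> s k = \<one>" using s_mult[of "inv k" k] k s1 Kcar by simp
    then have "inv x = s (inv k)" using k sK Kcar by (intro inv_equality) auto
    then show ?thesis using k unfolding S_def by auto
  qed
  have S: "subgroup S G"
  proof (rule subgroupI)
    show "S \<subseteq> carrier G" using SK Kcar by blast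
    show "S \<noteq> {}" unfolding S_def using K.one_closed by blast
  qed (use Smult Sinv in auto)
  have S1: "\<one> \<in> S" using S subgroup.one_closed by blast
  have bS: "b \<otimes> x \<otimes> inv b \<in> S" if "x \<in> S" for x
  proof -
    obtain k where k: "k \<in> K" "x = s k" using \<open>x \<in> S\<close> unfolding S_def by blast
    have "b \<otimes> x \<otimes> inv b = s (b \<otimes> k \<otimes> inv b)"
      unfolding k s_def using k b Kcar by (simp add: group_normalize)
    then show ?thesis using conj[OF b k(1)] unfolding S_def by blast
  qed
  have pS: "k \<otimes> b [^] j \<otimes> inv k \<otimes> inv (b [^] j) \<in> S" if k: "k \<in> K" for k and j :: nat
  proof (induction j)
    case 0 then show ?case using S1 k Kcar by simp
  next
    case (Suc j)
    have B: "b [^] Suc j = b \<otimes> b [^] j" using b pow_commute[of b b j] by simp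
    have "k \<otimes> b [^] Suc j \<otimes> inv k \<otimes> inv (b [^] Suc j)
      = s k \<otimes> (b \<otimes> (k \<otimes> b [^] j \<otimes> inv k \<otimes> inv (b [^] j)) \<otimes> inv b)"
      unfolding B s_def using b k Kcar by (simp add: group_normalize)
    moreover have "s k \<in> S" using k unfolding S_def by blast
    ultimately show ?case using Smult[OF _ bS[OF Suc]] by simp
  qed
  have comm: "g \<otimes> h \<otimes> inv g \<otimes> inv h \<in> S" if gh: "g \<in> carrier G" "h \<in> carrier G" for g h
  proof -
    obtain k i where g: "k \<in> K" "g = k \<otimes> b [^] (i::nat)" using dec gh by blast
    obtain l j where h: "l \<in> K" "h = l \<otimes> b [^] (j::nat)" using dec gh by blast
    define B C where "B = b [^] i" and "C = b [^] j"
    have BC: "B \<in> carrier G" "C \<in> carrier G" "B \<otimes> C = C \<otimes> B"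
      unfolding B_def C_def using b by (auto simp: nat_pow_mult add.commute)
    have kl: "k \<in> carrier G" "l \<in> carrier G" using g h Kcar by auto
    define u where "u = k \<otimes> C \<otimes> inv k \<otimes> inv C"
    define w where "w = l \<otimes> B \<otimes> inv l \<otimes> inv B"
    have uS: "u \<in> S" "w \<in> S" unfolding u_def w_def B_def C_def using pS g h by auto
    have "C \<otimes> inv B = inv B \<otimes> (B \<otimes> C) \<otimes> inv B" using BC(1,2) by (simp add: group_normalize)
    also have "\<dots> = inv B \<otimes> C" unfolding BC(3) using BC(1,2) by (simp add: group_normalize)
    finally have BC': "C \<otimes> inv B = inv B \<otimes> C" .
    have "k \<otimes> (B \<otimes> l \<otimes> inv B) = (B \<otimes> l \<otimes> inv B) \<otimes> k" using Kc[OF g(1) conj[OF BC(1) h(1)]] .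
    then have "k \<otimes> (B \<otimes> l \<otimes> inv B) \<otimes> (C \<otimes> inv k \<otimes> inv C) \<otimes> inv l
      = (B \<otimes> l \<otimes> inv B) \<otimes> u \<otimes> inv l" unfolding u_def using kl BC by (simp add: m_assoc)
    also have "(B \<otimes> l \<otimes> inv B) \<otimes> u = u \<otimes> (B \<otimes> l \<otimes> inv B)"
      using Kc conj[OF BC(1) h(1)] uS SK by blast
    also have "u \<otimes> (B \<otimes> l \<otimes> inv B) \<otimes> inv l = u \<otimes> inv w"
      unfolding w_def u_def using kl BC by (simp add: group_normalize)
    also have "k \<otimes> (B \<otimes> l \<otimes> inv B) \<otimes> (C \<otimes> inv k \<otimes> inv C) \<otimes> inv l = g \<otimes> h \<otimes> inv g \<otimes> inv h"
    proof -
      have "g \<otimes> h \<otimes> inv g \<otimes> inv h = k \<otimes> B \<otimes> l \<otimes> (C \<otimes> inv B) \<otimes> inv k \<otimes> inv C \<otimes> inv l"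
        unfolding g(2) h(2) B_def[symmetric] C_def[symmetric] using kl BC by (simp add: group_normalize)
      then show ?thesis unfolding BC' using kl BC by (simp add: m_assoc)
    qed
    finally show ?thesis using Smult Sinv uS by simp
  qed
  have "derived G (carrier G) \<subseteq> S"
    unfolding derived_def by (rule generate_subgroup_incl[OF _ S]) (use comm in auto)
  then show "derived G (carrier G) \<subseteq> {k \<otimes> b \<otimes> inv k \<otimes> inv b |k. k \<in> K}"
    unfolding S_def s_def .
qed

section \<open>Groups with the endomorphism monoid of a cyclic group\<close>

text \<open>
  Divisibility in the integers modulo a prime power is a total relation, because each element is
  associated to a power of the prime.
\<close>

lemma cong_multiple_total:
  fixes q v i j :: nat
  assumes "Factorial_Ring.prime q"
  shows "(\<exists>w. [i = w * j] (mod q ^ v)) \<or> (\<exists>w. [j = w * i] (mod q ^ v))"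
proof -
  have sol: "\<exists>w. [y = w * x] (mod n)" if "gcd x n dvd gcd y n" for x y n :: nat
  proof -
    have "gcd x n dvd y" using that by (rule dvd_trans) simp
    then obtain k where "y = gcd x n * k" by (rule dvdE)
    moreover obtain u where "[x * u = gcd x n] (mod n)" using cong_solve_nat by blast
    then have "[k * (x * u) = k * gcd x n] (mod n)" by (intro cong_scalar_left)
    ultimately have "[y = (k * u) * x] (mod n)" using cong_sym by (simp add: ac_simps)
    then show ?thesis by blast
  qed
  obtain a where a: "gcd i (q ^ v) = q ^ a" using assms by (metis divides_primepow_nat gcd_dvd2)
  obtain b where b: "gcd j (q ^ v) = q ^ b" using assms by (metis divides_primepow_nat gcd_dvd2)
  show ?thesis using sol[of i "q ^ v" j] sol[of j "q ^ v" i] a b by (metis le_imp_power_dvd nat_le_linear)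
qed

text \<open>
  Here \<open>x\<close> is an element of maximal order \<open>r\<^sup>k\<close>, and by assumption the elements of order \<open>r\<close> form the
  cyclic group generated by a power of \<open>x\<close>. If \<open>y\<^sup>r\<close> is a power of \<open>x\<close>, maximality of the order makes
  it the \<open>r\<close>-th power of a power of \<open>x\<close>; the quotient of the two roots lies in the socle, hence in
  \<open>\<langle>x\<rangle>\<close>.
\<close>

lemma (in comm_group) cyclic_if_unique_socle:
  fixes r k :: nat
  assumes r: "Factorial_Ring.prime r" and k: "k \<ge> 1"
    and expo: "\<And>x. x \<in> carrier G \<Longrightarrow> x [^] (r ^ k) = \<one>"
    and x: "x \<in> carrier G" "x [^] (r ^ (k - 1)) \<noteq> \<one>"
    and soc: "\<And>w. w \<in> carrier G \<Longrightarrow> w [^] r = \<one> \<Longrightarrow> \<exists>i::nat. w = (x [^] (r ^ (k - 1))) [^] i"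
  shows "ord x = r ^ k" and "\<And>y. y \<in> carrier G \<Longrightarrow> \<exists>i::nat. y = x [^] i"
proof -
  have "ord x dvd r ^ k" using expo x pow_eq_id by blast
  then obtain j where j: "ord x = r ^ j" "j \<le> k" using r divides_primepow_nat by blast
  have "\<not> j \<le> k - 1"
  proof
    assume "j \<le> k - 1"
    then have "ord x dvd r ^ (k - 1)" using j le_imp_power_dvd by metis
    then show False using x pow_eq_id by blast
  qed
  then show ox: "ord x = r ^ k" using j k by (metis Suc_diff_1 le_SucE less_eq_Suc_le One_nat_def)
  have "\<exists>i::nat. y = x [^] i" if "y \<in> carrier G" "y [^] (r ^ j) = \<one>" for y and j :: nat
    using that
  proof (induction j arbitrary: y)
    case 0 then show ?case by (intro exI[of _ 0]) simp
  next
    case (Suc j)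
    have "(y [^] r) [^] (r ^ j) = \<one>" using Suc.prems by (simp add: nat_pow_pow)
    then obtain i where i: "y [^] r = x [^] (i::nat)" using Suc.IH[of "y [^] r"] Suc.prems by auto
    have "r * r ^ (k - 1) = r ^ k" using k by (metis Suc_diff_1 less_eq_Suc_le One_nat_def power_Suc)
    then have "x [^] (i * r ^ (k - 1)) = \<one>"
      using expo[OF Suc.prems(1)] i x Suc.prems(1) by (metis nat_pow_pow)
    then have "r ^ k dvd i * r ^ (k - 1)" using ox x pow_eq_id by metis
    then have "r * r ^ (k - 1) dvd i * r ^ (k - 1)" using \<open>r * r ^ (k - 1) = r ^ k\<close> by simp
    then have "r dvd i" using prime_gt_0_nat[OF r] by simp
    then obtain i' where i': "i = r * i'" by blast
    define z where "z = y \<otimes> inv (x [^] i')"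
    have zc: "z \<in> carrier G" unfolding z_def using Suc.prems x by simp
    have "z [^] r = y [^] r \<otimes> inv (x [^] i)"
      unfolding z_def i' using Suc.prems(1) x
      by (simp add: nat_pow_distrib nat_pow_inv nat_pow_pow mult.commute)
    also have "\<dots> = \<one>" using i x by simp
    finally obtain l where l: "z = (x [^] (r ^ (k - 1))) [^] (l::nat)" using soc zc by blast
    have "y = z \<otimes> x [^] i'" unfolding z_def using Suc.prems x by (simp add: m_assoc)
    also have "\<dots> = x [^] (r ^ (k - 1) * l + i')" using l x by (simp add: nat_pow_pow nat_pow_mult)
    finally show ?case by blast
  qed
  then show "\<And>y. y \<in> carrier G \<Longrightarrow> \<exists>i::nat. y = x [^] i" using expo by blast
qed

lemma (in comm_group) power_map_hom: "(\<lambda>x. x [^] (k::nat)) \<in> hom G G"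
  by (rule homI) (auto simp: nat_pow_distrib)

text \<open>
  The hypotheses say that the endomorphism monoid is the multiplicative monoid of the integers modulo
  \<open>q\<^sup>v\<close>. That monoid is commutative and its divisibility relation is total, so the kernels of
  endomorphisms form a chain, and so do their images. Commuting inner automorphisms give class two, so
  \<open>y \<mapsto> [x, y]\<close> is an endomorphism with kernel the centralizer of \<open>x\<close>; as centralizers form a chain, any
  two elements commute. Finitely many power maps bound the exponent, the chain of their images makes it a
  prime power, and the chain of images of order \<open>r\<close> shows that the socle is cyclic. Then the group is
  cyclic, and counting its endomorphisms gives the order.
\<close>

lemma (in group) cyclic_of_End_cyclic:
  fixes \<kappa> :: "nat \<Rightarrow> 'a \<Rightarrow> 'a" and q v :: nat
  assumes q: "Factorial_Ring.prime q" and v: "v \<ge> 1"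
    and hom: "\<And>i. \<kappa> i \<in> hom G G"
    and mult: "\<And>i j x. x \<in> carrier G \<Longrightarrow> \<kappa> (i * j) x = \<kappa> i (\<kappa> j x)"
    and surj: "\<And>f. f \<in> hom G G \<Longrightarrow> \<exists>i. \<forall>x\<in>carrier G. f x = \<kappa> i x"
    and eq: "\<And>i j. (\<forall>x\<in>carrier G. \<kappa> i x = \<kappa> j x) \<longleftrightarrow> [i = j] (mod q ^ v)"
  shows "\<exists>b\<in>carrier G. ord b = q ^ v \<and> (\<forall>y\<in>carrier G. \<exists>i::nat. y = b [^] i)"
proof -
  have homc: "f x \<in> carrier G" if "f \<in> hom G G" "x \<in> carrier G" for f x
    using that by (auto simp: hom_def)
  have commute: "f (g x) = g (f x)" if fg: "f \<in> hom G G" "g \<in> hom G G" and x: "x \<in> carrier G" for f g x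
  proof -
    obtain i j where "\<forall>x\<in>carrier G. f x = \<kappa> i x" "\<forall>x\<in>carrier G. g x = \<kappa> j x"
      using surj[OF fg(1)] surj[OF fg(2)] by blast
    then show ?thesis using fg x mult homc by (metis mult.commute)
  qed
  \<comment> \<open>Divisibility in the monoid is total.\<close>
  have factor: "(\<exists>w\<in>hom G G. \<forall>x\<in>carrier G. f x = w (g x)) \<or> (\<exists>w\<in>hom G G. \<forall>x\<in>carrier G. g x = w (f x))"
    if fg: "f \<in> hom G G" "g \<in> hom G G" for f g
  proof -
    obtain i j where ij: "\<forall>x\<in>carrier G. f x = \<kappa> i x" "\<forall>x\<in>carrier G. g x = \<kappa> j x"
      using surj[OF fg(1)] surj[OF fg(2)] by blast
    show ?thesis using cong_multiple_total[OF q, of i j v]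
    proof
      assume "\<exists>w. [i = w * j] (mod q ^ v)"
      then obtain w where "[i = w * j] (mod q ^ v)" by blast
      then have "\<forall>x\<in>carrier G. f x = \<kappa> w (g x)" using ij eq mult by metis
      then show ?thesis using hom by blast
    next
      assume "\<exists>w. [j = w * i] (mod q ^ v)"
      then obtain w where "[j = w * i] (mod q ^ v)" by blast
      then have "\<forall>x\<in>carrier G. g x = \<kappa> w (f x)" using ij eq mult by metis
      then show ?thesis using hom by blast
    qed
  qed
  have ker_chain: "(\<forall>x\<in>carrier G. g x = \<one> \<longrightarrow> f x = \<one>) \<or> (\<forall>x\<in>carrier G. f x = \<one> \<longrightarrow> g x = \<one>)"
    if "f \<in> hom G G" "g \<in> hom G G" for f g
    using factor[OF that]
  proof
    assume "\<exists>w\<in>hom G G. \<forall>x\<in>carrier G. f x = w (g x)"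
    then show ?thesis using hom_one[OF _ group_axioms group_axioms] by auto
  next
    assume "\<exists>w\<in>hom G G. \<forall>x\<in>carrier G. g x = w (f x)"
    then show ?thesis using hom_one[OF _ group_axioms group_axioms] by auto
  qed
  have img_chain: "(\<forall>x\<in>carrier G. \<exists>y\<in>carrier G. f x = g y) \<or> (\<forall>x\<in>carrier G. \<exists>y\<in>carrier G. g x = f y)"
    if fg: "f \<in> hom G G" "g \<in> hom G G" for f g
    using factor[OF fg]
  proof
    assume "\<exists>w\<in>hom G G. \<forall>x\<in>carrier G. f x = w (g x)"
    then obtain w where w: "w \<in> hom G G" "\<forall>x\<in>carrier G. f x = w (g x)" by blast
    then have "\<forall>x\<in>carrier G. f x = g (w x)" using commute fg by simp
    then show ?thesis using w homc by metis
  next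
    assume "\<exists>w\<in>hom G G. \<forall>x\<in>carrier G. g x = w (f x)"
    then obtain w where w: "w \<in> hom G G" "\<forall>x\<in>carrier G. g x = w (f x)" by blast
    then have "\<forall>x\<in>carrier G. g x = f (w x)" using commute fg by simp
    then show ?thesis using w homc by metis
  qed
  have conj: "(\<lambda>z. x \<otimes> z \<otimes> inv x) \<in> hom G G" if "x \<in> carrier G" for x
    using that by (intro homI) (auto simp: group_normalize)
  \<comment> \<open>Inner automorphisms commute, so these commutators will be central.\<close>
  define c where "c = (\<lambda>x y. inv (x \<otimes> y) \<otimes> (y \<otimes> x))"
  have cc: "c x y \<in> carrier G" if "x \<in> carrier G" "y \<in> carrier G" for x y
    unfolding c_def using that by simp
  have central: "c x y \<otimes> z = z \<otimes> c x y"
    if xyz: "x \<in> carrier G" "y \<in> carrier G" "z \<in> carrier G" for x y z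
  proof -
    have "x \<otimes> (y \<otimes> z \<otimes> inv y) \<otimes> inv x = y \<otimes> (x \<otimes> z \<otimes> inv x) \<otimes> inv y"
      using commute[OF conj conj] xyz by metis
    then have "(x \<otimes> y) \<otimes> z \<otimes> inv (x \<otimes> y) = (y \<otimes> x) \<otimes> z \<otimes> inv (y \<otimes> x)"
      using xyz by (simp add: group_normalize)
    then have "inv (x \<otimes> y) \<otimes> ((x \<otimes> y) \<otimes> z \<otimes> inv (x \<otimes> y)) \<otimes> (y \<otimes> x)
      = inv (x \<otimes> y) \<otimes> ((y \<otimes> x) \<otimes> z \<otimes> inv (y \<otimes> x)) \<otimes> (y \<otimes> x)" by simp
    then show ?thesis unfolding c_def using xyz by (simp add: group_normalize)
  qed
  have yx: "y \<otimes> x = x \<otimes> y \<otimes> c x y" if "x \<in> carrier G" "y \<in> carrier G" for x y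
    unfolding c_def using that by (simp add: group_normalize)
  have chom: "c x \<in> hom G G" if x: "x \<in> carrier G" for x
  proof (rule homI)
    fix y y' assume y: "y \<in> carrier G" "y' \<in> carrier G"
    have C: "c x y \<in> carrier G" "c x y' \<in> carrier G" using cc x y by auto
    have "(y \<otimes> y') \<otimes> x = y \<otimes> (y' \<otimes> x)" using x y by (simp add: m_assoc)
    also have "\<dots> = (y \<otimes> x) \<otimes> (y' \<otimes> c x y')" unfolding yx[OF x y(2)] using x y C by (simp add: m_assoc)
    also have "\<dots> = x \<otimes> y \<otimes> (c x y \<otimes> (y' \<otimes> c x y'))"
      unfolding yx[OF x y(1)] using x y C by (simp add: m_assoc)
    also have "c x y \<otimes> (y' \<otimes> c x y') = y' \<otimes> (c x y \<otimes> c x y')"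
      using x y C central[of x y y'] by (simp flip: m_assoc)
    finally have "x \<otimes> (y \<otimes> y') \<otimes> c x (y \<otimes> y') = x \<otimes> (y \<otimes> y') \<otimes> (c x y \<otimes> c x y')"
      using yx[of x "y \<otimes> y'"] x y by (simp add: m_assoc cc)
    then show "c x (y \<otimes> y') = c x y \<otimes> c x y'" using x y by (simp add: cc)
  qed (use cc x in blast)
  have c1: "c x y = \<one> \<longleftrightarrow> y \<otimes> x = x \<otimes> y" if "x \<in> carrier G" "y \<in> carrier G" for x y
    unfolding c_def using that by (metis inv_closed inv_equality inv_inv m_closed r_inv l_inv)
  interpret comm_group G
  proof (rule group_comm_groupI)
    fix x y assume xy: "x \<in> carrier G" "y \<in> carrier G"
    show "x \<otimes> y = y \<otimes> x"
      using ker_chain[OF chom[OF xy(1)] chom[OF xy(2)]] c1 xy by metis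
  qed
  have pw: "(\<lambda>x. x [^] (k::nat)) \<in> hom G G" for k by (rule power_map_hom)
  \<comment> \<open>There are more exponents up to \<open>q\<^sup>v\<close> than endomorphisms, so two power maps coincide.\<close>
  have expo: "\<exists>m>0. \<forall>x\<in>carrier G. x [^] (m::nat) = \<one>"
  proof -
    define h where "h = (\<lambda>k::nat. (SOME i. \<forall>x\<in>carrier G. x [^] k = \<kappa> i x) mod q ^ v)"
    have h: "\<forall>x\<in>carrier G. x [^] k = \<kappa> (h k) x" for k :: nat
    proof -
      have "\<forall>x\<in>carrier G. x [^] k = \<kappa> (SOME i. \<forall>x\<in>carrier G. x [^] k = \<kappa> i x) x"
        using someI_ex[OF surj[OF pw[of k]]] .
      moreover have "\<forall>x\<in>carrier G. \<kappa> (i mod q ^ v) x = \<kappa> i x" for i using eq by simp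
      ultimately show ?thesis unfolding h_def by simp
    qed
    have "h ` {..q ^ v} \<subseteq> {..<q ^ v}" unfolding h_def using prime_gt_0_nat[OF q] by auto
    then have "\<not> inj_on h {..q ^ v}"
      using card_inj_on_le[of h "{..q ^ v}" "{..<q ^ v}"] by auto
    then obtain i j where "i \<noteq> j" "h i = h j" unfolding inj_on_def by blast
    then obtain i j where ij: "i < j" "h i = h j" by (metis nat_neq_iff)
    have "x [^] (j - i) = \<one>" if x: "x \<in> carrier G" for x
    proof -
      have "x [^] i = x [^] j" using h ij x by metis
      also have "\<dots> = x [^] i \<otimes> x [^] (j - i)" using ij x by (simp add: nat_pow_mult)
      finally show ?thesis using x by simp
    qed
    then show ?thesis using ij by (intro exI[of _ "j - i"]) auto
  qed
  define P where "P = (\<lambda>m::nat. m > 0 \<and> (\<forall>x\<in>carrier G. x [^] m = \<one>))"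
  define m where "m = (LEAST m. P m)"
  have m: "m > 0" "\<And>x. x \<in> carrier G \<Longrightarrow> x [^] m = \<one>"
    using expo LeastI_ex[of P] unfolding m_def P_def by blast+
  have least: "m \<le> m'" if "m' > 0" "\<And>x. x \<in> carrier G \<Longrightarrow> x [^] m' = \<one>" for m'
    using Least_le[of P m'] that unfolding m_def P_def by blast
  have qv: "q ^ v > 1" using q v by (metis one_less_power prime_gt_1_nat less_le_trans zero_less_one)
  have "m \<noteq> 1"
  proof
    assume "m = 1"
    then have triv: "x = \<one>" if "x \<in> carrier G" for x using m(2)[OF that] that by simp
    have "\<forall>x\<in>carrier G. \<kappa> 0 x = \<kappa> 1 x" using triv hom homc by metis
    then have "[0 = 1] (mod q ^ v)" using eq by blast
    then show False using qv mod_less[of 1 "q ^ v"] unfolding unique_euclidean_semiring_class.cong_def by simp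
  qed
  then obtain r where r: "Factorial_Ring.prime r" "r dvd m" using prime_factor_nat by blast
  obtain k m' where km: "m = r ^ k * m'" "\<not> r dvd m'"
    using prime_power_canonical[OF r(1) m(1)] by (metis mult.commute)
  have k: "k \<ge> 1" using km r(2) by (cases k) auto
  have m'0: "m' > 0" using km m(1) by (cases m') auto
  \<comment> \<open>The images of the two power maps have coprime exponents and are comparable, so one of them is trivial.\<close>
  have "m' = 1"
  proof -
    have A: "(x [^] (r ^ k)) [^] (r ^ k) = \<one>" if "x [^] (r ^ k) = y [^] m'" "x \<in> carrier G" "y \<in> carrier G" for x y
      using that m(2)[of y] km by (simp add: nat_pow_pow mult.commute)
    have B: "(x [^] m') [^] m' = \<one>" if "x [^] m' = y [^] (r ^ k)" "x \<in> carrier G" "y \<in> carrier G" for x y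
      using that m(2)[of y] km by (simp add: nat_pow_pow)
    have cop: "coprime (r ^ k) m'" using km r by (simp add: prime_imp_coprime)
    have red: "x = \<one>" if "x [^] a = \<one>" "x [^] b = \<one>" "coprime a b" "x \<in> carrier G" for x and a b :: nat
      using that by (metis coprime_common_divisor_nat ord_eq_1 pow_eq_id)
    show ?thesis using img_chain[OF pw pw, of "r ^ k" m']
    proof
      assume *: "\<forall>x\<in>carrier G. \<exists>y\<in>carrier G. x [^] (r ^ k) = y [^] m'"
      have "x [^] (r ^ k) = \<one>" if x: "x \<in> carrier G" for x
      proof (rule red[OF _ _ cop])
        show "(x [^] (r ^ k)) [^] (r ^ k) = \<one>" using * A x by blast
        show "(x [^] (r ^ k)) [^] m' = \<one>" using m(2)[OF x] km x by (simp add: nat_pow_pow)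
      qed (use x in simp)
      then have "m \<le> r ^ k" using least[of "r ^ k"] prime_gt_0_nat[OF r(1)] by simp
      then show "m' = 1" using km m'0 prime_gt_0_nat[OF r(1)] by (cases m') auto
    next
      assume *: "\<forall>x\<in>carrier G. \<exists>y\<in>carrier G. x [^] m' = y [^] (r ^ k)"
      have "x [^] m' = \<one>" if x: "x \<in> carrier G" for x
      proof (rule red[OF _ _ cop])
        show "(x [^] m') [^] (r ^ k) = \<one>" using m(2)[OF x] km x by (simp add: nat_pow_pow mult.commute)
        show "(x [^] m') [^] m' = \<one>" using * B x by blast
      qed (use x in simp)
      then have "m \<le> m'" using least m'0 by simp
      moreover have "r ^ k > 1" using r(1) k by (metis one_less_power prime_gt_1_nat less_le_trans zero_less_one)
      ultimately show "m' = 1" using km m'0 by simp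
    qed
  qed
  then have mrk: "m = r ^ k" using km by simp
  have expk: "x [^] (r ^ k) = \<one>" if "x \<in> carrier G" for x using m(2)[OF that] mrk by simp
  have "r ^ (k - 1) < r ^ k" using k prime_gt_1_nat[OF r(1)] by (intro power_strict_increasing) auto
  then have "\<not> (\<forall>x\<in>carrier G. x [^] (r ^ (k - 1)) = \<one>)"
    using least[of "r ^ (k - 1)"] mrk prime_gt_0_nat[OF r(1)] by auto
  then obtain x where x: "x \<in> carrier G" "x [^] (r ^ (k - 1)) \<noteq> \<one>" by blast
  define w0 where "w0 = x [^] (r ^ (k - 1))"
  have rk: "r ^ (k - 1) * r = r ^ k" using k by (metis Suc_diff_1 less_eq_Suc_le One_nat_def power_Suc2)
  have w0: "w0 \<in> carrier G" "w0 \<noteq> \<one>" "w0 [^] r = \<one>"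
    using x expk[OF x(1)] rk unfolding w0_def by (simp_all add: nat_pow_pow)
  define M where "M = {y \<in> carrier G. y [^] (r ^ (k - 1)) = \<one>}"
  have M: "subgroup M G"
    unfolding M_def by (rule subgroupI) (auto simp: nat_pow_distrib nat_pow_inv intro: exI[of _ \<one>])
  have ext: "\<exists>f\<in>hom G G. f x = w \<and> (\<forall>a\<in>carrier G. \<exists>i::nat. f a = w [^] i)"
    if w: "w \<in> carrier G" "w [^] r = \<one>" for w
  proof (rule exists_hom_of_prime_quotient[OF r(1) M _ _ x(1) _ w])
    fix a b assume ab: "a \<in> carrier G" "b \<in> carrier G"
    then have "a \<otimes> b \<otimes> inv a \<otimes> inv b = \<one>" unfolding m_comm[OF ab] by (simp add: group_normalize)
    then show "a \<otimes> b \<otimes> inv a \<otimes> inv b \<in> M" using M subgroup.one_closed by metis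
  next
    fix a assume "a \<in> carrier G" then show "a [^] r \<in> M"
      unfolding M_def using expk rk by (simp add: nat_pow_pow mult.commute)
  next
    show "x \<notin> M" unfolding M_def using x by simp
  qed
  have soc: "\<exists>i::nat. w = w0 [^] i" if w: "w \<in> carrier G" "w [^] r = \<one>" for w
  proof -
    obtain f where f: "f \<in> hom G G" "f x = w" "\<And>a. a \<in> carrier G \<Longrightarrow> \<exists>i::nat. f a = w [^] i"
      using ext[OF w] by blast
    obtain g where g: "g \<in> hom G G" "g x = w0" "\<And>a. a \<in> carrier G \<Longrightarrow> \<exists>i::nat. g a = w0 [^] i"
      using ext[OF w0(1,3)] by blast
    show ?thesis using img_chain[OF f(1) g(1)]
    proof
      assume "\<forall>x\<in>carrier G. \<exists>y\<in>carrier G. f x = g y"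
      then show ?thesis using f(2) g(3) x by metis
    next
      assume "\<forall>x\<in>carrier G. \<exists>y\<in>carrier G. g x = f y"
      then obtain i where i: "w0 = w [^] (i::nat)" using g(2) f(3) x by metis
      have "\<not> r dvd i"
      proof
        assume "r dvd i"
        then have "w [^] i = \<one>" using w by (metis dvdE nat_pow_one nat_pow_pow)
        then show False using i w0 by simp
      qed
      then obtain j where j: "[i * j = 1] (mod r)"
        using cong_solve_coprime_nat[of i r] prime_imp_coprime[OF r(1), of i] by (auto simp: coprime_commute)
      have "w0 [^] j = w" using pow_cong[OF w j] i w by (simp add: nat_pow_pow)
      then show ?thesis by metis
    qed
  qed
  have ox: "ord x = r ^ k" and gen: "\<And>y. y \<in> carrier G \<Longrightarrow> \<exists>i::nat. y = x [^] i"
    using cyclic_if_unique_socle[OF r(1) k expk x soc[unfolded w0_def]] by blast+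
  \<comment> \<open>An endomorphism is determined by the image of \<open>x\<close>, so there are \<open>r\<^sup>k\<close> of them.\<close>
  have hom_pow: "f (a [^] (i::nat)) = f a [^] i" if "f \<in> hom G G" "a \<in> carrier G" for f a i
  proof -
    interpret f: group_hom G G f by unfold_locales (rule that)
    show ?thesis using that f.hom_nat_pow by blast
  qed
  have det: "f y = f' y" if f: "f \<in> hom G G" "f' \<in> hom G G" "f x = f' x" and y: "y \<in> carrier G" for f f' y
  proof -
    obtain i where "y = x [^] (i::nat)" using gen y by blast
    then show ?thesis using hom_pow[OF f(1) x(1)] hom_pow[OF f(2) x(1)] f(3) by simp
  qed
  have xk: "x [^] (r ^ k) = \<one>" using expk x by blast
  have xp: "x [^] i = x [^] j \<longleftrightarrow> [i = j] (mod r ^ k)" for i j :: nat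
    using pow_eq_iff_cong_ord[OF x(1)] ox by simp
  define g where "g = (\<lambda>i. (SOME a::nat. \<kappa> i x = x [^] a) mod r ^ k)"
  have g: "\<kappa> i x = x [^] (g i)" for i
  proof -
    have "\<kappa> i x = x [^] (SOME a::nat. \<kappa> i x = x [^] a)"
      using someI_ex[OF gen[OF homc[OF hom x(1)]]] .
    moreover have "x [^] (b mod r ^ k) = x [^] b" for b :: nat using xp by simp
    ultimately show ?thesis unfolding g_def by simp
  qed
  have "bij_betw g {..<q ^ v} {..<r ^ k}"
    unfolding bij_betw_def
  proof
    show "inj_on g {..<q ^ v}"
    proof (rule inj_onI)
      fix i j assume ij: "i \<in> {..<q ^ v}" "j \<in> {..<q ^ v}" "g i = g j"
      then have "\<forall>y\<in>carrier G. \<kappa> i y = \<kappa> j y" using det[OF hom hom] g by metis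
      then have "[i = j] (mod q ^ v)" using eq by blast
      then show "i = j" using ij by (simp add: unique_euclidean_semiring_class.cong_def)
    qed
    have lt: "g i < r ^ k" for i unfolding g_def using prime_gt_0_nat[OF r(1)] by simp
    show "g ` {..<q ^ v} = {..<r ^ k}"
    proof (intro equalityI subsetI)
      fix a assume "a \<in> {..<r ^ k}"
      then have a: "a < r ^ k" by simp
      obtain i where i: "\<forall>y\<in>carrier G. y [^] a = \<kappa> i y" using surj[OF pw] by blast
      have "\<forall>y\<in>carrier G. \<kappa> (i mod q ^ v) y = \<kappa> i y" using eq by simp
      then have "x [^] a = x [^] g (i mod q ^ v)" using i x g by metis
      then have "a = g (i mod q ^ v)" using xp a lt by (simp add: unique_euclidean_semiring_class.cong_def)
      moreover have "i mod q ^ v < q ^ v" using prime_gt_0_nat[OF q] by simp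
      ultimately show "a \<in> g ` {..<q ^ v}" by blast
    qed (use lt in auto)
  qed
  then have "q ^ v = r ^ k" using bij_betw_same_card by fastforce
  then show ?thesis using ox gen x by metis
qed

section \<open>Finite fields generated by a root of unity\<close>

lemma (in cring) binomial_expansion:
  assumes x: "x \<in> carrier R" and y: "y \<in> carrier R"
  shows "(x \<oplus> y) [^] (n::nat) = (\<Oplus>k\<in>{..n}. add_pow R (n choose k) (x [^] k \<otimes> y [^] (n - k)))"
proof (induction n)
  case 0 show ?case using x y by simp
next
  case (Suc n)
  define a where "a = (\<lambda>k. add_pow R (n choose k) (x [^] k \<otimes> y [^] (n - k)))"
  define a' where "a' = (\<lambda>k. add_pow R (Suc n choose k) (x [^] k \<otimes> y [^] (Suc n - k)))"
  define b where "b = (\<lambda>k. add_pow R (n choose k) (x [^] k \<otimes> y [^] (Suc n - k)))"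
  have cl: "a k \<in> carrier R" "a' k \<in> carrier R" "b k \<in> carrier R" for k
    unfolding a_def a'_def b_def using x y by auto
  have xa: "x \<otimes> a k = add_pow R (n choose k) (x [^] Suc k \<otimes> y [^] (n - k))" for k
    unfolding a_def using x y by (simp add: add_pow_rdistr m_ac)
  have ya: "y \<otimes> a k = b k" if "k \<le> n" for k
  proof -
    have "Suc n - k = Suc (n - k)" using that by simp
    then show ?thesis unfolding a_def b_def using x y by (simp add: add_pow_rdistr m_ac)
  qed
  have a'Suc: "a' (Suc k) = x \<otimes> a k \<oplus> b (Suc k)" for k
    unfolding xa b_def a'_def using x y by (simp add: add.nat_pow_mult[symmetric])
  have "(x \<oplus> y) [^] Suc n = (x \<oplus> y) \<otimes> (\<Oplus>k\<in>{..n}. a k)"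
    using Suc x y unfolding a_def by (simp add: m_comm)
  also have "\<dots> = (\<Oplus>k\<in>{..n}. x \<otimes> a k) \<oplus> (\<Oplus>k\<in>{..n}. y \<otimes> a k)"
    using x y cl by (simp add: l_distr finsum_rdistr Pi_def)
  also have "(\<Oplus>k\<in>{..n}. y \<otimes> a k) = (\<Oplus>k\<in>{..n}. b k)"
    by (rule finsum_cong') (use ya cl in auto)
  also have "\<dots> = (\<Oplus>k\<in>{..Suc n}. b k)"
  proof -
    have "b (Suc n) = \<zero>" unfolding b_def using x y by (simp add: binomial_eq_0)
    then show ?thesis using cl by (simp add: Pi_def)
  qed
  also have "\<dots> = (\<Oplus>k\<in>{..n}. b (Suc k)) \<oplus> b 0"
    using cl by (subst finsum_Suc2) auto
  also have "(\<Oplus>k\<in>{..n}. x \<otimes> a k) \<oplus> ((\<Oplus>k\<in>{..n}. b (Suc k)) \<oplus> b 0)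
    = (\<Oplus>k\<in>{..n}. a' (Suc k)) \<oplus> b 0"
    unfolding a'Suc using x cl by (subst finsum_addf) (auto simp: a_assoc)
  also have "b 0 = a' 0" unfolding b_def a'_def by simp
  also have "(\<Oplus>k\<in>{..n}. a' (Suc k)) \<oplus> a' 0 = (\<Oplus>k\<in>{..Suc n}. a' k)"
    using cl by (subst finsum_Suc2) auto
  finally show ?case unfolding a'_def .
qed

text \<open>
  In characteristic \<open>p\<close> the inner binomial coefficients vanish.
\<close>

lemma (in cring) freshmans_dream:
  fixes p :: nat
  assumes p: "Factorial_Ring.prime p" and char: "add_pow R p \<one> = \<zero>"
    and x: "x \<in> carrier R" and y: "y \<in> carrier R"
  shows "(x \<oplus> y) [^] p = x [^] p \<oplus> y [^] p"
proof -
  obtain m where m: "p = Suc (Suc m)" using prime_ge_2_nat[OF p] by (metis add_2_eq_Suc le_Suc_ex)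
  define a where "a = (\<lambda>k. add_pow R (p choose k) (x [^] k \<otimes> y [^] (p - k)))"
  have cl: "a k \<in> carrier R" for k unfolding a_def using x y by auto
  have z: "a k = \<zero>" if k: "0 < k" "k < p" for k
  proof -
    have "p dvd k * (p choose k)" using times_binomial_minus1_eq[OF k(1), of p] by simp
    moreover have "\<not> p dvd k" using k nat_dvd_not_less by blast
    ultimately have "p dvd (p choose k)" using p prime_dvd_mult_nat by blast
    then obtain c where c: "(p choose k) = p * c" by blast
    let ?t = "x [^] k \<otimes> y [^] (p - k)"
    have t: "?t \<in> carrier R" using x y by simp
    have "add_pow R p (\<one> \<otimes> ?t) = (add_pow R p \<one>) \<otimes> ?t" by (rule add_pow_ldistr[symmetric]) (use t in auto)
    then have "add_pow R p ?t = \<zero>" using char t by simp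
    then have "add_pow R (p * c) ?t = \<zero>" using t add.nat_pow_pow[OF t, of c p] by simp
    then show ?thesis unfolding a_def c .
  qed
  have "(x \<oplus> y) [^] p = (\<Oplus>k\<in>{..p}. a k)" unfolding a_def by (rule binomial_expansion[OF x y])
  also have "\<dots> = a p \<oplus> (\<Oplus>k\<in>{..Suc m}. a k)" unfolding m using cl by (simp add: Pi_def)
  also have "(\<Oplus>k\<in>{..Suc m}. a k) = (\<Oplus>k\<in>{..m}. a (Suc k)) \<oplus> a 0" using cl by (subst finsum_Suc2) auto
  also have "(\<Oplus>k\<in>{..m}. a (Suc k)) = (\<Oplus>k\<in>{..m}. \<zero>)"
    by (rule finsum_cong') (use z m in auto)
  finally show ?thesis unfolding a_def using x y by simp
qed

text \<open>
  The assumption \<open>irr\<close> says that \<open>F\<close> is generated by \<open>\<zeta>\<close> over its prime field, phrased as irreducibility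
  of the additive group under multiplication by \<open>\<zeta>\<close>. In this form it serves as an induction principle.
\<close>

locale cyclotomic_field = field F for F (structure) +
  fixes \<zeta> :: 'a and p q n :: nat
  assumes fin: "finite (carrier F)" and p: "Factorial_Ring.prime p" and q: "Factorial_Ring.prime q"
    and pq: "p \<noteq> q" and card: "card (carrier F) = p ^ n"
    and zeta: "\<zeta> \<in> carrier F" "\<zeta> [^] q = \<one>" "\<zeta> \<noteq> \<one>"
    and irr: "\<And>S. subgroup S (add_monoid F) \<Longrightarrow> (\<And>x. x \<in> S \<Longrightarrow> \<zeta> \<otimes> x \<in> S) \<Longrightarrow> S \<noteq> {\<zero>} \<Longrightarrow> S = carrier F"
begin

text \<open>
  The elements with property \<open>P\<close> form a subgroup invariant under \<open>\<zeta>\<close>, so it is enough that it contains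
  one nonzero element. Below, \<open>z\<close> is usually \<open>\<one>\<close>.
\<close>

lemma span_induct:
  assumes z: "z \<in> carrier F" "z \<noteq> \<zero>" "P z"
    and add: "\<And>x y. x \<in> carrier F \<Longrightarrow> y \<in> carrier F \<Longrightarrow> P x \<Longrightarrow> P y \<Longrightarrow> P (x \<oplus> y)"
    and neg: "\<And>x. x \<in> carrier F \<Longrightarrow> P x \<Longrightarrow> P (\<ominus> x)"
    and mul: "\<And>x. x \<in> carrier F \<Longrightarrow> P x \<Longrightarrow> P (\<zeta> \<otimes> x)"
    and x: "x \<in> carrier F"
  shows "P x"
proof -
  define S where "S = {x \<in> carrier F. P x}"
  have "subgroup S (add_monoid F)"
    by (rule add.subgroupI) (use z add neg in \<open>auto simp: S_def simp flip: a_inv_def\<close>)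
  moreover have "S \<noteq> {\<zero>}" using z unfolding S_def by blast
  ultimately have "S = carrier F" using irr[of S] mul zeta unfolding S_def by auto
  then show ?thesis using x unfolding S_def by blast
qed

lemma zeta_nonzero: "\<zeta> \<noteq> \<zero>"
  using zeta prime_gt_0_nat[OF q] by (metis nat_pow_zero neq0_conv zero_not_one)

lemma unit_inv:
  assumes "a \<in> carrier F" "a \<noteq> \<zero>"
  shows "inv a \<in> carrier F" "inv a \<otimes> a = \<one>" "a \<otimes> inv a = \<one>" "inv a \<noteq> \<zero>"
    "\<And>x. x \<in> carrier F \<Longrightarrow> inv a \<otimes> (a \<otimes> x) = x" "\<And>x. x \<in> carrier F \<Longrightarrow> a \<otimes> (inv a \<otimes> x) = x"
proof -
  have U: "a \<in> Units F" using assms field_Units by blast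
  then show 1: "inv a \<in> carrier F" "inv a \<otimes> a = \<one>" "a \<otimes> inv a = \<one>" by auto
  then show "inv a \<noteq> \<zero>" using assms(1) by force
  show "\<And>x. x \<in> carrier F \<Longrightarrow> inv a \<otimes> (a \<otimes> x) = x" "\<And>x. x \<in> carrier F \<Longrightarrow> a \<otimes> (inv a \<otimes> x) = x"
    using 1 assms by (simp_all flip: m_assoc)
qed

lemma zeta_pow: "\<zeta> [^] (i::nat) = \<zeta> [^] j \<longleftrightarrow> [i = j] (mod q)"
proof -
  interpret M: group "Multiplicative_Group.mult_of F" rewrites "([^]\<^bsub>Multiplicative_Group.mult_of F\<^esub>) = (([^]) :: _ \<Rightarrow> nat \<Rightarrow> _)" and "\<one>\<^bsub>Multiplicative_Group.mult_of F\<^esub> = \<one>"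
    by (rule field_mult_group) (simp_all add: fun_eq_iff nat_pow_def)
  have z: "\<zeta> \<in> carrier (Multiplicative_Group.mult_of F)" using zeta zeta_nonzero by simp
  have "M.ord \<zeta> dvd q" using M.pow_eq_id[OF z] zeta by blast
  moreover have "M.ord \<zeta> \<noteq> 1" using M.ord_eq_1[OF z] zeta by blast
  ultimately have "M.ord \<zeta> = q" using q prime_nat_iff by blast
  then show ?thesis using M.pow_eq_iff_cong_ord[OF z] by simp
qed

lemma zeta_pow_one: "\<zeta> [^] (i::nat) = \<one> \<longleftrightarrow> q dvd i"
  using zeta_pow[of i 0] by (simp add: cong_0_iff)

definition zinv where "zinv = \<zeta> [^] (q - 1)"

lemma zinv: "zinv \<in> carrier F" "\<zeta> \<otimes> zinv = \<one>" "zinv \<otimes> \<zeta> = \<one>"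
proof -
  show 1: "zinv \<in> carrier F" unfolding zinv_def using zeta by simp
  have "\<zeta> [^] (q - 1) \<otimes> \<zeta> = \<zeta> [^] q" using prime_gt_0_nat[OF q] by (metis Suc_diff_1 nat_pow_Suc)
  then show 2: "zinv \<otimes> \<zeta> = \<one>" unfolding zinv_def using zeta by simp
  show "\<zeta> \<otimes> zinv = \<one>" using 1 2 zeta by (simp add: m_comm)
qed

lemma roots_of_unity:
  assumes x: "x \<in> carrier F" "x [^] q = \<one>"
  shows "\<exists>i::nat. x = \<zeta> [^] i"
proof -
  let ?R = "{x \<in> carrier F. x [^] q = \<one>}"
  have q0: "q \<noteq> 0" using prime_gt_0_nat[OF q] by simp
  have sub: "(\<lambda>i::nat. \<zeta> [^] i) ` {..<q} \<subseteq> ?R"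
    using zeta by (auto simp: nat_pow_pow zeta_pow_one)
  have "inj_on (\<lambda>i::nat. \<zeta> [^] i) {..<q}"
    by (rule inj_onI) (auto simp: zeta_pow unique_euclidean_semiring_class.cong_def)
  then have "card ((\<lambda>i::nat. \<zeta> [^] i) ` {..<q}) = q" by (simp add: card_image)
  moreover have "finite ?R" using fin by simp
  ultimately have "(\<lambda>i::nat. \<zeta> [^] i) ` {..<q} = ?R"
    using card_seteq[OF \<open>finite ?R\<close> sub] num_roots_le_deg[OF fin q0] by simp
  then show ?thesis using x by blast
qed

lemma char_p: "x \<in> carrier F \<Longrightarrow> add_pow F p x = \<zero>"
proof -
  have pow: "add_pow F (p ^ m) \<one> = (add_pow F p \<one>) [^] m" for m
  proof (induction m)
    case (Suc m)
    have "add_pow F (p ^ Suc m) \<one> = add_pow F p (add_pow F (p ^ m) \<one>)"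
      using add.nat_pow_pow[of \<one> p "p ^ m"] by (simp only: power_Suc2) simp
    also have "\<dots> = add_pow F p (\<one> \<otimes> (add_pow F (p ^ m) \<one>))" by simp
    also have "\<dots> = (add_pow F p \<one>) \<otimes> (add_pow F (p ^ m) \<one>)" by (rule add_pow_ldistr[symmetric]) auto
    finally show ?case using Suc by (simp add: m_comm)
  qed simp
  have "add_pow F (p ^ n) \<one> = \<zero>"
    using add.pow_order_eq_1[of \<one>] card by (simp add: order_def)
  then have "(add_pow F p \<one>) [^] n = \<zero>" using pow by simp
  moreover have "a = \<zero>" if "a [^] m = \<zero>" "a \<in> carrier F" for a and m :: nat
    using that by (induction m) (auto simp: integral_iff)
  ultimately have p1: "add_pow F p \<one> = \<zero>" by blast
  assume x: "x \<in> carrier F"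
  have "add_pow F p (\<one> \<otimes> x) = (add_pow F p \<one>) \<otimes> x" by (rule add_pow_ldistr[symmetric]) (use x in auto)
  then show ?thesis using p1 x by simp
qed

definition frob where "frob m = (\<lambda>x. x [^] (p ^ m :: nat))"

lemma frob_hom: "frob m \<in> ring_hom F F"
proof (induction m)
  case 0
  show ?case unfolding frob_def by (rule ring_hom_memI) auto
next
  case (Suc m)
  show ?case
  proof (rule ring_hom_memI)
    fix x y assume xy: "x \<in> carrier F" "y \<in> carrier F"
    have *: "frob (Suc m) z = (frob m z) [^] p" if "z \<in> carrier F" for z
      unfolding frob_def using that by (simp add: nat_pow_pow mult.commute)
    have "frob m x \<in> carrier F" "frob m y \<in> carrier F" using xy unfolding frob_def by auto
    then show "frob (Suc m) (x \<oplus> y) = frob (Suc m) x \<oplus> frob (Suc m) y"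
      using * xy ring_hom_add[OF Suc xy] freshmans_dream[OF p char_p] by simp
  qed (auto simp: frob_def nat_pow_distrib)
qed

lemma roots_bound:
  assumes "d > 0" "\<And>x. x \<in> carrier F \<Longrightarrow> x \<noteq> \<zero> \<Longrightarrow> x [^] (d::nat) = \<one>"
  shows "p ^ n - 1 \<le> d"
proof -
  have "carrier F - {\<zero>} \<subseteq> {x \<in> carrier F. x [^] d = \<one>}" using assms by blast
  then have "card (carrier F - {\<zero>}) \<le> card {x \<in> carrier F. x [^] d = \<one>}" using fin by (intro card_mono) auto
  also have "\<dots> \<le> d" using num_roots_le_deg[OF fin] assms(1) by simp
  finally show ?thesis using card fin by (simp add: card_Diff_singleton)
qed

lemma n_pos: "n > 0"
proof (rule ccontr)
  assume "\<not> n > 0"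
  then have "card (carrier F) = 1" using card by simp
  then obtain a where "carrier F = {a}" using card_1_singletonE by blast
  then show False using zero_closed one_closed zero_not_one by force
qed

lemma fermat:
  assumes "x \<in> carrier F" shows "x [^] (p ^ n) = x"
proof (cases "x = \<zero>")
  case True then show ?thesis using prime_gt_0_nat[OF p] by (simp add: nat_pow_zero)
next
  case False
  interpret M: group "Multiplicative_Group.mult_of F" rewrites "([^]\<^bsub>Multiplicative_Group.mult_of F\<^esub>) = (([^]) :: _ \<Rightarrow> nat \<Rightarrow> _)" and "\<one>\<^bsub>Multiplicative_Group.mult_of F\<^esub> = \<one>"
    by (rule field_mult_group) (simp_all add: fun_eq_iff nat_pow_def)
  have "order (Multiplicative_Group.mult_of F) = p ^ n - 1" using order_mult_of[OF fin] card by (simp add: order_def)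
  then have "x [^] (p ^ n - 1) = \<one>" using M.pow_order_eq_1[of x] assms False by simp
  moreover have "x [^] (p ^ n) = x [^] (p ^ n - 1) \<otimes> x"
    using prime_gt_0_nat[OF p] by (metis Suc_diff_1 nat_pow_Suc zero_less_power)
  ultimately show ?thesis using assms by simp
qed

lemma q_dvd: "q dvd p ^ n - 1"
proof -
  have "\<zeta> [^] (p ^ n) = \<zeta> [^] (1::nat)" using fermat[OF zeta(1)] zeta by simp
  then have "[p ^ n = 1] (mod q)" using zeta_pow by blast
  then show ?thesis using prime_gt_0_nat[OF p] by (simp add: cong_altdef_nat)
qed

text \<open>
  If \<open>q\<close> divides \<open>p\<^sup>m - 1\<close>, then the \<open>m\<close>-th power of the Frobenius map fixes \<open>\<zeta>\<close>, hence all of \<open>F\<close>, and a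
  polynomial of degree \<open>p\<^sup>m\<close> has at most \<open>p\<^sup>m\<close> roots.
\<close>

lemma n_le:
  assumes m: "m > 0" "q dvd p ^ m - 1"
  shows "n \<le> m"
proof -
  have pm: "p ^ m > 1" using m prime_gt_1_nat[OF p] by (intro one_less_power) auto
  have h: "frob m \<in> ring_hom F F" by (rule frob_hom)
  interpret h: ring_hom_cring F F "frob m" by unfold_locales (rule h)
  have "[p ^ m = 1] (mod q)" using m pm by (simp add: cong_altdef_nat)
  then have fz: "frob m \<zeta> = \<zeta>" unfolding frob_def using zeta_pow[of "p ^ m" 1] zeta by simp
  have fixd: "frob m x = x" if "x \<in> carrier F" for x
    by (rule span_induct[where P = "\<lambda>x. frob m x = x" and z = \<one>]) (use that fz zeta in auto)
  have "x [^] (p ^ m - 1) = \<one>" if x: "x \<in> carrier F" "x \<noteq> \<zero>" for x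
  proof -
    have "x [^] (p ^ m - 1) \<otimes> x = \<one> \<otimes> x"
      using fixd[OF x(1)] pm x unfolding frob_def by (metis Suc_diff_1 l_one less_imp_le less_le_trans nat_pow_Suc zero_less_one)
    then show ?thesis using x m_rcancel by (metis nat_pow_closed one_closed)
  qed
  then have "p ^ n - 1 \<le> p ^ m - 1" using roots_bound pm by simp
  then have "p ^ n \<le> p ^ m" using pm by simp
  then show ?thesis using prime_gt_1_nat[OF p] by (metis power_le_imp_le_exp)
qed

lemma additive_zero_neg:
  assumes "\<And>x. x \<in> carrier F \<Longrightarrow> f x \<in> carrier F"
    and "\<And>x y. x \<in> carrier F \<Longrightarrow> y \<in> carrier F \<Longrightarrow> f (x \<oplus> y) = f x \<oplus> f y"
  shows "f \<zero> = \<zero>" and "\<And>x. x \<in> carrier F \<Longrightarrow> f (\<ominus> x) = \<ominus> f x"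
proof -
  have "f \<zero> \<oplus> f \<zero> = f \<zero>" using assms(2)[of \<zero> \<zero>] by simp
  then show z: "f \<zero> = \<zero>" using assms(1) by (metis add.r_cancel_one' zero_closed)
  fix x assume x: "x \<in> carrier F"
  have "f (\<ominus> x) \<oplus> f x = \<zero>" using assms(2)[of "\<ominus> x" x] x z by (simp add: l_neg)
  then show "f (\<ominus> x) = \<ominus> f x" using assms(1) x by (metis a_inv_closed minus_equality)
qed

text \<open>
  Dividing by the value at \<open>\<one>\<close> gives a map that sends \<open>\<zeta> \<otimes> x\<close> to \<open>z \<otimes> \<tau> x\<close>. Being multiplicative in the
  first argument is then a property closed under sums and under multiplication by \<open>\<zeta>\<close>.
\<close>

lemma semilinear:
  assumes f: "\<And>x. x \<in> carrier F \<Longrightarrow> f x \<in> carrier F"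
    and add: "\<And>x y. x \<in> carrier F \<Longrightarrow> y \<in> carrier F \<Longrightarrow> f (x \<oplus> y) = f x \<oplus> f y"
    and z: "z \<in> carrier F" and mul: "\<And>x. x \<in> carrier F \<Longrightarrow> f (\<zeta> \<otimes> x) = z \<otimes> f x"
    and nz: "f \<one> \<noteq> \<zero>"
  shows "\<exists>\<tau>\<in>ring_hom F F. \<tau> \<zeta> = z \<and> (\<forall>x\<in>carrier F. f x = f \<one> \<otimes> \<tau> x)"
proof -
  note inv = unit_inv[OF f[OF one_closed] nz]
  define t where "t = (\<lambda>x. inv (f \<one>) \<otimes> f x)"
  have tc: "t x \<in> carrier F" if "x \<in> carrier F" for x unfolding t_def using that f inv by simp
  have ta: "t (x \<oplus> y) = t x \<oplus> t y" if "x \<in> carrier F" "y \<in> carrier F" for x y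
    unfolding t_def using that f inv add by (simp add: r_distr)
  have tz: "t (\<zeta> \<otimes> x) = z \<otimes> t x" if "x \<in> carrier F" for x
    unfolding t_def using that f inv z mul by (simp add: m_lcomm)
  have t1: "t \<one> = \<one>" unfolding t_def using inv by simp
  note tn = additive_zero_neg[of t, OF tc ta]
  have tm: "\<forall>y\<in>carrier F. t (x \<otimes> y) = t x \<otimes> t y" if x: "x \<in> carrier F" for x
    by (rule span_induct[where z = \<one> and P = "\<lambda>x. \<forall>y\<in>carrier F. t (x \<otimes> y) = t x \<otimes> t y"])
      (use x t1 ta tc tz tn zeta z in \<open>auto simp: l_distr l_minus m_assoc\<close>)
  have "t \<in> ring_hom F F" by (rule ring_hom_memI) (use tc ta tm t1 in auto)
  moreover have "t \<zeta> = z" using tz[OF one_closed] t1 zeta z by simp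
  moreover have "f x = f \<one> \<otimes> t x" if "x \<in> carrier F" for x unfolding t_def using that f inv by simp
  ultimately show ?thesis by blast
qed

end

locale field_involution = field F for F (structure) +
  fixes \<eta> :: "'a \<Rightarrow> 'a"
  assumes hom: "\<eta> \<in> ring_hom F F" and invol: "\<And>x. x \<in> carrier F \<Longrightarrow> \<eta> (\<eta> x) = x"
    and nontriv: "\<exists>x\<in>carrier F. \<eta> x \<noteq> x"
begin

sublocale h: ring_hom_cring F F \<eta>
  by unfold_locales (rule hom)

definition fixed where "fixed = {x \<in> carrier F. \<eta> x = x}"

text \<open>
  For \<open>w = x \<ominus> \<eta> x \<noteq> \<zero>\<close> the quotient of two elements negated by \<open>\<eta>\<close> is fixed by \<open>\<eta>\<close>, so these elements
  form the line through \<open>w\<close> over the fixed field.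
\<close>

lemma decompose:
  obtains x w where "x \<in> carrier F" "w \<in> carrier F" "w \<noteq> \<zero>" "w = x \<ominus> \<eta> x" "\<eta> w = \<ominus> w"
    "\<And>y. y \<in> carrier F \<Longrightarrow> \<eta> y = \<ominus> y \<Longrightarrow> \<exists>c\<in>fixed. y = c \<otimes> w"
proof -
  obtain x where x: "x \<in> carrier F" "\<eta> x \<noteq> x" using nontriv by blast
  define w where "w = x \<ominus> \<eta> x"
  have w: "w \<in> carrier F" unfolding w_def using x by simp
  have w0: "w \<noteq> \<zero>" unfolding w_def using x by (metis r_right_minus_eq h.hom_closed)
  have sw: "\<eta> w = \<ominus> w" unfolding w_def a_minus_def using x invol by (simp add: minus_add a_comm)
  have "\<exists>c\<in>fixed. y = c \<otimes> w" if y: "y \<in> carrier F" "\<eta> y = \<ominus> y" for y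
  proof
    have U: "w \<in> Units F" using w w0 field_Units by blast
    then have iw: "inv w \<in> carrier F" "inv w \<otimes> w = \<one>" by auto
    show "y = (y \<otimes> inv w) \<otimes> w" using y w iw by (simp add: m_assoc)
    have "\<eta> (y \<otimes> inv w) \<otimes> w = y \<otimes> inv w \<otimes> w"
    proof -
      have "\<eta> (inv w) \<otimes> \<eta> w = \<one>" using iw w h.hom_mult[of "inv w" w] by simp
      then have "\<ominus> (\<eta> (inv w) \<otimes> w) = \<one>" using sw w iw by (simp add: r_minus)
      then have "\<ominus> y \<otimes> \<eta> (inv w) \<otimes> w = y" using y w iw
        by (metis (no_types, lifting) h.hom_closed l_minus m_assoc m_closed r_minus r_one)
      then show ?thesis using y w iw by (simp add: m_assoc)
    qed
    then have "\<eta> (y \<otimes> inv w) = y \<otimes> inv w" using m_rcancel[OF w0] y w iw by simp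
    then show "y \<otimes> inv w \<in> fixed" unfolding fixed_def using y iw by simp
  qed
  then show thesis using that x w w0 sw w_def by blast
qed

lemma anti_fixed_is_difference:
  assumes y: "y \<in> carrier F" "\<eta> y = \<ominus> y"
  shows "\<exists>z\<in>carrier F. y = z \<ominus> \<eta> z"
proof -
  obtain x w where xw: "x \<in> carrier F" "w = x \<ominus> \<eta> x"
    "\<And>y. y \<in> carrier F \<Longrightarrow> \<eta> y = \<ominus> y \<Longrightarrow> \<exists>c\<in>fixed. y = c \<otimes> w" using decompose by metis
  obtain c where c: "c \<in> carrier F" "\<eta> c = c" "y = c \<otimes> w" using xw(3)[OF y] unfolding fixed_def by blast
  have "y = c \<otimes> x \<ominus> \<eta> (c \<otimes> x)" using c xw(1,2) by (simp add: a_minus_def r_distr r_minus)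
  then show ?thesis using c xw by blast
qed

text \<open>
  Both \<open>\<one>\<close> and \<open>x\<close>, where \<open>x\<close> is not fixed, form a basis over the fixed field: a relation
  \<open>y = a \<oplus> b \<otimes> x\<close> determines \<open>b\<close> through \<open>y \<ominus> \<eta> y = b \<otimes> w\<close>.
\<close>

lemma card_square: "card (carrier F) = (card fixed) ^ 2"
proof -
  obtain x w where xw: "x \<in> carrier F" "w \<in> carrier F" "w \<noteq> \<zero>" "w = x \<ominus> \<eta> x"
    "\<And>y. y \<in> carrier F \<Longrightarrow> \<eta> y = \<ominus> y \<Longrightarrow> \<exists>c\<in>fixed. y = c \<otimes> w" using decompose by metis
  have F: "a \<in> carrier F" "\<eta> a = a" if "a \<in> fixed" for a using that unfolding fixed_def by auto
  have d: "(a \<oplus> b \<otimes> x) \<ominus> \<eta> (a \<oplus> b \<otimes> x) = b \<otimes> w" if "a \<in> fixed" "b \<in> fixed" for a b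
  proof -
    have "(a \<oplus> b \<otimes> x) \<ominus> \<eta> (a \<oplus> b \<otimes> x) = (a \<oplus> b \<otimes> x) \<ominus> (a \<oplus> b \<otimes> \<eta> x)" using that F xw by simp
    also have "\<dots> = b \<otimes> w" unfolding xw(4) using F[OF that(1)] F[OF that(2)] xw(1) h.hom_closed[OF xw(1)] by algebra
    finally show ?thesis .
  qed
  have "bij_betw (\<lambda>(a, b). a \<oplus> b \<otimes> x) (fixed \<times> fixed) (carrier F)"
    unfolding bij_betw_def
  proof
    show "inj_on (\<lambda>(a, b). a \<oplus> b \<otimes> x) (fixed \<times> fixed)"
    proof (rule inj_onI, clarify)
      fix a b a' b' assume ab: "a \<in> fixed" "b \<in> fixed" "a' \<in> fixed" "b' \<in> fixed" "a \<oplus> b \<otimes> x = a' \<oplus> b' \<otimes> x"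
      have "b \<otimes> w = b' \<otimes> w" using d ab by metis
      then have b: "b = b'" using m_rcancel[OF xw(3)] xw F ab by blast
      then have "a = a'" using ab F xw by (metis add.right_cancel m_closed)
      then show "a = a' \<and> b = b'" using b by blast
    qed
    show "(\<lambda>(a, b). a \<oplus> b \<otimes> x) ` (fixed \<times> fixed) = carrier F"
    proof (intro equalityI subsetI)
      fix y assume y: "y \<in> carrier F"
      let ?z = "y \<ominus> \<eta> y"
      have "\<eta> ?z = \<ominus> ?z" using y invol by (simp add: a_minus_def minus_add a_comm)
      then obtain b where b: "b \<in> fixed" "?z = b \<otimes> w" using xw(5)[of ?z] y by auto
      have "y \<ominus> b \<otimes> x \<in> fixed"
      proof -
        have "\<eta> y = y \<ominus> b \<otimes> w" unfolding b(2)[symmetric] using y h.hom_closed[OF y] by algebra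
        then have "\<eta> (y \<ominus> b \<otimes> x) = y \<ominus> b \<otimes> w \<ominus> b \<otimes> \<eta> x" using F b xw y by (simp add: a_minus_def)
        also have "\<dots> = y \<ominus> b \<otimes> x" unfolding xw(4) using F[OF b(1)] y xw(1) h.hom_closed[OF xw(1)] by algebra
        finally show ?thesis unfolding fixed_def using F b xw y by simp
      qed
      moreover have "y = (y \<ominus> b \<otimes> x) \<oplus> b \<otimes> x" using F[OF b(1)] y xw(1) by algebra
      ultimately show "y \<in> (\<lambda>(a, b). a \<oplus> b \<otimes> x) ` (fixed \<times> fixed)"
        using b(1) by (intro image_eqI[where x = "(y \<ominus> b \<otimes> x, b)"]) auto
    qed (use F xw in auto)
  qed
  then have "card (fixed \<times> fixed) = card (carrier F)" by (rule bij_betw_same_card)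
  then show ?thesis by (simp add: power2_eq_square card_cartesian_product)
qed

text \<open>
  The trace is linear over the fixed field, so it is onto unless it vanishes. If it vanished, \<open>\<eta>\<close> would
  be negation; as \<open>\<eta>\<close> fixes \<open>\<one>\<close>, negation would then be the identity, and so would \<open>\<eta>\<close>.
\<close>

lemma trace_surj:
  assumes c: "c \<in> fixed"
  shows "\<exists>a\<in>carrier F. a \<oplus> \<eta> a = c"
proof -
  have "\<exists>x\<in>carrier F. x \<oplus> \<eta> x \<noteq> \<zero>"
  proof (rule ccontr)
    assume "\<not> ?thesis"
    then have *: "\<And>x. x \<in> carrier F \<Longrightarrow> \<eta> x = \<ominus> x" by (metis a_comm h.hom_closed minus_equality)
    then have "\<ominus> \<one> = \<one>" by (metis h.hom_one one_closed)
    then have "\<eta> x = x" if "x \<in> carrier F" for x using *[OF that] that by (metis l_minus l_one one_closed)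
    then show False using nontriv by blast
  qed
  then obtain x where x: "x \<in> carrier F" "x \<oplus> \<eta> x \<noteq> \<zero>" by blast
  define t where "t = x \<oplus> \<eta> x"
  have t: "t \<in> carrier F" "\<eta> t = t" "t \<in> Units F"
    unfolding t_def using x invol field_Units by (auto simp: a_comm)
  have it: "inv t \<in> carrier F" "inv t \<otimes> t = \<one>" using t by auto
  have cc: "c \<in> carrier F" "\<eta> c = c" using c unfolding fixed_def by auto
  have sit: "\<eta> (inv t) = inv t"
  proof -
    have "\<eta> (inv t) \<otimes> t = \<one>" using it t h.hom_mult[of "inv t" t] by simp
    then show ?thesis using it t by (metis Units_closed h.hom_closed inv_char m_comm)
  qed
  have "c \<otimes> inv t \<otimes> x \<oplus> \<eta> (c \<otimes> inv t \<otimes> x) = c \<otimes> inv t \<otimes> t"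
    unfolding t_def[symmetric] using cc it sit x by (simp add: t_def r_distr)
  also have "\<dots> = c" using cc it t by (simp add: m_assoc)
  finally show ?thesis using cc it x by blast
qed

end

context cyclotomic_field
begin

lemma involution_even:
  assumes "field_involution F \<eta>"
  shows "even n"
proof -
  interpret s: field_involution F \<eta> by fact
  have "subgroup s.fixed (add_monoid F)"
    by (rule add.subgroupI) (auto simp: s.fixed_def simp flip: a_inv_def)
  then have "card s.fixed dvd order (add_monoid F)" using add.lagrange by (metis dvd_triv_right)
  then have "card s.fixed dvd p ^ n" using card by (simp add: order_def)
  then obtain a where "card s.fixed = p ^ a" using p divides_primepow_nat by blast
  then have "p ^ n = p ^ (a * 2)" using s.card_square card by (simp add: power_mult)
  then have "n = a * 2" using prime_gt_1_nat[OF p] by (metis power_inject_exp)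
  then show ?thesis by simp
qed

text \<open>
  The involution is the Frobenius map of order two, \<open>x \<mapsto> x [^] p\<^sup>m\<close> with \<open>n = 2 m\<close>. As \<open>q\<close> divides
  \<open>p\<^sup>n - 1 = (p\<^sup>m - 1) (p\<^sup>m + 1)\<close> but not \<open>p\<^sup>m - 1\<close>, it divides \<open>p\<^sup>m + 1\<close>.
\<close>

lemma even_involution:
  assumes "even n"
  shows "\<exists>\<eta>. field_involution F \<eta> \<and> \<zeta> \<otimes> \<eta> \<zeta> = \<one>"
proof -
  obtain m where m: "n = 2 * m" using assms by blast
  have m0: "m > 0" "m < n" using m n_pos by auto
  have pm: "p ^ m > 1" using m0 prime_gt_1_nat[OF p] by (intro one_less_power) auto
  have pp: "p ^ m * p ^ m = p ^ n" using m by (simp add: mult_2 power_add)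
  have "\<exists>x\<in>carrier F. frob m x \<noteq> x"
  proof (rule ccontr)
    assume "\<not> ?thesis"
    then have fixd: "\<And>x. x \<in> carrier F \<Longrightarrow> frob m x = x" by blast
    then have "\<zeta> [^] (p ^ m) = \<zeta> [^] (1::nat)" using zeta unfolding frob_def by simp
    then have "[p ^ m = 1] (mod q)" using zeta_pow by blast
    then have "q dvd p ^ m - 1" using pm by (simp add: cong_altdef_nat)
    then show False using n_le[OF m0(1)] m0(2) by simp
  qed
  moreover have "frob m (frob m x) = x" if "x \<in> carrier F" for x
    unfolding frob_def nat_pow_pow[OF that] pp by (rule fermat[OF that])
  ultimately have "field_involution F (frob m)"
    by unfold_locales (use frob_hom in auto)
  moreover have "\<zeta> \<otimes> frob m \<zeta> = \<one>"
  proof -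
    have "(p ^ m - 1) * (p ^ m + 1) = p ^ n - 1" unfolding pp[symmetric] by (simp add: algebra_simps)
    then have "q dvd (p ^ m - 1) * (p ^ m + 1)" using q_dvd by simp
    moreover have "\<not> q dvd p ^ m - 1" using n_le[OF m0(1)] m0(2) by auto
    ultimately have "q dvd p ^ m + 1" using q prime_dvd_mult_nat by blast
    then have "\<zeta> [^] (p ^ m + 1) = \<one>" using zeta_pow_one by blast
    then show ?thesis unfolding frob_def using zeta by (simp add: m_comm)
  qed
  ultimately show ?thesis by blast
qed

text \<open>
  Invariance makes multiplication by \<open>zinv\<close> adjoint to multiplication by \<open>\<zeta>\<close>, so every element of \<open>F\<close>
  has an adjoint. The radical of a nontrivial form is a proper invariant subgroup, hence trivial, and
  adjoints are unique. Taking adjoints is a ring endomorphism with square the identity. If it is not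
  the identity, \<open>n\<close> is even. If it is, then \<open>\<zeta>\<^sup>2 = \<one>\<close>, so \<open>q = 2\<close> and \<open>p\<close> is odd; the form is then both
  symmetric and alternating, which makes it trivial.
\<close>

lemma odd_form_trivial:
  fixes c :: "'a \<Rightarrow> 'a \<Rightarrow> 'c" and Z :: "('c, 'd) monoid_scheme"
  assumes n: "odd n" and Z: "comm_group Z"
    and cl: "\<And>x y. x \<in> carrier F \<Longrightarrow> y \<in> carrier F \<Longrightarrow> c x y \<in> carrier Z"
    and l: "\<And>x x' y. x \<in> carrier F \<Longrightarrow> x' \<in> carrier F \<Longrightarrow> y \<in> carrier F \<Longrightarrow> c (x \<oplus> x') y = c x y \<otimes>\<^bsub>Z\<^esub> c x' y"
    and r: "\<And>x y y'. x \<in> carrier F \<Longrightarrow> y \<in> carrier F \<Longrightarrow> y' \<in> carrier F \<Longrightarrow> c x (y \<oplus> y') = c x y \<otimes>\<^bsub>Z\<^esub> c x y'"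
    and alt: "\<And>x. x \<in> carrier F \<Longrightarrow> c x x = \<one>\<^bsub>Z\<^esub>"
    and inva: "\<And>x y. x \<in> carrier F \<Longrightarrow> y \<in> carrier F \<Longrightarrow> c (\<zeta> \<otimes> x) (\<zeta> \<otimes> y) = c x y"
    and xy: "x \<in> carrier F" "y \<in> carrier F"
  shows "c x y = \<one>\<^bsub>Z\<^esub>"
proof (rule ccontr)
  assume nz: "c x y \<noteq> \<one>\<^bsub>Z\<^esub>"
  interpret Z: comm_group Z by (rule Z)
  have c0: "c \<zero> y = \<one>\<^bsub>Z\<^esub>" "c y \<zero> = \<one>\<^bsub>Z\<^esub>" if "y \<in> carrier F" for y
    using l[of \<zero> \<zero> y] r[of y \<zero> \<zero>] cl[of \<zero> y] cl[of y \<zero>] that by simp_all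
  have cn: "c (\<ominus> x) y = inv\<^bsub>Z\<^esub> (c x y)" "c x (\<ominus> y) = inv\<^bsub>Z\<^esub> (c x y)" if "x \<in> carrier F" "y \<in> carrier F" for x y
    using l[of "\<ominus> x" x y] r[of x "\<ominus> y" y] c0 cl that
    by (auto simp: l_neg intro!: Z.inv_equality[symmetric])
  have anti: "c y x = inv\<^bsub>Z\<^esub> (c x y)" if "x \<in> carrier F" "y \<in> carrier F" for x y
  proof -
    have "c (x \<oplus> y) (x \<oplus> y) = c y x \<otimes>\<^bsub>Z\<^esub> c x y"
      using that l r cl alt[OF that(1)] alt[OF that(2)] by simp
    then have "c y x \<otimes>\<^bsub>Z\<^esub> c x y = \<one>\<^bsub>Z\<^esub>" using alt that by simp
    then show ?thesis using cl that by (simp add: Z.inv_equality[symmetric])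
  qed
  have zl: "c (\<zeta> \<otimes> x) y = c x (zinv \<otimes> y)" "c x (\<zeta> \<otimes> y) = c (zinv \<otimes> x) y"
    if "x \<in> carrier F" "y \<in> carrier F" for x y
    using inva[of x "zinv \<otimes> y"] inva[of "zinv \<otimes> x" y] that zinv zeta by (simp_all flip: m_assoc)
  have nondeg: "b = \<zero>" if b: "b \<in> carrier F" and rad: "\<And>x. x \<in> carrier F \<Longrightarrow> c x b = \<one>\<^bsub>Z\<^esub>" for b
  proof (rule ccontr)
    assume "b \<noteq> \<zero>"
    then have "\<forall>x\<in>carrier F. c x y = \<one>\<^bsub>Z\<^esub>"
      by (rule span_induct[where P = "\<lambda>y. \<forall>x\<in>carrier F. c x y = \<one>\<^bsub>Z\<^esub>", OF b])
        (use rad r cn zl zinv xy in auto)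
    then show False using nz xy by blast
  qed
  define adj where "adj = (\<lambda>a a'. a' \<in> carrier F \<and> (\<forall>x\<in>carrier F. \<forall>y\<in>carrier F. c (a \<otimes> x) y = c x (a' \<otimes> y)))"
  have ex: "\<exists>a'. adj a a'" if a: "a \<in> carrier F" for a
  proof (rule span_induct[where z = \<one> and P = "\<lambda>a. \<exists>a'. adj a a'"])
    show "\<exists>a'. adj \<one> a'" unfolding adj_def by (rule exI[of _ \<one>]) auto
  next
    fix a b assume ab: "a \<in> carrier F" "b \<in> carrier F" "\<exists>a'. adj a a'" "\<exists>a'. adj b a'"
    then obtain a' b' where "adj a a'" "adj b b'" by blast
    then have "adj (a \<oplus> b) (a' \<oplus> b')" unfolding adj_def using ab l r by (auto simp: l_distr)
    then show "\<exists>a'. adj (a \<oplus> b) a'" by blast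
  next
    fix a assume a: "a \<in> carrier F" "\<exists>a'. adj a a'"
    then obtain a' where a': "adj a a'" by blast
    then have "adj (\<ominus> a) (\<ominus> a')" unfolding adj_def using a cn by (auto simp: l_minus)
    then show "\<exists>a'. adj (\<ominus> a) a'" by blast
    have "adj (\<zeta> \<otimes> a) (a' \<otimes> zinv)" using a' unfolding adj_def using a zl zinv zeta by (auto simp: m_assoc)
    then show "\<exists>a'. adj (\<zeta> \<otimes> a) a'" by blast
  qed (use a in auto)
  have un: "a' = a''" if "adj a a'" "adj a a''" "a \<in> carrier F" for a a' a''
  proof -
    have a: "a' \<in> carrier F" "a'' \<in> carrier F" using that unfolding adj_def by auto
    have "a' \<ominus> a'' = \<zero>"
    proof (rule nondeg)
      fix x assume x: "x \<in> carrier F"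
      have "c x a' = c x a''" using that a x unfolding adj_def by (metis one_closed r_one)
      then show "c x (a' \<ominus> a'') = \<one>\<^bsub>Z\<^esub>" using a x r cn cl by (simp add: a_minus_def)
    qed (use a in simp)
    then show ?thesis using a by (metis r_right_minus_eq)
  qed
  define \<eta> where "\<eta> = (\<lambda>a. SOME a'. adj a a')"
  have s: "adj a (\<eta> a)" if "a \<in> carrier F" for a unfolding \<eta>_def using someI_ex[OF ex[OF that]] .
  have sc: "\<eta> a \<in> carrier F" and sa: "\<And>x y. x \<in> carrier F \<Longrightarrow> y \<in> carrier F \<Longrightarrow> c (a \<otimes> x) y = c x (\<eta> a \<otimes> y)"
    if "a \<in> carrier F" for a using s[OF that] unfolding adj_def by auto
  have sI: "\<eta> a = a'" if "a \<in> carrier F" "adj a a'" for a a' using un s that by blast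
  have hom: "\<eta> \<in> ring_hom F F"
  proof (rule ring_hom_memI)
    fix a b assume ab: "a \<in> carrier F" "b \<in> carrier F"
    show "\<eta> (a \<oplus> b) = \<eta> a \<oplus> \<eta> b"
      by (rule sI) (use ab sc sa l r in \<open>auto simp: adj_def l_distr\<close>)
    show "\<eta> (a \<otimes> b) = \<eta> a \<otimes> \<eta> b"
    proof (rule sI)
      show "adj (a \<otimes> b) (\<eta> a \<otimes> \<eta> b)" unfolding adj_def
      proof (intro conjI ballI)
        fix x y assume xy: "x \<in> carrier F" "y \<in> carrier F"
        have "c (a \<otimes> b \<otimes> x) y = c x (\<eta> b \<otimes> (\<eta> a \<otimes> y))" using ab xy sc sa by (simp add: m_assoc)
        also have "\<eta> b \<otimes> (\<eta> a \<otimes> y) = \<eta> a \<otimes> \<eta> b \<otimes> y" using ab xy sc by (simp add: m_assoc m_lcomm)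
        finally show "c (a \<otimes> b \<otimes> x) y = c x (\<eta> a \<otimes> \<eta> b \<otimes> y)" .
      qed (use ab sc in auto)
    qed (use ab in auto)
    show "\<eta> a \<in> carrier F" using sc ab by blast
  next
    show "\<eta> \<one> = \<one>" by (rule sI) (auto simp: adj_def)
  qed
  have invol: "\<eta> (\<eta> a) = a" if a: "a \<in> carrier F" for a
  proof (rule sI)
    show "adj (\<eta> a) a" unfolding adj_def
    proof (intro conjI ballI)
      fix x y assume xy: "x \<in> carrier F" "y \<in> carrier F"
      show "c (\<eta> a \<otimes> x) y = c x (a \<otimes> y)"
        using anti[of y "\<eta> a \<otimes> x"] anti[of "a \<otimes> y" x] sa[OF a, of y x] xy a sc by simp
    qed (use a in auto)
  qed (use a sc in auto)
  show False
  proof (cases "\<exists>x\<in>carrier F. \<eta> x \<noteq> x")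
    case True
    then have "field_involution F \<eta>" by unfold_locales (use hom invol in auto)
    then show False using involution_even n by blast
  next
    case False
    then have id: "\<eta> a = a" if "a \<in> carrier F" for a using that by blast
    have "adj \<zeta> zinv" unfolding adj_def using zl zinv by auto
    then have "zinv = \<zeta>" using sI id zeta by metis
    then have "\<zeta> [^] (2::nat) = \<one>" using zinv zeta by (simp add: numeral_2_eq_2)
    then have "q dvd 2" using zeta_pow_one by blast
    then have q2: "q = 2" using q by (metis primes_dvd_imp_eq two_is_prime_nat)
    then have "odd p" using p pq primes_dvd_imp_eq two_is_prime_nat by blast
    have sym: "c x y = c y x"
      using sa[OF xy(1) one_closed xy(2)] sa[OF xy(2) one_closed xy(1)] id xy by (simp add: m_comm)
    have "c x y \<otimes>\<^bsub>Z\<^esub> c x y = \<one>\<^bsub>Z\<^esub>" using anti[OF xy] sym cl xy by (metis Z.r_inv)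
    then have 2: "c x y [^]\<^bsub>Z\<^esub> (2::nat) = \<one>\<^bsub>Z\<^esub>" using cl xy by (simp add: numeral_2_eq_2)
    have "c (add_pow F k x) y = c x y [^]\<^bsub>Z\<^esub> k" for k :: nat
      by (induction k) (use xy c0 l in auto)
    then have "c x y [^]\<^bsub>Z\<^esub> p = \<one>\<^bsub>Z\<^esub>" using char_p[OF xy(1)] c0 xy by metis
    then have "Z.ord (c x y) dvd 2" "Z.ord (c x y) dvd p" using 2 Z.pow_eq_id cl xy by auto
    then have "Z.ord (c x y) = 1" using \<open>odd p\<close>
      by (metis nat_dvd_1_iff_1 coprime_common_divisor_nat coprime_left_2_iff_odd)
    then show False using Z.ord_eq_1 cl xy nz by blast
  qed
qed

lemma n_is_order:
  "n = group.ord (units_of (residue_ring (int q))) (int p mod int q)"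
proof -
  interpret R: residues "int q" "residue_ring (int q)"
    by unfold_locales (use prime_gt_1_nat[OF q] in auto)
  let ?U = "units_of (residue_ring (int q))" and ?x = "int p mod int q"
  interpret U: group ?U by (rule R.units_group)
  have "coprime p q" using p q pq by (simp add: primes_coprime)
  then have xU: "?x \<in> Units (residue_ring (int q))"
    by (intro R.mod_in_res_units) (use prime_gt_1_nat[OF q] in \<open>auto simp: coprime_int_iff\<close>)
  have xc: "?x \<in> carrier ?U" using xU by (simp add: units_of_def)
  have "?x [^]\<^bsub>?U\<^esub> k = \<one>\<^bsub>?U\<^esub> \<longleftrightarrow> q dvd p ^ k - 1" for k :: nat
  proof -
    have "?x [^]\<^bsub>?U\<^esub> k = int p ^ k mod int q"
      using R.units_of_pow[OF xU, of k] R.pow_cong[of "int p" k] by simp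
    moreover have "\<one>\<^bsub>?U\<^esub> = 1 mod int q"
      using R.res_one_eq prime_gt_1_nat[OF q] by (simp add: units_of_def)
    ultimately have "?x [^]\<^bsub>?U\<^esub> k = \<one>\<^bsub>?U\<^esub> \<longleftrightarrow> [int p ^ k = 1] (mod int q)"
      by (simp add: unique_euclidean_semiring_class.cong_def)
    also have "\<dots> \<longleftrightarrow> [p ^ k = 1] (mod q)" using cong_int_iff[of "p ^ k" 1 q] by simp
    also have "\<dots> \<longleftrightarrow> q dvd p ^ k - 1" using prime_gt_0_nat[OF p] by (simp add: cong_altdef_nat)
    finally show ?thesis .
  qed
  then have dvd: "q dvd p ^ k - 1 \<longleftrightarrow> U.ord ?x dvd k" for k using U.pow_eq_id[OF xc] by simp
  then have 1: "U.ord ?x dvd n" using q_dvd by blast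
  then have "U.ord ?x > 0" using n_pos by (metis dvd_0_left_iff gr0I less_numeral_extra(3))
  moreover have "q dvd p ^ U.ord ?x - 1" using dvd by simp
  ultimately have "n \<le> U.ord ?x" by (rule n_le)
  then show ?thesis using dvd_imp_le[OF 1 n_pos] by (rule le_antisym)
qed
end

section \<open>Semidirect products of a field with a cyclic group\<close>

text \<open>
  The group \<open>G\<close> is a semidirect product of the additive group of \<open>F\<close> and \<open>\<langle>b\<rangle>\<close>, where \<open>b\<close> acts as
  multiplication by \<open>\<zeta>\<close>. The field is carried by a subgroup of \<open>G\<close> itself, so elements of \<open>F\<close> are at the
  same time elements of \<open>G\<close>.
\<close>

locale field_semidirect = cyclotomic_field F \<zeta> p q n + G: group G
  for F :: "('a, 'f) ring_scheme" (structure) and \<zeta> p q n and G :: "('a, 'm) monoid_scheme" +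
  fixes b :: 'a and v :: nat
  assumes FG: "carrier F \<subseteq> carrier G"
    and add_eq: "\<And>x y. x \<in> carrier F \<Longrightarrow> y \<in> carrier F \<Longrightarrow> x \<oplus> y = x \<otimes>\<^bsub>G\<^esub> y"
    and zero_eq: "\<zero> = \<one>\<^bsub>G\<^esub>"
    and b: "b \<in> carrier G" "G.ord b = q ^ v" and v: "v \<ge> 1"
    and conj_b: "\<And>x. x \<in> carrier F \<Longrightarrow> b \<otimes>\<^bsub>G\<^esub> x \<otimes>\<^bsub>G\<^esub> inv\<^bsub>G\<^esub> b = \<zeta> \<otimes> x"
    and dec: "\<And>g. g \<in> carrier G \<Longrightarrow> \<exists>x\<in>carrier F. \<exists>i::nat. g = x \<otimes>\<^bsub>G\<^esub> b [^]\<^bsub>G\<^esub> i"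
    and disj: "\<And>i::nat. b [^]\<^bsub>G\<^esub> i \<in> carrier F \<Longrightarrow> b [^]\<^bsub>G\<^esub> i = \<one>\<^bsub>G\<^esub>"
begin

abbreviation gm (infixl \<open>\<cdot>\<^sub>G\<close> 70) where "gm \<equiv> monoid.mult G"
abbreviation gi where "gi x \<equiv> inv\<^bsub>G\<^esub> x"

lemma F_G [simp, intro]: "x \<in> carrier F \<Longrightarrow> x \<in> carrier G"
  using FG by blast

lemma one_G_F [simp]: "\<one>\<^bsub>G\<^esub> \<in> carrier F"
  using zero_closed zero_eq by simp

lemma minus_eq_inv: "x \<in> carrier F \<Longrightarrow> \<ominus> x = gi x"
proof -
  assume x: "x \<in> carrier F"
  have "\<ominus> x \<cdot>\<^sub>G x = \<one>\<^bsub>G\<^esub>" using x add_eq[of "\<ominus> x" x] zero_eq by (simp add: l_neg)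
  then show ?thesis using x by (simp add: G.inv_equality)
qed

lemma bpow_order: "b [^]\<^bsub>G\<^esub> (q ^ v) = \<one>\<^bsub>G\<^esub>"
  using b G.pow_ord_eq_1 by metis

lemma bpow_eq: "b [^]\<^bsub>G\<^esub> (i::nat) = b [^]\<^bsub>G\<^esub> j \<longleftrightarrow> [i = j] (mod q ^ v)"
  using G.pow_eq_iff_cong_ord[OF b(1)] b(2) by simp

lemma inv_bpow: "\<exists>j::nat. gi (b [^]\<^bsub>G\<^esub> (i::nat)) = b [^]\<^bsub>G\<^esub> j"
proof (intro exI G.inv_equality)
  have "(q ^ v - 1) * i + i = q ^ v * i" using prime_gt_0_nat[OF q]
    by (metis Suc_diff_1 add.commute mult_Suc zero_less_power)
  then show "b [^]\<^bsub>G\<^esub> ((q ^ v - 1) * i) \<cdot>\<^sub>G b [^]\<^bsub>G\<^esub> i = \<one>\<^bsub>G\<^esub>"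
    using b bpow_order by (metis G.nat_pow_mult G.nat_pow_one G.nat_pow_pow)
qed (use b in auto)

lemma F_p: "x \<in> carrier F \<Longrightarrow> x [^]\<^bsub>G\<^esub> p = \<one>\<^bsub>G\<^esub>"
proof -
  assume x: "x \<in> carrier F"
  have "add_pow F k x = x [^]\<^bsub>G\<^esub> k" for k :: nat
  proof (induction k)
    case (Suc k)
    then show ?case using x add_eq[of "add_pow F k x" x] add.nat_pow_closed[OF x, of k] by simp
  qed (use zero_eq in simp)
  then show ?thesis using char_p[OF x] zero_eq by metis
qed

lemma F_comm: "x \<in> carrier F \<Longrightarrow> y \<in> carrier F \<Longrightarrow> x \<cdot>\<^sub>G y = y \<cdot>\<^sub>G x"
  by (metis a_comm add_eq)

lemma F_closed: "x \<in> carrier F \<Longrightarrow> y \<in> carrier F \<Longrightarrow> x \<cdot>\<^sub>G y \<in> carrier F"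
  by (metis a_closed add_eq)

lemma F_inv_closed: "x \<in> carrier F \<Longrightarrow> gi x \<in> carrier F"
  by (metis a_inv_closed minus_eq_inv)

lemma conj_bpow: "x \<in> carrier F \<Longrightarrow> b [^]\<^bsub>G\<^esub> (i::nat) \<cdot>\<^sub>G x \<cdot>\<^sub>G gi (b [^]\<^bsub>G\<^esub> i) = \<zeta> [^] i \<otimes> x"
proof (induction i arbitrary: x)
  case (Suc i)
  have "b [^]\<^bsub>G\<^esub> Suc i \<cdot>\<^sub>G x \<cdot>\<^sub>G gi (b [^]\<^bsub>G\<^esub> Suc i) = b [^]\<^bsub>G\<^esub> i \<cdot>\<^sub>G (b \<cdot>\<^sub>G x \<cdot>\<^sub>G gi b) \<cdot>\<^sub>G gi (b [^]\<^bsub>G\<^esub> i)"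
    using Suc.prems b by (simp add: G.group_normalize)
  also have "\<dots> = \<zeta> [^] i \<otimes> (\<zeta> \<otimes> x)" using Suc conj_b zeta by simp
  finally show ?case using Suc.prems zeta by (simp add: m_assoc)
qed (use b in auto)

lemma decE:
  assumes "g \<in> carrier G"
  obtains x i where "x \<in> carrier F" "g = x \<cdot>\<^sub>G b [^]\<^bsub>G\<^esub> (i::nat)"
  using dec[OF assms] by blast

lemma dec_unique:
  assumes "x \<in> carrier F" "y \<in> carrier F" "x \<cdot>\<^sub>G b [^]\<^bsub>G\<^esub> (i::nat) = y \<cdot>\<^sub>G b [^]\<^bsub>G\<^esub> (j::nat)"
  shows "b [^]\<^bsub>G\<^esub> i = b [^]\<^bsub>G\<^esub> j" "x = y"
proof -
  obtain j' :: nat where j': "gi (b [^]\<^bsub>G\<^esub> j) = b [^]\<^bsub>G\<^esub> j'" using inv_bpow by blast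
  have "b [^]\<^bsub>G\<^esub> (i + j') = gi x \<cdot>\<^sub>G (x \<cdot>\<^sub>G b [^]\<^bsub>G\<^esub> i) \<cdot>\<^sub>G b [^]\<^bsub>G\<^esub> j'"
    using assms(1,2) b by (simp add: G.group_normalize G.nat_pow_mult)
  also have "\<dots> = gi x \<cdot>\<^sub>G (y \<cdot>\<^sub>G b [^]\<^bsub>G\<^esub> j) \<cdot>\<^sub>G gi (b [^]\<^bsub>G\<^esub> j)" unfolding assms(3) j' by (rule refl)
  also have "\<dots> = gi x \<cdot>\<^sub>G y" using assms(1,2) b by (simp add: G.group_normalize)
  finally have e: "b [^]\<^bsub>G\<^esub> (i + j') = gi x \<cdot>\<^sub>G y" .
  then have "b [^]\<^bsub>G\<^esub> (i + j') = \<one>\<^bsub>G\<^esub>" using disj F_closed F_inv_closed assms by metis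
  then have "b [^]\<^bsub>G\<^esub> i \<cdot>\<^sub>G gi (b [^]\<^bsub>G\<^esub> j) = \<one>\<^bsub>G\<^esub>" unfolding j' using b by (simp add: G.nat_pow_mult)
  moreover have "b [^]\<^bsub>G\<^esub> i = (b [^]\<^bsub>G\<^esub> i \<cdot>\<^sub>G gi (b [^]\<^bsub>G\<^esub> j)) \<cdot>\<^sub>G b [^]\<^bsub>G\<^esub> j"
    using b by (simp add: G.group_normalize)
  ultimately show 1: "b [^]\<^bsub>G\<^esub> i = b [^]\<^bsub>G\<^esub> j" using b by simp
  then show "x = y" using assms b by simp
qed

text \<open>
  Every \<open>g\<close> in \<open>G\<close> is uniquely \<open>pr g \<cdot>\<^sub>G e g\<close> with \<open>pr g\<close> in \<open>F\<close> and \<open>e g\<close> in \<open>\<langle>b\<rangle>\<close>. Conjugation by \<open>g\<close> acts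
  on \<open>F\<close> as multiplication by a power of \<open>\<zeta>\<close>, which is therefore its value \<open>\<chi> g\<close> at \<open>\<one>\<close>.
\<close>

definition e where "e g = (SOME h. \<exists>x\<in>carrier F. \<exists>i::nat. g = x \<cdot>\<^sub>G b [^]\<^bsub>G\<^esub> i \<and> h = b [^]\<^bsub>G\<^esub> i)"
definition pr where "pr g = g \<cdot>\<^sub>G gi (e g)"
definition \<chi> where "\<chi> g = g \<cdot>\<^sub>G \<one> \<cdot>\<^sub>G gi g"

lemma e_dec: "x \<in> carrier F \<Longrightarrow> e (x \<cdot>\<^sub>G b [^]\<^bsub>G\<^esub> (i::nat)) = b [^]\<^bsub>G\<^esub> i"
  unfolding e_def
proof (rule some_equality)
  fix h assume x: "x \<in> carrier F"
    and "\<exists>y\<in>carrier F. \<exists>j::nat. x \<cdot>\<^sub>G b [^]\<^bsub>G\<^esub> i = y \<cdot>\<^sub>G b [^]\<^bsub>G\<^esub> j \<and> h = b [^]\<^bsub>G\<^esub> j"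
  then obtain y j where "y \<in> carrier F" "x \<cdot>\<^sub>G b [^]\<^bsub>G\<^esub> i = y \<cdot>\<^sub>G b [^]\<^bsub>G\<^esub> (j::nat)" "h = b [^]\<^bsub>G\<^esub> j"
    by auto
  then show "h = b [^]\<^bsub>G\<^esub> i" using dec_unique(1)[OF x] by metis
qed auto

lemma pr_dec: "x \<in> carrier F \<Longrightarrow> pr (x \<cdot>\<^sub>G b [^]\<^bsub>G\<^esub> (i::nat)) = x"
  unfolding pr_def using e_dec b by (simp add: G.group_normalize)

lemma conj_dec: "x \<in> carrier F \<Longrightarrow> y \<in> carrier F \<Longrightarrow>
  (x \<cdot>\<^sub>G b [^]\<^bsub>G\<^esub> (i::nat)) \<cdot>\<^sub>G y \<cdot>\<^sub>G gi (x \<cdot>\<^sub>G b [^]\<^bsub>G\<^esub> i) = \<zeta> [^] i \<otimes> y"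
proof -
  assume xy: "x \<in> carrier F" "y \<in> carrier F"
  have "(x \<cdot>\<^sub>G b [^]\<^bsub>G\<^esub> i) \<cdot>\<^sub>G y \<cdot>\<^sub>G gi (x \<cdot>\<^sub>G b [^]\<^bsub>G\<^esub> i)
    = x \<cdot>\<^sub>G (b [^]\<^bsub>G\<^esub> i \<cdot>\<^sub>G y \<cdot>\<^sub>G gi (b [^]\<^bsub>G\<^esub> i)) \<cdot>\<^sub>G gi x"
    using xy b by (simp add: G.group_normalize)
  also have "\<dots> = x \<cdot>\<^sub>G (\<zeta> [^] i \<otimes> y) \<cdot>\<^sub>G gi x" using conj_bpow xy by simp
  also have "\<dots> = \<zeta> [^] i \<otimes> y" using F_comm[of x "\<zeta> [^] i \<otimes> y"] xy zeta by (simp add: G.group_normalize)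
  finally show ?thesis .
qed

lemma chi_dec: "x \<in> carrier F \<Longrightarrow> \<chi> (x \<cdot>\<^sub>G b [^]\<^bsub>G\<^esub> (i::nat)) = \<zeta> [^] i"
  unfolding \<chi>_def using conj_dec[of x \<one> i] zeta by simp

lemma e_bpow: "g \<in> carrier G \<Longrightarrow> \<exists>i::nat. e g = b [^]\<^bsub>G\<^esub> i"
  using decE e_dec by metis

lemma e_closed [simp]: "g \<in> carrier G \<Longrightarrow> e g \<in> carrier G"
  using e_bpow b by fastforce

lemma pr_closed [simp]: "g \<in> carrier G \<Longrightarrow> pr g \<in> carrier F"
  using decE pr_dec by metis

lemma pr_e: "g \<in> carrier G \<Longrightarrow> pr g \<cdot>\<^sub>G e g = g"
  unfolding pr_def by (simp add: G.group_normalize)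

lemma e_F [simp]: "x \<in> carrier F \<Longrightarrow> e x = \<one>\<^bsub>G\<^esub>"
  using e_dec[of x 0] by simp

lemma e_b [simp]: "e (b [^]\<^bsub>G\<^esub> (i::nat)) = b [^]\<^bsub>G\<^esub> i" "e b = b"
  and pr_b [simp]: "pr (b [^]\<^bsub>G\<^esub> i) = \<zero>" "pr b = \<zero>"
  using e_dec[of \<zero> i] e_dec[of \<zero> 1] pr_dec[of \<zero> i] pr_dec[of \<zero> 1] b zero_eq by simp_all

lemma pr_F [simp]: "x \<in> carrier F \<Longrightarrow> pr x = x"
  using pr_dec[of x 0] by simp

lemma chi_b: "\<chi> b = \<zeta>" "\<chi> (b [^]\<^bsub>G\<^esub> (i::nat)) = \<zeta> [^] i"
  using chi_dec[of \<zero> 1] chi_dec[of \<zero> i] b zero_eq zeta by simp_all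

lemma chi_closed [simp]: "g \<in> carrier G \<Longrightarrow> \<chi> g \<in> carrier F"
  by (metis decE chi_dec nat_pow_closed zeta(1))

lemma chi_e: "g \<in> carrier G \<Longrightarrow> \<chi> (e g) = \<chi> g"
  using decE chi_dec e_dec chi_b by metis

lemma chi_F: "x \<in> carrier F \<Longrightarrow> \<chi> x = \<one>"
  using chi_dec[of x 0] by simp

lemma conj_chi: "g \<in> carrier G \<Longrightarrow> x \<in> carrier F \<Longrightarrow> g \<cdot>\<^sub>G x \<cdot>\<^sub>G gi g = \<chi> g \<otimes> x"
  using decE chi_dec conj_dec by metis

lemma mult_dec:
  assumes "x \<in> carrier F" "y \<in> carrier F"
  shows "(x \<cdot>\<^sub>G b [^]\<^bsub>G\<^esub> (i::nat)) \<cdot>\<^sub>G (y \<cdot>\<^sub>G b [^]\<^bsub>G\<^esub> (j::nat)) = (x \<oplus> \<zeta> [^] i \<otimes> y) \<cdot>\<^sub>G b [^]\<^bsub>G\<^esub> (i + j)"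
proof -
  have "(x \<cdot>\<^sub>G b [^]\<^bsub>G\<^esub> i) \<cdot>\<^sub>G (y \<cdot>\<^sub>G b [^]\<^bsub>G\<^esub> j)
    = x \<cdot>\<^sub>G (b [^]\<^bsub>G\<^esub> i \<cdot>\<^sub>G y \<cdot>\<^sub>G gi (b [^]\<^bsub>G\<^esub> i)) \<cdot>\<^sub>G (b [^]\<^bsub>G\<^esub> i \<cdot>\<^sub>G b [^]\<^bsub>G\<^esub> j)"
    using assms b by (simp add: G.group_normalize)
  then show ?thesis using assms conj_bpow zeta b by (simp add: add_eq G.nat_pow_mult)
qed

lemma e_mult: "g \<in> carrier G \<Longrightarrow> h \<in> carrier G \<Longrightarrow> e (g \<cdot>\<^sub>G h) = e g \<cdot>\<^sub>G e h"
  and pr_mult: "g \<in> carrier G \<Longrightarrow> h \<in> carrier G \<Longrightarrow> pr (g \<cdot>\<^sub>G h) = pr g \<oplus> \<chi> g \<otimes> pr h"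
  and chi_mult: "g \<in> carrier G \<Longrightarrow> h \<in> carrier G \<Longrightarrow> \<chi> (g \<cdot>\<^sub>G h) = \<chi> g \<otimes> \<chi> h"
proof -
  assume gh: "g \<in> carrier G" "h \<in> carrier G"
  obtain x i where g: "x \<in> carrier F" "g = x \<cdot>\<^sub>G b [^]\<^bsub>G\<^esub> (i::nat)" using decE gh by blast
  obtain y j where h: "y \<in> carrier F" "h = y \<cdot>\<^sub>G b [^]\<^bsub>G\<^esub> (j::nat)" using decE gh by blast
  let ?z = "x \<oplus> \<zeta> [^] i \<otimes> y"
  have z: "?z \<in> carrier F" "g \<cdot>\<^sub>G h = ?z \<cdot>\<^sub>G b [^]\<^bsub>G\<^esub> (i + j)" unfolding g(2) h(2) using g h zeta mult_dec by auto
  show "e (g \<cdot>\<^sub>G h) = e g \<cdot>\<^sub>G e h" unfolding z(2) e_dec[OF z(1)] unfolding g(2) h(2)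
    using g h b e_dec by (simp add: G.nat_pow_mult)
  show "pr (g \<cdot>\<^sub>G h) = pr g \<oplus> \<chi> g \<otimes> pr h" unfolding z(2) pr_dec[OF z(1)] unfolding g(2) h(2)
    using g h b pr_dec chi_dec by simp
  show "\<chi> (g \<cdot>\<^sub>G h) = \<chi> g \<otimes> \<chi> h" unfolding z(2) chi_dec[OF z(1)] unfolding g(2) h(2)
    using g h b chi_dec zeta by (simp add: nat_pow_mult)
qed

lemma chi_nonzero: "g \<in> carrier G \<Longrightarrow> \<chi> g \<noteq> \<zero>"
proof
  assume g: "g \<in> carrier G" and "\<chi> g = \<zero>"
  then have "\<chi> (g \<cdot>\<^sub>G gi g) = \<zero>" using chi_mult[of g "gi g"] by simp
  then show False using g chi_F[of \<zero>] zero_eq zero_not_one by simp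
qed

lemma e_hom: "e \<in> hom G G"
  by (rule homI) (auto simp: e_mult)

lemma e_eq_one_iff: "g \<in> carrier G \<Longrightarrow> e g = \<one>\<^bsub>G\<^esub> \<longleftrightarrow> g \<in> carrier F"
  by (metis G.r_one F_G e_F pr_closed pr_e)

lemma e_pow_order: "g \<in> carrier G \<Longrightarrow> e g [^]\<^bsub>G\<^esub> (q ^ v) = \<one>\<^bsub>G\<^esub>"
  using e_bpow bpow_order b by (metis G.nat_pow_one G.nat_pow_pow mult.commute)

lemma coprime_pq: "coprime (p ^ k) (q ^ l)"
  using p q pq by (simp add: primes_coprime)

lemma coprime_pow_trivial:
  assumes "group M" "x \<in> carrier M" "x [^]\<^bsub>M\<^esub> (i::nat) = \<one>\<^bsub>M\<^esub>" "x [^]\<^bsub>M\<^esub> (j::nat) = \<one>\<^bsub>M\<^esub>" "coprime i j"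
  shows "x = \<one>\<^bsub>M\<^esub>"
  using assms by (metis coprime_common_divisor_nat group.ord_eq_1 group.pow_eq_id)

lemma pow_p_in_F:
  assumes g: "g \<in> carrier G" "g [^]\<^bsub>G\<^esub> (p ^ k) = \<one>\<^bsub>G\<^esub>"
  shows "g \<in> carrier F"
proof -
  interpret e: group_hom G G e by unfold_locales (rule e_hom)
  have "e g [^]\<^bsub>G\<^esub> (p ^ k) = \<one>\<^bsub>G\<^esub>" using g e.hom_nat_pow[of g "p ^ k"] by simp
  then have "e g = \<one>\<^bsub>G\<^esub>"
    using coprime_pow_trivial[OF G.is_group e_closed[OF g(1)] _ e_pow_order[OF g(1)] coprime_pq] by blast
  then show ?thesis using e_eq_one_iff g by blast
qed

lemma finite_G: "finite (carrier G)"
proof -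
  have "carrier G \<subseteq> (\<lambda>(x, i). x \<cdot>\<^sub>G b [^]\<^bsub>G\<^esub> i) ` (carrier F \<times> {..<q ^ v})"
  proof
    fix g assume "g \<in> carrier G"
    then obtain x i where g: "x \<in> carrier F" "g = x \<cdot>\<^sub>G b [^]\<^bsub>G\<^esub> (i::nat)" using decE by blast
    have "b [^]\<^bsub>G\<^esub> i = b [^]\<^bsub>G\<^esub> (i mod q ^ v)" unfolding bpow_eq by simp
    then show "g \<in> (\<lambda>(x, i). x \<cdot>\<^sub>G b [^]\<^bsub>G\<^esub> i) ` (carrier F \<times> {..<q ^ v})"
      using g prime_gt_0_nat[OF q] by (intro image_eqI[where x = "(x, i mod q ^ v)"]) auto
  qed
  then show ?thesis using fin finite_subset by blast
qed

text \<open>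
  The elements of \<open>F\<close> are those whose order is a power of \<open>p\<close>.
\<close>

lemma hom_F: "f \<in> hom G G \<Longrightarrow> x \<in> carrier F \<Longrightarrow> f x \<in> carrier F"
proof -
  assume f: "f \<in> hom G G" and x: "x \<in> carrier F"
  interpret f: group_hom G G f by unfold_locales (rule f)
  have "f x [^]\<^bsub>G\<^esub> (p ^ 1) = \<one>\<^bsub>G\<^esub>" using F_p[OF x] x f.hom_nat_pow[of x p] by simp
  then show ?thesis using pow_p_in_F f.hom_closed x by blast
qed

lemma hom_add: "f \<in> hom G G \<Longrightarrow> x \<in> carrier F \<Longrightarrow> y \<in> carrier F \<Longrightarrow> f (x \<oplus> y) = f x \<oplus> f y"
  using hom_mult[of f G G x y] hom_F by (simp add: add_eq)

lemma hom_zeta: "f \<in> hom G G \<Longrightarrow> x \<in> carrier F \<Longrightarrow> f (\<zeta> \<otimes> x) = \<chi> (f b) \<otimes> f x"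
proof -
  assume f: "f \<in> hom G G" and x: "x \<in> carrier F"
  interpret f: group_hom G G f by unfold_locales (rule f)
  have "f (\<zeta> \<otimes> x) = f b \<cdot>\<^sub>G f x \<cdot>\<^sub>G gi (f b)" using x b conj_b[symmetric] by simp
  then show ?thesis using conj_chi hom_F[OF f x] b by simp
qed

lemma hom_ext:
  assumes "group H" "f \<in> hom G H" "f' \<in> hom G H" "\<And>x. x \<in> carrier F \<Longrightarrow> f x = f' x" "f b = f' b" "g \<in> carrier G"
  shows "f g = f' g"
proof -
  interpret H: group H by fact
  interpret f: group_hom G H f by unfold_locales fact
  interpret f': group_hom G H f' by unfold_locales fact
  obtain x i where g: "x \<in> carrier F" "g = x \<cdot>\<^sub>G b [^]\<^bsub>G\<^esub> (i::nat)" using decE assms by blast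
  then show ?thesis using assms(4,5) b f.hom_nat_pow f'.hom_nat_pow by simp
qed

text \<open>
  The part of the kernel inside \<open>F\<close> is invariant under \<open>\<zeta>\<close>, hence zero or all of \<open>F\<close>. If it is zero,
  then conjugation by \<open>f b\<close> acts nontrivially on \<open>F\<close>, so \<open>f b\<close> lies over a generator of \<open>\<langle>b\<rangle>\<close> and
  nothing outside \<open>F\<close> is in the kernel either.
\<close>

lemma hom_kill_or_inj:
  assumes f: "f \<in> hom G G"
  shows "(\<forall>x\<in>carrier F. f x = \<zero>) \<or> inj_on f (carrier G)"
proof (rule disjCI)
  assume "\<not> inj_on f (carrier G)"
  interpret f: group_hom G G f by unfold_locales (rule f)
  have f0: "f \<zero> = \<zero>" using zero_eq by simp
  note neg = additive_zero_neg[of f, OF hom_F[OF f] hom_add[OF f]]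
  have kill: "\<forall>y\<in>carrier F. f y = \<zero>" if "x \<in> carrier F" "x \<noteq> \<zero>" "f x = \<zero>" for x
  proof
    fix y assume "y \<in> carrier F"
    show "f y = \<zero>"
      by (rule span_induct[where P = "\<lambda>y. f y = \<zero>" and z = x])
        (use that hom_add[OF f] neg hom_zeta[OF f] b \<open>y \<in> carrier F\<close> in auto)
  qed
  show "\<forall>x\<in>carrier F. f x = \<zero>"
  proof (rule ccontr)
    assume nk: "\<not> (\<forall>x\<in>carrier F. f x = \<zero>)"
    have f1: "f \<one> \<noteq> \<zero>" using kill[OF one_closed one_not_zero] nk by blast
    obtain k where k: "e (f b) = b [^]\<^bsub>G\<^esub> (k::nat)"
      using e_bpow[OF f.hom_closed[OF b(1)]] by auto
    have "\<chi> (f b) \<noteq> \<one>"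
    proof
      assume "\<chi> (f b) = \<one>"
      then have "f \<zeta> = f \<one>" using hom_zeta[OF f one_closed] zeta hom_F[OF f] by simp
      then have "f (\<zeta> \<ominus> \<one>) = \<zero>" using hom_add[OF f, of \<zeta> "\<ominus> \<one>"] zeta neg hom_F[OF f]
        by (simp add: a_minus_def r_neg)
      moreover have "\<zeta> \<ominus> \<one> \<noteq> \<zero>" using zeta by (metis r_right_minus_eq one_closed)
      ultimately show False using kill[of "\<zeta> \<ominus> \<one>"] zeta f1 by auto
    qed
    then have "\<zeta> [^] k \<noteq> \<one>" using k chi_e[of "f b"] chi_b b by simp
    then have qk: "\<not> q dvd k" using zeta_pow_one by blast
    have "g = \<one>\<^bsub>G\<^esub>" if g: "g \<in> carrier G" "f g = \<one>\<^bsub>G\<^esub>" for g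
    proof -
      obtain x i where xi: "x \<in> carrier F" "g = x \<cdot>\<^sub>G b [^]\<^bsub>G\<^esub> (i::nat)" using decE g by blast
      interpret e: group_hom G G e by unfold_locales (rule e_hom)
      have "\<one>\<^bsub>G\<^esub> = e (f g)" using g by simp
      also have "\<dots> = e (f x) \<cdot>\<^sub>G e (f b) [^]\<^bsub>G\<^esub> i"
        unfolding xi(2) using xi(1) b f.hom_nat_pow e.hom_nat_pow by simp
      also have "\<dots> = b [^]\<^bsub>G\<^esub> (k * i)" using hom_F[OF f xi(1)] k b by (simp add: G.nat_pow_pow)
      finally have "[k * i = 0] (mod q ^ v)" using bpow_eq[of "k * i" 0] by simp
      then have "q ^ v dvd k * i" by (simp add: cong_0_iff)
      moreover have "coprime (q ^ v) k" using qk q by (simp add: prime_imp_coprime)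
      ultimately have "q ^ v dvd i" using coprime_dvd_mult_right_iff by blast
      then have "b [^]\<^bsub>G\<^esub> i = \<one>\<^bsub>G\<^esub>" using b G.pow_eq_id by metis
      then have "g = x" using xi by simp
      then show ?thesis using kill[OF xi(1)] nk g zero_eq by metis
    qed
    then have "inj_on f (carrier G)" using f.inj_on_one_iff by blast
    then show False using \<open>\<not> inj_on f (carrier G)\<close> by blast
  qed
qed

end

section \<open>The derived subgroup of a Miller--Moreno group as a field\<close>

text \<open>
  These are the properties of a group of Miller and Moreno with its derived subgroup \<open>P\<close> and a generator
  \<open>b\<close> of the cyclic complement.
\<close>

locale miller_moreno_structure = group G for G (structure) +
  fixes p q n v :: nat and b :: 'a and P :: "'a set"
  assumes fin: "finite (carrier G)" and noncomm: "\<not> comm_group G"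
    and proper: "\<And>H x y. subgroup H G \<Longrightarrow> H \<noteq> carrier G \<Longrightarrow> x \<in> H \<Longrightarrow> y \<in> H \<Longrightarrow> x \<otimes> y = y \<otimes> x"
    and p: "Factorial_Ring.prime p" and q: "Factorial_Ring.prime q" and pq: "p \<noteq> q" and v: "v \<ge> 1"
    and P_def: "P = derived G (carrier G)" and cardP: "card P = p ^ n"
    and b: "b \<in> carrier G" "ord b = q ^ v"
    and dec: "\<And>g. g \<in> carrier G \<Longrightarrow> \<exists>x\<in>P. \<exists>i::nat. g = x \<otimes> b [^] i"
    and disj: "\<And>i::nat. b [^] i \<in> P \<Longrightarrow> b [^] i = \<one>"
begin

definition \<beta> where "\<beta> x = b \<otimes> x \<otimes> inv b"

sublocale P: normal P G
  unfolding P_def by (rule derived_self_is_normal)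

lemma PG [simp]: "x \<in> P \<Longrightarrow> x \<in> carrier G"
  by (rule P.mem_carrier)

lemma finP: "finite P"
  using fin finite_subset[OF P.subset] by blast

lemma bpow_eq: "b [^] (i::nat) = b [^] j \<longleftrightarrow> [i = j] (mod q ^ v)"
  using pow_eq_iff_cong_ord[OF b(1)] b(2) by simp

lemma b_notin_P: "b \<notin> P"
proof
  assume "b \<in> P"
  then have "b [^] (1::nat) = b [^] (0::nat)" using disj[of 1] b by simp
  then have "[1 = 0] (mod q ^ v)" using bpow_eq by blast
  then have "q ^ v dvd 1" by (simp add: cong_0_iff)
  then show False using q v prime_gt_1_nat[OF q] by (simp add: power_eq_1_iff nat_dvd_1_iff_1)
qed

lemma P_comm: "x \<in> P \<Longrightarrow> y \<in> P \<Longrightarrow> x \<otimes> y = y \<otimes> x"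
  using proper[OF P.subgroup_axioms] b_notin_P b by blast

lemma beta_P: "x \<in> P \<Longrightarrow> \<beta> x \<in> P"
  unfolding \<beta>_def using P.inv_op_closed2 b by simp

lemma beta_mult: "x \<in> carrier G \<Longrightarrow> y \<in> carrier G \<Longrightarrow> \<beta> (x \<otimes> y) = \<beta> x \<otimes> \<beta> y"
  unfolding \<beta>_def using b by (simp add: group_normalize)

lemma beta_inv: "x \<in> carrier G \<Longrightarrow> \<beta> (inv x) = inv (\<beta> x)"
  unfolding \<beta>_def using b by (simp add: group_normalize)

lemma beta_one: "\<beta> \<one> = \<one>"
  unfolding \<beta>_def using b by simp

lemma conj_bpow_in:
  assumes "\<And>x. x \<in> N \<Longrightarrow> \<beta> x \<in> N" "N \<subseteq> P" "x \<in> N"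
  shows "b [^] (i::nat) \<otimes> x \<otimes> inv (b [^] i) \<in> N"
proof (induction i)
  case (Suc i)
  have "b [^] Suc i = b \<otimes> b [^] i" using pow_commute[of b b i] b by simp
  then have "b [^] Suc i \<otimes> x \<otimes> inv (b [^] Suc i) = \<beta> (b [^] i \<otimes> x \<otimes> inv (b [^] i))"
    unfolding \<beta>_def using b assms(2,3) by (simp add: group_normalize subset_iff)
  then show ?case using assms(1) Suc by simp
qed (use assms in auto)

text \<open>
  The products of elements of \<open>N\<close> with powers of \<open>b [^] m\<close> form a subgroup. If it is proper, it is
  abelian. This is used with \<open>m = 1\<close> for proper subgroups \<open>N\<close> of \<open>P\<close>, and with \<open>m = q\<close> for \<open>N = P\<close>.
\<close>

lemma proper_product_commutes:
  assumes N: "subgroup N G" "N \<subseteq> P" "\<And>x. x \<in> N \<Longrightarrow> \<beta> x \<in> N"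
    and ne: "\<exists>g\<in>carrier G. \<forall>x\<in>N. \<forall>i::nat. g \<noteq> x \<otimes> b [^] (m * i)" and x: "x \<in> N"
  shows "b [^] (m::nat) \<otimes> x = x \<otimes> b [^] m"
proof -
  interpret N: subgroup N G by (rule N)
  have NG: "x \<in> carrier G" if "x \<in> N" for x using that N.mem_carrier by blast
  let ?M = "{x \<otimes> b [^] (m * i) |x i. x \<in> N}"
  have "subgroup ?M G"
  proof (rule subgroupI)
    show "?M \<subseteq> carrier G" using NG b by auto
    show "?M \<noteq> {}" using x by auto
  next
    fix a assume "a \<in> ?M"
    then obtain x i where a: "x \<in> N" "a = x \<otimes> b [^] (m * i)" by blast
    let ?j = "m * ((q ^ v - 1) * i)"
    have "b [^] ?j \<otimes> b [^] (m * i) = b [^] (q ^ v * (m * i))"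
    proof -
      have "q ^ v > 0" using prime_gt_0_nat[OF q] by simp
      then obtain r where r: "q ^ v = Suc r" using gr0_conv_Suc by blast
      have "?j + m * i = q ^ v * (m * i)" unfolding r by (simp add: algebra_simps)
      then show ?thesis using b by (simp add: nat_pow_mult)
    qed
    also have "\<dots> = \<one>" using b pow_ord_eq_1[OF b(1)] by (metis nat_pow_one nat_pow_pow)
    finally have j: "inv (b [^] (m * i)) = b [^] ?j" using b by (simp add: inv_equality)
    have "inv a = (b [^] ?j \<otimes> inv x \<otimes> inv (b [^] ?j)) \<otimes> b [^] ?j"
      unfolding a(2) using NG[OF a(1)] b j by (simp add: inv_mult_group m_assoc)
    moreover have "b [^] ?j \<otimes> inv x \<otimes> inv (b [^] ?j) \<in> N" using conj_bpow_in N(2,3) a(1) N.m_inv_closed by blast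
    ultimately show "inv a \<in> ?M" by blast
  next
    fix a a' assume "a \<in> ?M" "a' \<in> ?M"
    then obtain x i x' i' where a: "x \<in> N" "a = x \<otimes> b [^] (m * i)" "x' \<in> N" "a' = x' \<otimes> b [^] (m * i')" by blast
    have "a \<otimes> a' = x \<otimes> (b [^] (m * i) \<otimes> x' \<otimes> inv (b [^] (m * i))) \<otimes> (b [^] (m * i) \<otimes> b [^] (m * i'))"
      unfolding a(2,4) using NG a(1,3) b by (simp add: group_normalize)
    also have "\<dots> = x \<otimes> (b [^] (m * i) \<otimes> x' \<otimes> inv (b [^] (m * i))) \<otimes> b [^] (m * (i + i'))"
      using b by (simp add: nat_pow_mult distrib_left)
    finally show "a \<otimes> a' \<in> ?M" using conj_bpow_in[OF N(3,2) a(3)] a(1) N.m_closed by blast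
  qed
  moreover have "?M \<noteq> carrier G" using ne by blast
  moreover have "b [^] m \<in> ?M" using N.one_closed b by (intro CollectI exI[of _ \<one>] exI[of _ 1]) auto
  moreover have "x \<in> ?M" using x NG b by (intro CollectI exI[of _ x] exI[of _ 0]) auto
  ultimately show ?thesis using proper by blast
qed

text \<open>
  As \<open>P\<close> is the derived subgroup, the homomorphism \<open>k \<mapsto> [k, b]\<close> of \<open>P\<close> to itself is onto. On a finite
  group it is then injective, and its kernel is the set of fixed points.
\<close>

lemma fixed_point_free:
  assumes x: "x \<in> P" "\<beta> x = x"
  shows "x = \<one>"
proof -
  let ?s = "\<lambda>k. k \<otimes> b \<otimes> inv k \<otimes> inv b"
  have s_alt: "?s k = k \<otimes> inv (\<beta> k)" if "k \<in> P" for k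
    unfolding \<beta>_def using that b by (simp add: group_normalize)
  have "P \<subseteq> {?s k |k. k \<in> P}"
    using derived_of_cyclic_by_abelian[OF P.normal_axioms P_comm b(1) dec] P_def by simp
  then have "P \<subseteq> ?s ` P" by blast
  moreover have "?s ` P \<subseteq> P" using s_alt beta_P by auto
  ultimately have "?s ` P = P" by blast
  then have "inj_on ?s P" using finP by (simp add: eq_card_imp_inj_on)
  moreover have "?s x = ?s \<one>" using s_alt[OF x(1)] s_alt[OF P.one_closed] x beta_one by simp
  ultimately show ?thesis using x(1) by (meson P.one_closed inj_onD)
qed

lemma irr:
  assumes N: "subgroup N G" "N \<subseteq> P" "\<And>x. x \<in> N \<Longrightarrow> \<beta> x \<in> N" and x: "x \<in> N" "x \<noteq> \<one>"
  shows "N = P"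
proof (rule ccontr)
  assume "N \<noteq> P"
  then obtain y where y: "y \<in> P" "y \<notin> N" using N(2) by blast
  interpret N: subgroup N G by (rule N)
  have "\<forall>x\<in>N. \<forall>i::nat. y \<noteq> x \<otimes> b [^] (1 * i)"
  proof (intro ballI allI notI)
    fix x i assume x: "x \<in> N" and eq: "y = x \<otimes> b [^] (1 * i :: nat)"
    have xP: "x \<in> P" using x N by blast
    have "b [^] i = inv x \<otimes> y" unfolding eq using xP b by (simp add: group_normalize)
    then have "b [^] i \<in> P" using xP y by simp
    then have "b [^] i = \<one>" by (rule disj)
    then show False using eq x y xP by simp
  qed
  then have ne: "\<exists>g\<in>carrier G. \<forall>x\<in>N. \<forall>i::nat. g \<noteq> x \<otimes> b [^] (1 * i)"
    by (rule bexI[of _ y]) (use y in simp)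
  have "b [^] (1::nat) \<otimes> x = x \<otimes> b [^] (1::nat)"
    by (rule proper_product_commutes[OF N(1,2) _ ne x(1)]) (rule N(3))
  then have "\<beta> x = x" unfolding \<beta>_def using b N x by (simp add: group_normalize subset_iff)
  then show False using fixed_point_free x N by blast
qed

lemma bq_central:
  assumes x: "x \<in> P" shows "b [^] q \<otimes> x \<otimes> inv (b [^] q) = x"
proof -
  have "\<forall>x\<in>P. \<forall>i::nat. b \<noteq> x \<otimes> b [^] (q * i)"
  proof (intro ballI allI notI)
    fix x i assume x: "x \<in> P" and eq: "b = x \<otimes> b [^] (q * i :: nat)"
    have "q ^ v > 0" using prime_gt_0_nat[OF q] by simp
    then obtain r where r: "q ^ v = Suc r" using gr0_conv_Suc by blast
    have b1: "b [^] (1::nat) = b" using b by simp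
    have "b [^] (1 + r * (q * i)) = b [^] (1::nat) \<otimes> b [^] (r * (q * i))"
      by (rule nat_pow_mult[symmetric, OF b(1)])
    also have "b [^] (1::nat) = x \<otimes> b [^] (q * i)" by (rule trans[OF b1 eq])
    also have "x \<otimes> b [^] (q * i) \<otimes> b [^] (r * (q * i)) = x \<otimes> (b [^] (q * i) \<otimes> b [^] (r * (q * i)))" using x b by (simp add: m_assoc)
    also have "\<dots> = x \<otimes> b [^] (q ^ v * (q * i))" unfolding r mult_Suc by (simp only: nat_pow_mult[OF b(1)])
    also have "\<dots> = x" using b pow_ord_eq_1[OF b(1)] x by (simp add: nat_pow_pow[symmetric])
    finally have bx: "b [^] (1 + r * (q * i)) = x" .
    then have "b [^] (1 + r * (q * i)) \<in> P" using x by metis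
    then have "b [^] (1 + r * (q * i)) = \<one>" by (rule disj)
    then have "x = \<one>" using bx by metis
    then have "b [^] (1::nat) = b [^] (q * i)" using trans[OF b1 eq] b by simp
    then have "[1 = q * i] (mod q ^ v)" using bpow_eq by blast
    moreover have "q dvd q ^ v" using v by (simp add: dvd_power)
    ultimately have "[1 = q * i] (mod q)" by (rule cong_dvd_modulus_nat)
    then have "q dvd 1" using cong_dvd_iff[of 1 "q * i" q] by simp
    then show False using prime_gt_1_nat[OF q] by simp
  qed
  then have ne: "\<exists>g\<in>carrier G. \<forall>x\<in>P. \<forall>i::nat. g \<noteq> x \<otimes> b [^] (q * i)"
    by (rule bexI[of _ b]) (use b in simp)
  have "b [^] q \<otimes> x = x \<otimes> b [^] q"
    by (rule proper_product_commutes[OF P.subgroup_axioms _ _ ne x]) (auto simp: beta_P)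
  then show ?thesis using b x by (simp add: group_normalize)
qed

lemma P_nontrivial: "\<exists>x\<in>P. x \<noteq> \<one>"
proof (rule ccontr)
  assume "\<not> ?thesis"
  then have triv: "x = \<one>" if "x \<in> P" for x using that by blast
  have "\<exists>i::nat. g = b [^] i" if g: "g \<in> carrier G" for g
  proof -
    obtain x i where "x \<in> P" "g = x \<otimes> b [^] (i::nat)" using dec[OF g] by blast
    then have "g = b [^] i" using triv[of x] b by simp
    then show ?thesis by blast
  qed
  then have "x \<otimes> y = y \<otimes> x" if "x \<in> carrier G" "y \<in> carrier G" for x y
    using that b by (metis add.commute nat_pow_mult)
  then show False using noncomm group_comm_groupI by blast
qed

text \<open>
  The endomorphisms of \<open>P\<close> that commute with the action of \<open>b\<close>; by Schur's lemma this will be a field.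
\<close>

definition E where "E = {f. (\<forall>x\<in>P. f x \<in> P) \<and> (\<forall>x\<in>P. \<forall>y\<in>P. f (x \<otimes> y) = f x \<otimes> f y) \<and> (\<forall>x\<in>P. f (\<beta> x) = \<beta> (f x))}"

lemma E_D:
  assumes "f \<in> E"
  shows "\<And>x. x \<in> P \<Longrightarrow> f x \<in> P" "\<And>x y. x \<in> P \<Longrightarrow> y \<in> P \<Longrightarrow> f (x \<otimes> y) = f x \<otimes> f y" "\<And>x. x \<in> P \<Longrightarrow> f (\<beta> x) = \<beta> (f x)"
    "f \<one> = \<one>" "\<And>x. x \<in> P \<Longrightarrow> f (inv x) = inv (f x)"
proof -
  show 1: "\<And>x. x \<in> P \<Longrightarrow> f x \<in> P" and 2: "\<And>x y. x \<in> P \<Longrightarrow> y \<in> P \<Longrightarrow> f (x \<otimes> y) = f x \<otimes> f y"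
    and "\<And>x. x \<in> P \<Longrightarrow> f (\<beta> x) = \<beta> (f x)" using assms unfolding E_def by auto
  have "f \<one> \<otimes> f \<one> = f \<one>" using 2[of \<one> \<one>] by simp
  then show 3: "f \<one> = \<one>" using 1[of \<one>] by simp
  show "f (inv x) = inv (f x)" if "x \<in> P" for x
    using 2[of "inv x" x] 1[of x] 1[of "inv x"] 3 that by (simp add: inv_equality[symmetric])
qed

lemma E_comp: "f \<in> E \<Longrightarrow> g \<in> E \<Longrightarrow> (\<lambda>x. f (g x)) \<in> E"
  unfolding E_def by auto

lemma E_beta: "\<beta> \<in> E"
  unfolding E_def using beta_P beta_mult by auto

lemma E_id: "(\<lambda>x. x) \<in> E"
  unfolding E_def by auto

lemma E_mult: "f \<in> E \<Longrightarrow> g \<in> E \<Longrightarrow> (\<lambda>x. f x \<otimes> g x) \<in> E"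
proof -
  assume f: "f \<in> E" "g \<in> E"
  note Ef = E_D[OF f(1)] and Eg = E_D[OF f(2)]
  have "f (x \<otimes> y) \<otimes> g (x \<otimes> y) = f x \<otimes> g x \<otimes> (f y \<otimes> g y)" if xy: "x \<in> P" "y \<in> P" for x y
  proof -
    have "f (x \<otimes> y) \<otimes> g (x \<otimes> y) = f x \<otimes> (f y \<otimes> g x) \<otimes> g y"
      using xy Ef(1)[of x] Ef(1)[of y] Eg(1)[of x] Eg(1)[of y] Ef(2)[of x y] Eg(2)[of x y] by (simp add: m_assoc)
    also have "f y \<otimes> g x = g x \<otimes> f y" using P_comm Ef(1) Eg(1) xy by blast
    finally show ?thesis
      using xy Ef(1)[of x] Ef(1)[of y] Eg(1)[of x] Eg(1)[of y] by (simp add: m_assoc)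
  qed
  then show ?thesis unfolding E_def using Ef Eg beta_mult by auto
qed

lemma E_inv: "f \<in> E \<Longrightarrow> (\<lambda>x. inv (f x)) \<in> E"
proof -
  assume f: "f \<in> E"
  note Ef = E_D[OF f]
  have "inv (f (x \<otimes> y)) = inv (f x) \<otimes> inv (f y)" if "x \<in> P" "y \<in> P" for x y
    using that Ef P_comm[of "f x" "f y"] by (simp add: inv_mult_group[symmetric])
  then show ?thesis unfolding E_def using Ef beta_inv by auto
qed

lemma E_eqI:
  assumes f: "f \<in> E" and g: "g \<in> E" and x: "x \<in> P" "x \<noteq> \<one>" "f x = g x" and y: "y \<in> P"
  shows "f y = g y"
proof -
  note Ef = E_D[OF f] and Eg = E_D[OF g]
  have "subgroup {y \<in> P. f y = g y} G"
    by (rule subgroupI) (use Ef Eg in \<open>auto intro: exI[of _ \<one>]\<close>)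
  then have "{y \<in> P. f y = g y} = P"
    by (rule irr[where x = x]) (use x Ef Eg beta_P in auto)
  then show ?thesis using y by blast
qed

definition x0 where "x0 = (SOME x. x \<in> P \<and> x \<noteq> \<one>)"

lemma x0: "x0 \<in> P" "x0 \<noteq> \<one>"
proof -
  have "\<exists>x. x \<in> P \<and> x \<noteq> \<one>" using P_nontrivial by blast
  then have "x0 \<in> P \<and> x0 \<noteq> \<one>" unfolding x0_def by (rule someI_ex)
  then show "x0 \<in> P" "x0 \<noteq> \<one>" by auto
qed

text \<open>
  The endomorphisms in \<open>E\<close> that commute with all of \<open>E\<close> contain \<open>\<beta>\<close>, so their values at \<open>x0\<close> form an
  invariant subgroup, which is all of \<open>P\<close>. Since members of \<open>E\<close> are determined by their value at \<open>x0\<close>,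
  this gives at once that \<open>E\<close> is commutative and that every element of \<open>P\<close> is such a value.
\<close>

lemma E_transitive:
  assumes x: "x \<in> P"
  shows "\<exists>f\<in>E. f x0 = x \<and> (\<forall>g\<in>E. \<forall>y\<in>P. f (g y) = g (f y))"
proof -
  define C where "C = {f \<in> E. \<forall>g\<in>E. \<forall>y\<in>P. f (g y) = g (f y)}"
  have C1: "\<beta> \<in> C" "(\<lambda>x. x) \<in> C" unfolding C_def using E_beta E_id E_D(3) by auto
  have C2: "(\<lambda>x. f x \<otimes> g x) \<in> C" if "f \<in> C" "g \<in> C" for f g
    using that E_mult E_D(1,2) unfolding C_def by simp
  have C3: "(\<lambda>x. inv (f x)) \<in> C" if "f \<in> C" for f
    using that E_inv E_D(1,5) unfolding C_def by simp
  have C4: "(\<lambda>x. \<beta> (f x)) \<in> C" if fC: "f \<in> C" for f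
  proof -
    have f: "f \<in> E" "\<And>g y. g \<in> E \<Longrightarrow> y \<in> P \<Longrightarrow> f (g y) = g (f y)" using fC unfolding C_def by auto
    have "\<beta> (f (g y)) = g (\<beta> (f y))" if "g \<in> E" "y \<in> P" for g y
      using f(2)[OF that] E_D(3)[OF that(1)] E_D(1)[OF f(1) that(2)] by simp
    then show ?thesis unfolding C_def using E_comp[OF E_beta f(1)] by auto
  qed
  let ?S = "{f x0 |f. f \<in> C}"
  have CE: "f \<in> C \<Longrightarrow> f x0 \<in> P" for f unfolding C_def using E_D(1) x0 by blast
  have "subgroup ?S G"
  proof (rule subgroupI)
    show "?S \<subseteq> carrier G" using CE PG by blast
    show "?S \<noteq> {}" using C1 by blast
  next
    fix a assume "a \<in> ?S"
    then obtain f where "f \<in> C" "a = f x0" by auto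
    then show "inv a \<in> ?S" using C3[of f] by auto
  next
    fix a d assume "a \<in> ?S" "d \<in> ?S"
    then obtain f g where "f \<in> C" "a = f x0" "g \<in> C" "d = g x0" by auto
    then show "a \<otimes> d \<in> ?S" using C2[of f g] by auto
  qed
  moreover have "?S \<subseteq> P" using CE by blast
  moreover have "x0 \<in> ?S" using C1(2) by (intro CollectI exI[of _ "\<lambda>x. x"]) simp
  moreover have "\<beta> y \<in> ?S" if y: "y \<in> ?S" for y
  proof -
    obtain f where f: "f \<in> C" "y = f x0" using y by auto
    show ?thesis unfolding f(2) using C4[OF f(1)] by (intro CollectI exI[of _ "\<lambda>x. \<beta> (f x)"]) simp
  qed
  ultimately have "?S = P" using x0(2) by (intro irr[where x = x0])
  then have "x \<in> ?S" using x by simp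
  then obtain f where "f \<in> C" "f x0 = x" by auto
  then show ?thesis unfolding C_def by (intro bexI[of _ f]) simp_all
qed

definition \<phi> where "\<phi> x = (SOME f. f \<in> E \<and> f x0 = x)"

lemma phi: "x \<in> P \<Longrightarrow> \<phi> x \<in> E" "x \<in> P \<Longrightarrow> \<phi> x x0 = x"
proof -
  assume "x \<in> P"
  then have "\<exists>f. f \<in> E \<and> f x0 = x" using E_transitive[of x] by auto
  then have "\<phi> x \<in> E \<and> \<phi> x x0 = x" unfolding \<phi>_def by (rule someI_ex)
  then show "\<phi> x \<in> E" "\<phi> x x0 = x" by auto
qed

lemma phi_eqI:
  assumes "x \<in> P" "f \<in> E" "f x0 = x" "y \<in> P"
  shows "\<phi> x y = f y"
proof (rule E_eqI[OF phi(1)[OF assms(1)] assms(2) x0 _ assms(4)])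
  show "\<phi> x x0 = f x0" using phi(2)[OF assms(1)] assms(3) by simp
qed

lemma phi_closed: "x \<in> P \<Longrightarrow> y \<in> P \<Longrightarrow> \<phi> x y \<in> P"
  using E_D(1)[OF phi(1)] .

lemma phi_comm: "x \<in> P \<Longrightarrow> y \<in> P \<Longrightarrow> \<phi> x y = \<phi> y x"
proof -
  assume xy: "x \<in> P" "y \<in> P"
  obtain f where f: "f \<in> E" "f x0 = x" "\<forall>g\<in>E. \<forall>y\<in>P. f (g y) = g (f y)" using E_transitive xy by blast
  have "\<phi> x y = f (\<phi> y x0)" using phi_eqI[OF xy(1) f(1,2) xy(2)] phi(2)[OF xy(2)] by simp
  also have "\<dots> = \<phi> y x" using f phi(1)[OF xy(2)] x0 by simp
  finally show ?thesis .
qed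

lemma phi_assoc: "x \<in> P \<Longrightarrow> y \<in> P \<Longrightarrow> z \<in> P \<Longrightarrow> \<phi> (\<phi> x y) z = \<phi> x (\<phi> y z)"
  by (rule phi_eqI[of _ "\<lambda>z. \<phi> x (\<phi> y z)"]) (auto simp: phi phi_closed E_comp)

text \<open>
  Evaluation at \<open>x0\<close> is a bijection from \<open>E\<close> to \<open>P\<close>; the ring structure of \<open>E\<close> is transported along it.
\<close>

definition F :: "'a ring" where
  "F = \<lparr>carrier = P, monoid.mult = \<phi>, one = x0, ring.zero = \<one>, ring.add = (\<otimes>)\<rparr>"

lemma F_simps [simp]: "carrier F = P" "x \<otimes>\<^bsub>F\<^esub> y = \<phi> x y" "\<one>\<^bsub>F\<^esub> = x0" "\<zero>\<^bsub>F\<^esub> = \<one>" "x \<oplus>\<^bsub>F\<^esub> y = x \<otimes> y"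
  unfolding F_def by simp_all

lemma field_F: "field F"
proof -
  have ag: "abelian_group F"
  proof (rule abelian_groupI)
    show "x \<oplus>\<^bsub>F\<^esub> y = y \<oplus>\<^bsub>F\<^esub> x" if "x \<in> carrier F" "y \<in> carrier F" for x y
      using P_comm that by simp
    show "\<exists>y\<in>carrier F. y \<oplus>\<^bsub>F\<^esub> x = \<zero>\<^bsub>F\<^esub>" if "x \<in> carrier F" for x
      by (rule bexI[of _ "inv x"]) (use that in auto)
  qed (auto simp: m_assoc)
  have cm: "comm_monoid F"
  proof (rule comm_monoidI)
    show "x \<otimes>\<^bsub>F\<^esub> y = y \<otimes>\<^bsub>F\<^esub> x" if "x \<in> carrier F" "y \<in> carrier F" for x y
      using phi_comm that by simp
    show "\<one>\<^bsub>F\<^esub> \<otimes>\<^bsub>F\<^esub> x = x" if "x \<in> carrier F" for x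
      using phi_eqI[OF x0(1) E_id] that by simp
  qed (simp_all add: phi_closed phi_assoc x0)
  have "cring F"
  proof (rule cringI[OF ag cm])
    fix x y z assume xyz: "x \<in> carrier F" "y \<in> carrier F" "z \<in> carrier F"
    have "\<phi> (x \<otimes> y) z = \<phi> z x \<otimes> \<phi> z y" using phi_comm[of "x \<otimes> y" z] E_D(2)[OF phi(1)[of z]] xyz by simp
    then show "(x \<oplus>\<^bsub>F\<^esub> y) \<otimes>\<^bsub>F\<^esub> z = x \<otimes>\<^bsub>F\<^esub> z \<oplus>\<^bsub>F\<^esub> y \<otimes>\<^bsub>F\<^esub> z" using phi_comm xyz by simp
  qed
  then interpret cring F .
  show ?thesis
  proof (rule cring_fieldI2)
    show "\<zero>\<^bsub>F\<^esub> \<noteq> \<one>\<^bsub>F\<^esub>" using x0 by simp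
  next
    fix x assume x: "x \<in> carrier F" "x \<noteq> \<zero>\<^bsub>F\<^esub>"
    then have xP: "x \<in> P" "x \<noteq> \<one>" by auto
    note Ex = E_D[OF phi(1)[OF xP(1)]]
    have "inj_on (\<phi> x) P"
    proof (rule inj_onI)
      fix y z assume yz: "y \<in> P" "z \<in> P" "\<phi> x y = \<phi> x z"
      let ?N = "{y \<in> P. \<phi> x y = \<one>}"
      have N: "subgroup ?N G" by (rule subgroupI) (use Ex in \<open>auto intro: exI[of _ \<one>]\<close>)
      have "\<phi> x (y \<otimes> inv z) = \<one>" using Ex yz by simp
      then have yzN: "y \<otimes> inv z \<in> ?N" using yz by simp
      have "y \<otimes> inv z = \<one>"
      proof (rule ccontr)
        assume "y \<otimes> inv z \<noteq> \<one>"
        then have "?N = P" using Ex beta_P beta_one yzN by (intro irr[OF N _ _ yzN]) auto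
        then show False using x0(1) phi(2)[OF xP(1)] xP(2) by (metis (mono_tags, lifting) mem_Collect_eq)
      qed
      then have "y \<otimes> inv z \<otimes> z = \<one> \<otimes> z" by simp
      then show "y = z" using yz by (simp add: group_normalize)
    qed
    moreover have "\<phi> x ` P \<subseteq> P" using Ex by blast
    ultimately have "\<phi> x ` P = P" using finP by (simp add: endo_inj_surj)
    then obtain y where "y \<in> P" "\<phi> x y = x0" using x0 by (metis imageE)
    then show "\<exists>y\<in>carrier F. x \<otimes>\<^bsub>F\<^esub> y = \<one>\<^bsub>F\<^esub>" by auto
  qed
qed

lemma phi_zeta: "x \<in> P \<Longrightarrow> \<phi> (\<beta> x0) x = \<beta> x"
  by (rule phi_eqI) (auto simp: beta_P x0 E_beta)

lemma zeta_pow: "\<beta> x0 [^]\<^bsub>F\<^esub> (k::nat) = b [^] k \<otimes> x0 \<otimes> inv (b [^] k) \<and> \<beta> x0 [^]\<^bsub>F\<^esub> k \<in> P"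
proof (induction k)
  case 0 then show ?case using x0 by simp
next
  case (Suc k)
  interpret F: field F by (rule field_F)
  have z: "\<beta> x0 \<in> P" using beta_P x0 by blast
  have "b [^] Suc k = b \<otimes> b [^] k" using pow_commute[of b b k] b by simp
  then have "b [^] Suc k \<otimes> x0 \<otimes> inv (b [^] Suc k) = \<beta> (b [^] k \<otimes> x0 \<otimes> inv (b [^] k))"
    unfolding \<beta>_def using b x0 by (simp add: group_normalize)
  moreover have "\<beta> x0 [^]\<^bsub>F\<^esub> Suc k = \<beta> (\<beta> x0 [^]\<^bsub>F\<^esub> k)"
  proof -
    have y: "\<beta> x0 [^]\<^bsub>F\<^esub> k \<in> P" using Suc by blast
    have "\<beta> x0 [^]\<^bsub>F\<^esub> Suc k = \<phi> (\<beta> x0 [^]\<^bsub>F\<^esub> k) (\<beta> x0)" by simp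
    also have "\<dots> = \<phi> (\<beta> x0) (\<beta> x0 [^]\<^bsub>F\<^esub> k)" by (rule phi_comm[OF y z])
    also have "\<dots> = \<beta> (\<beta> x0 [^]\<^bsub>F\<^esub> k)" by (rule phi_zeta[OF y])
    finally show ?thesis .
  qed
  ultimately show ?case using Suc beta_P by metis
qed

lemma is_field_semidirect: "field_semidirect F (\<beta> x0) p q n G b v"
proof -
  interpret F: field F by (rule field_F)
  have "cyclotomic_field F (\<beta> x0) p q n"
  proof (rule cyclotomic_field.intro[OF field_F], rule cyclotomic_field_axioms.intro)
    show "finite (carrier F)" "card (carrier F) = p ^ n" using finP cardP by simp_all
    show "Factorial_Ring.prime p" "Factorial_Ring.prime q" "p \<noteq> q" by (rule p, rule q, rule pq)
    show "\<beta> x0 \<in> carrier F" using beta_P x0 by simp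
    show "\<beta> x0 [^]\<^bsub>F\<^esub> q = \<one>\<^bsub>F\<^esub>" using zeta_pow[of q] bq_central[OF x0(1)] by simp
    show "\<beta> x0 \<noteq> \<one>\<^bsub>F\<^esub>" using fixed_point_free x0 by auto
  next
    fix S assume S: "subgroup S (add_monoid F)" "\<And>x. x \<in> S \<Longrightarrow> \<beta> x0 \<otimes>\<^bsub>F\<^esub> x \<in> S" "S \<noteq> {\<zero>\<^bsub>F\<^esub>}"
    interpret S: subgroup S "add_monoid F" by (rule S)
    have SP: "S \<subseteq> P" using S.subset by simp
    have Sone: "\<one> \<in> S" using S.one_closed by simp
    have "subgroup S G"
    proof (rule subgroupI)
      fix a assume a: "a \<in> S"
      have aP: "a \<in> P" using a SP by blast
      have m: "\<ominus>\<^bsub>F\<^esub> a \<in> S" unfolding a_inv_def by (rule S.m_inv_closed[OF a])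
      have "\<ominus>\<^bsub>F\<^esub> a \<otimes> a = \<one>" using F.l_neg[of a] aP by simp
      then have "inv a = \<ominus>\<^bsub>F\<^esub> a" using aP m SP by (intro inv_equality) auto
      then show "inv a \<in> S" using m by simp
    next
      fix a d assume "a \<in> S" "d \<in> S" then show "a \<otimes> d \<in> S" using S.m_closed[of a d] by simp
    next
      show "S \<subseteq> carrier G" by (rule subset_trans[OF SP P.subset])
      show "S \<noteq> {}" using Sone by (metis empty_iff)
    qed
    moreover obtain x where "x \<in> S" "x \<noteq> \<one>" using S(3) Sone by auto
    moreover have "\<beta> x \<in> S" if "x \<in> S" for x
    proof -
      have "x \<in> P" using that SP by blast
      then show ?thesis using S(2)[OF that] phi_zeta[of x] by simp
    qed
    ultimately have "S = P" using irr[of S] SP by blast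
    then show "S = carrier F" by (simp only: F_simps)
  qed
  then interpret cyclotomic_field F "\<beta> x0" p q n .
  show ?thesis
  proof unfold_locales
    show "b \<otimes> x \<otimes> inv b = \<beta> x0 \<otimes>\<^bsub>F\<^esub> x" if "x \<in> carrier F" for x
      using phi_zeta that by (simp add: \<beta>_def[symmetric])
    show "\<exists>x\<in>carrier F. \<exists>i::nat. g = x \<otimes> b [^] i" if "g \<in> carrier G" for g
      using dec[OF that] by simp
    show "b [^] i = \<one>" if "b [^] i \<in> carrier F" for i :: nat
      using disj[of i] that by simp
  qed (use P.subset b v in simp_all)
qed

end

lemma miller_moreno_field:
  fixes G :: "('a, 'm) monoid_scheme"
  assumes "miller_moreno_with_parameters G p q v"
  shows "\<exists>(F :: 'a ring) \<zeta> n b. field_semidirect F \<zeta> p q n G b v"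
proof -
  have s: "schmidt_group_with_parameters G p q v" and m: "miller_moreno_group G"
    using assms unfolding miller_moreno_with_parameters_def by auto
  interpret group G using m unfolding miller_moreno_group_def by blast
  let ?P = "derived G (carrier G)"
  obtain n where n: "card ?P = p ^ n" using s unfolding schmidt_group_with_parameters_def by blast
  obtain b where b: "b \<in> carrier G" "card (generate G {b}) = q ^ v" "internal_semidirect G ?P (generate G {b})"
    using s unfolding schmidt_group_with_parameters_def by blast
  have fin: "finite (carrier G)" using m unfolding miller_moreno_group_def by blast
  have gen: "generate G {b} = {b [^]\<^bsub>G\<^esub> i |i. i \<in> (UNIV :: nat set)}" using generate_pow_on_finite_carrier[OF fin b(1)] .
  have int: "?P \<inter> generate G {b} = {\<one>\<^bsub>G\<^esub>}" "?P <#>\<^bsub>G\<^esub> generate G {b} = carrier G"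
    using b(3) unfolding internal_semidirect_def by auto
  have "miller_moreno_structure G p q n v b ?P"
  proof unfold_locales
    show "finite (carrier G)" "\<not> comm_group G" using m unfolding miller_moreno_group_def by auto
    show "Factorial_Ring.prime p" "Factorial_Ring.prime q" "p \<noteq> q" "1 \<le> v"
      using s unfolding schmidt_group_with_parameters_def by auto
    show "group.ord G b = q ^ v" using generate_pow_card[OF b(1)] b(2) by simp
  next
    fix H x y assume H: "subgroup H G" "H \<noteq> carrier G" "x \<in> H" "y \<in> H"
    then have "comm_group (G\<lparr>carrier := H\<rparr>)" using m unfolding miller_moreno_group_def by blast
    then interpret H: comm_group "G\<lparr>carrier := H\<rparr>" .
    show "x \<otimes>\<^bsub>G\<^esub> y = y \<otimes>\<^bsub>G\<^esub> x" using H.m_comm[of x y] H by simp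
  next
    fix g assume "g \<in> carrier G"
    then have "g \<in> ?P <#>\<^bsub>G\<^esub> generate G {b}" using int by simp
    then obtain x y where "x \<in> ?P" "y \<in> generate G {b}" "g = x \<otimes>\<^bsub>G\<^esub> y" unfolding set_mult_def by auto
    then show "\<exists>x\<in>?P. \<exists>i::nat. g = x \<otimes>\<^bsub>G\<^esub> b [^]\<^bsub>G\<^esub> i" unfolding gen by auto
  next
    fix i :: nat assume "b [^]\<^bsub>G\<^esub> i \<in> ?P"
    then show "b [^]\<^bsub>G\<^esub> i = \<one>\<^bsub>G\<^esub>" using int(1) unfolding gen by blast
  qed (use n b in auto)
  from miller_moreno_structure.is_field_semidirect[OF this] show ?thesis by (intro exI)
qed

section \<open>Isomorphisms of endomorphism semigroups from unique lifting\<close>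

text \<open>
  Both semigroups are related by \<open>\<pi> \<circ> f = g \<circ> \<pi>\<close>. The assumption \<open>ker\<close> makes every \<open>f\<close> induce a \<open>g\<close>, and
  the last two assumptions make this correspondence bijective.
\<close>

lemma End_iso_of_unique_lifting:
  fixes H :: "('c, 'd) monoid_scheme" and G :: "('a, 'm) monoid_scheme"
  assumes H: "group H" and G: "group G" and pi: "\<pi> \<in> hom H G" and surj: "\<pi> ` carrier H = carrier G"
    and ker: "\<And>f x. f \<in> hom H H \<Longrightarrow> x \<in> carrier H \<Longrightarrow> \<pi> x = \<one>\<^bsub>G\<^esub> \<Longrightarrow> \<pi> (f x) = \<one>\<^bsub>G\<^esub>"
    and up: "\<And>g. g \<in> hom G G \<Longrightarrow> \<exists>f\<in>hom H H. \<forall>x\<in>carrier H. \<pi> (f x) = g (\<pi> x)"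
    and uniq: "\<And>f f' x. f \<in> hom H H \<Longrightarrow> f' \<in> hom H H \<Longrightarrow> (\<And>x. x \<in> carrier H \<Longrightarrow> \<pi> (f x) = \<pi> (f' x))
      \<Longrightarrow> x \<in> carrier H \<Longrightarrow> f x = f' x"
  shows "End H \<cong> End G"
proof -
  interpret H: group H by (rule H)
  interpret G: group G by (rule G)
  interpret pi: group_hom H G \<pi> by unfold_locales (rule pi)
  define s where "s y = (SOME x. x \<in> carrier H \<and> \<pi> x = y)" for y
  have s: "s y \<in> carrier H" "\<pi> (s y) = y" if "y \<in> carrier G" for y
  proof -
    have "y \<in> \<pi> ` carrier H" using that surj by simp
    then have "\<exists>x. x \<in> carrier H \<and> \<pi> x = y" by auto
    then have "s y \<in> carrier H \<and> \<pi> (s y) = y" unfolding s_def by (rule someI_ex)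
    then show "s y \<in> carrier H" "\<pi> (s y) = y" by auto
  qed
  define \<Phi> where "\<Phi> f = (\<lambda>y\<in>carrier G. \<pi> (f (s y)))" for f
  have Phi: "\<pi> (f x) = \<Phi> f (\<pi> x)" if f: "f \<in> hom H H" and x: "x \<in> carrier H" for f x
  proof -
    interpret f: group_hom H H f by unfold_locales (rule f)
    define z where "z = x \<otimes>\<^bsub>H\<^esub> inv\<^bsub>H\<^esub> (s (\<pi> x))"
    have sx: "s (\<pi> x) \<in> carrier H" "\<pi> (s (\<pi> x)) = \<pi> x" using s x by auto
    have "z \<in> carrier H" "\<pi> z = \<one>\<^bsub>G\<^esub>" unfolding z_def using x sx by auto
    then have "\<pi> (f z) = \<one>\<^bsub>G\<^esub>" using ker f by blast
    moreover have "x = z \<otimes>\<^bsub>H\<^esub> s (\<pi> x)" unfolding z_def using x sx by (simp add: H.group_normalize)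
    ultimately have "\<pi> (f x) = \<pi> (f (s (\<pi> x)))"
      by (metis G.l_one \<open>z \<in> carrier H\<close> f.hom_closed f.hom_mult pi.hom_closed pi.hom_mult sx(1))
    then show ?thesis unfolding \<Phi>_def using x by simp
  qed
  have Phi_End: "\<Phi> f \<in> carrier (End G)" if f: "f \<in> hom H H" for f
  proof -
    interpret f: group_hom H H f by unfold_locales (rule f)
    have "\<Phi> f \<in> hom G G"
    proof (rule homI)
      fix y assume "y \<in> carrier G" then show "\<Phi> f y \<in> carrier G" unfolding \<Phi>_def using s by simp
    next
      fix y y' assume y: "y \<in> carrier G" "y' \<in> carrier G"
      have "\<Phi> f (y \<otimes>\<^bsub>G\<^esub> y') = \<Phi> f (\<pi> (s y \<otimes>\<^bsub>H\<^esub> s y'))" using s y by simp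
      also have "\<dots> = \<pi> (f (s y \<otimes>\<^bsub>H\<^esub> s y'))" using Phi[OF f] s y by (metis H.m_closed)
      also have "\<dots> = \<pi> (f (s y)) \<otimes>\<^bsub>G\<^esub> \<pi> (f (s y'))" using s y by simp
      also have "\<dots> = \<Phi> f y \<otimes>\<^bsub>G\<^esub> \<Phi> f y'" unfolding \<Phi>_def using y by simp
      finally show "\<Phi> f (y \<otimes>\<^bsub>G\<^esub> y') = \<Phi> f y \<otimes>\<^bsub>G\<^esub> \<Phi> f y'" .
    qed
    moreover have "\<Phi> f \<in> extensional (carrier G)" unfolding \<Phi>_def by simp
    ultimately show ?thesis unfolding End_def by simp
  qed
  have ext_eq: "g = g'" if "g \<in> extensional (carrier G)" "g' \<in> extensional (carrier G)"
    "\<And>x. x \<in> carrier H \<Longrightarrow> g (\<pi> x) = g' (\<pi> x)" for g g'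
    by (rule extensionalityI[OF that(1,2)]) (metis s that(3))
  have "\<Phi> \<in> iso (End H) (End G)"
    unfolding iso_def
  proof (intro CollectI conjI)
    show "\<Phi> \<in> hom (End H) (End G)"
    proof (rule homI)
      fix f assume "f \<in> carrier (End H)" then show "\<Phi> f \<in> carrier (End G)" using Phi_End by (simp add: End_def)
    next
      fix f g assume "f \<in> carrier (End H)" "g \<in> carrier (End H)"
      then have fg: "f \<in> hom H H" "g \<in> hom H H" by (auto simp: End_def)
      have c: "compose (carrier H) g f \<in> hom H H"
        using fg by (auto simp: hom_def compose_def Pi_iff)
      show "\<Phi> (f \<otimes>\<^bsub>End H\<^esub> g) = \<Phi> f \<otimes>\<^bsub>End G\<^esub> \<Phi> g"
        unfolding End_def monoid.simps
      proof (rule ext_eq)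
        fix x assume x: "x \<in> carrier H"
        have fx: "f x \<in> carrier H" using fg x by (auto simp: hom_def)
        have "\<Phi> (compose (carrier H) g f) (\<pi> x) = \<pi> (g (f x))"
          using Phi[OF c x] x by (simp add: compose_def)
        also have "\<dots> = compose (carrier G) (\<Phi> g) (\<Phi> f) (\<pi> x)"
          using Phi[OF fg(2) fx] Phi[OF fg(1) x] x by (simp add: compose_def)
        finally show "\<Phi> (compose (carrier H) g f) (\<pi> x) = compose (carrier G) (\<Phi> g) (\<Phi> f) (\<pi> x)" .
      qed (auto simp: \<Phi>_def)
    qed
    show "bij_betw \<Phi> (carrier (End H)) (carrier (End G))"
      unfolding bij_betw_def
    proof
      show "inj_on \<Phi> (carrier (End H))"
      proof (rule inj_onI)
        fix f f' assume *: "f \<in> carrier (End H)" "f' \<in> carrier (End H)" "\<Phi> f = \<Phi> f'"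
        then have f: "f \<in> hom H H" "f' \<in> hom H H" "f \<in> extensional (carrier H)" "f' \<in> extensional (carrier H)"
          by (auto simp: End_def)
        show "f = f'"
          by (rule extensionalityI[OF f(3,4)]) (rule uniq[OF f(1,2)], use Phi f(1,2) *(3) in auto)
      qed
      show "\<Phi> ` carrier (End H) = carrier (End G)"
      proof (intro equalityI subsetI)
        fix g assume "g \<in> carrier (End G)"
        then have g: "g \<in> hom G G" "g \<in> extensional (carrier G)" by (auto simp: End_def)
        obtain f where f: "f \<in> hom H H" "\<forall>x\<in>carrier H. \<pi> (f x) = g (\<pi> x)" using up g by blast
        define f' where "f' = restrict f (carrier H)"
        have f': "f' \<in> hom H H" unfolding f'_def using f(1) by (auto simp: hom_def)
        have "\<Phi> f' = g"
        proof (rule ext_eq[OF _ g(2)])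
          fix x assume x: "x \<in> carrier H"
          then show "\<Phi> f' (\<pi> x) = g (\<pi> x)" using Phi[OF f' x] f(2) unfolding f'_def by simp
        qed (auto simp: \<Phi>_def)
        moreover have "f' \<in> carrier (End H)" using f' unfolding f'_def End_def by simp
        ultimately show "g \<in> \<Phi> ` carrier (End H)" by blast
      qed (use Phi_End in \<open>auto simp: End_def\<close>)
    qed
  qed
  then show ?thesis unfolding is_iso_def by blast
qed

lemma End_iso_of_iso:
  fixes H :: "('c, 'd) monoid_scheme" and G :: "('a, 'm) monoid_scheme"
  assumes H: "group H" and G: "group G" and "H \<cong> G"
  shows "End H \<cong> End G"
proof -
  interpret H: group H by (rule H)
  interpret G: group G by (rule G)
  obtain \<pi> where pi: "\<pi> \<in> iso H G" using assms(3) unfolding is_iso_def by blast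
  then have h: "\<pi> \<in> hom H G" and bij: "bij_betw \<pi> (carrier H) (carrier G)" by (auto simp: iso_def)
  interpret pi: group_hom H G \<pi> by unfold_locales (rule h)
  let ?r = "inv_into (carrier H) \<pi>"
  have r: "?r \<in> iso G H" by (rule H.iso_set_sym[OF pi])
  then have rh: "?r \<in> hom G H" by (simp add: iso_def)
  show ?thesis
  proof (rule End_iso_of_unique_lifting[OF H G h])
    show "\<pi> ` carrier H = carrier G" using bij by (simp add: bij_betw_def)
  next
    fix f x assume "f \<in> hom H H" "x \<in> carrier H" "\<pi> x = \<one>\<^bsub>G\<^esub>"
    then show "\<pi> (f x) = \<one>\<^bsub>G\<^esub>" using bij H.one_closed hom_one[OF _ H H]
      by (metis bij_betw_def inj_onD pi.hom_one)
  next
    fix g assume g: "g \<in> hom G G"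
    have "(\<lambda>x. ?r (g (\<pi> x))) \<in> hom H H" using g rh h by (auto simp: hom_def Pi_iff)
    moreover have "\<pi> (?r (g (\<pi> x))) = g (\<pi> x)" if "x \<in> carrier H" for x
    proof (rule bij_betw_inv_into_right[OF bij])
      show "g (\<pi> x) \<in> carrier G" using that g by (auto simp: hom_def)
    qed
    ultimately show "\<exists>f\<in>hom H H. \<forall>x\<in>carrier H. \<pi> (f x) = g (\<pi> x)"
      by (intro bexI[of _ "\<lambda>x. ?r (g (\<pi> x))"]) auto
  next
    fix f f' x assume f: "f \<in> hom H H" "f' \<in> hom H H" and eq: "\<And>x. x \<in> carrier H \<Longrightarrow> \<pi> (f x) = \<pi> (f' x)"
      and x: "x \<in> carrier H"
    then have "f x \<in> carrier H" "f' x \<in> carrier H" by (auto simp: hom_def)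
    then show "f x = f' x" using bij eq[OF x] by (metis bij_betw_def inj_onD)
  qed
qed

lemma End_iso_sym:
  assumes "End H \<cong> End G" and "group H"
  shows "End G \<cong> End H"
proof -
  interpret H: group H by fact
  obtain h where h: "h \<in> hom (End H) (End G)" "bij_betw h (carrier (End H)) (carrier (End G))"
    using assms(1) unfolding is_iso_def iso_def by blast
  let ?r = "inv_into (carrier (End H)) h"
  have mc: "f \<otimes>\<^bsub>End H\<^esub> g \<in> carrier (End H)" if "f \<in> carrier (End H)" "g \<in> carrier (End H)" for f g
    using that unfolding End_def by (auto simp: hom_def compose_def Pi_iff)
  have rc: "?r y \<in> carrier (End H)" "h (?r y) = y" if "y \<in> carrier (End G)" for y
    using that h(2) by (auto simp: bij_betw_def inv_into_into f_inv_into_f)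
  have "?r \<in> hom (End G) (End H)"
  proof (rule homI)
    fix x y assume xy: "x \<in> carrier (End G)" "y \<in> carrier (End G)"
    have "h (?r x \<otimes>\<^bsub>End H\<^esub> ?r y) = x \<otimes>\<^bsub>End G\<^esub> y" using hom_mult[OF h(1) rc(1)[OF xy(1)] rc(1)[OF xy(2)]] rc(2) xy by simp
    then show "?r (x \<otimes>\<^bsub>End G\<^esub> y) = ?r x \<otimes>\<^bsub>End H\<^esub> ?r y"
      using mc rc(1) xy h(2) by (metis bij_betw_def inv_into_f_f)
  qed (use rc in blast)
  then show ?thesis using bij_betw_inv_into[OF h(2)] unfolding is_iso_def iso_def by blast
qed

section \<open>The covering group for even order\<close>

text \<open>
  The condition \<open>zeta_unit\<close> puts \<open>\<zeta>\<close> into the unitary group of the hermitian form \<open>x \<otimes> \<eta> y\<close>, so that the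
  action of \<open>b\<close> preserves the form.
\<close>

locale field_semidirect_involution = field_semidirect F \<zeta> p q n G b v + inv: field_involution F \<eta>
  for F :: "('a, 'f) ring_scheme" (structure) and \<zeta> p q n and G :: "('a, 'm) monoid_scheme" and b v \<eta> +
  assumes zeta_unit: "\<zeta> \<otimes> \<eta> \<zeta> = \<one>"
begin

lemma eta [simp]: "x \<in> carrier F \<Longrightarrow> \<eta> x \<in> carrier F" "x \<in> carrier F \<Longrightarrow> \<eta> (\<eta> x) = x"
  using inv.invol by auto

lemma chi_unit: "g \<in> carrier G \<Longrightarrow> \<chi> g \<otimes> \<eta> (\<chi> g) = \<one>"
proof -
  assume g: "g \<in> carrier G"
  have "\<zeta> [^] i \<otimes> \<eta> (\<zeta> [^] i) = \<one>" for i :: nat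
  proof (induction i)
    case (Suc i)
    have "\<zeta> [^] Suc i \<otimes> \<eta> (\<zeta> [^] Suc i) = (\<zeta> [^] i \<otimes> \<eta> (\<zeta> [^] i)) \<otimes> (\<zeta> \<otimes> \<eta> \<zeta>)"
      using zeta by (simp add: m_ac)
    then show ?case using Suc zeta_unit by simp
  qed simp
  then show ?thesis using decE[OF g] chi_dec by metis
qed

text \<open>
  Over \<open>F\<close> this is the group of pairs \<open>(x, a)\<close> with trace of \<open>a\<close> equal to the norm of \<open>x\<close>, as in the Sylow
  \<open>p\<close>-subgroups of three-dimensional unitary groups. The condition on the trace, instead of a plain
  product with some additive group, makes the construction work for \<open>p = 2\<close> as well.
\<close>

definition H :: "('a \<times> 'a) monoid" where
  "H = \<lparr>carrier = {(g, a). g \<in> carrier G \<and> a \<in> carrier F \<and> a \<oplus> \<eta> a = pr g \<otimes> \<eta> (pr g)},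
    monoid.mult = (\<lambda>(g, a) (h, c). (g \<cdot>\<^sub>G h, a \<oplus> c \<oplus> pr g \<otimes> \<eta> (\<chi> g \<otimes> pr h))),
    one = (\<one>\<^bsub>G\<^esub>, \<zero>)\<rparr>"

lemma H_carrier: "(g, a) \<in> carrier H \<longleftrightarrow> g \<in> carrier G \<and> a \<in> carrier F \<and> a \<oplus> \<eta> a = pr g \<otimes> \<eta> (pr g)"
  and H_mult: "(g, a) \<otimes>\<^bsub>H\<^esub> (h, c) = (g \<cdot>\<^sub>G h, a \<oplus> c \<oplus> pr g \<otimes> \<eta> (\<chi> g \<otimes> pr h))"
  and H_one: "\<one>\<^bsub>H\<^esub> = (\<one>\<^bsub>G\<^esub>, \<zero>)"
  unfolding H_def by auto

lemma H_closed: "h \<in> carrier H \<Longrightarrow> k \<in> carrier H \<Longrightarrow> h \<otimes>\<^bsub>H\<^esub> k \<in> carrier H"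
proof -
  assume hk: "h \<in> carrier H" "k \<in> carrier H"
  obtain g a where h: "h = (g, a)" "g \<in> carrier G" "a \<in> carrier F" "a \<oplus> \<eta> a = pr g \<otimes> \<eta> (pr g)"
    using hk H_carrier by (cases h) auto
  obtain g' c where k: "k = (g', c)" "g' \<in> carrier G" "c \<in> carrier F" "c \<oplus> \<eta> c = pr g' \<otimes> \<eta> (pr g')"
    using hk H_carrier by (cases k) auto
  define x y u where "x = pr g" and "y = pr g'" and "u = \<chi> g"
  have F: "x \<in> carrier F" "y \<in> carrier F" "u \<in> carrier F" unfolding x_def y_def u_def using h k by auto
  note F' = F F[THEN eta(1)] h(3) k(3) h(3)[THEN eta(1)] k(3)[THEN eta(1)]
  have uu: "u \<otimes> \<eta> u = \<one>" unfolding u_def using chi_unit h by simp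
  have "(a \<oplus> c \<oplus> x \<otimes> \<eta> (u \<otimes> y)) \<oplus> \<eta> (a \<oplus> c \<oplus> x \<otimes> \<eta> (u \<otimes> y)) =
    (a \<oplus> c \<oplus> x \<otimes> (\<eta> u \<otimes> \<eta> y)) \<oplus> (\<eta> a \<oplus> \<eta> c \<oplus> \<eta> x \<otimes> (u \<otimes> y))" using F' by simp
  also have "\<dots> = (a \<oplus> \<eta> a) \<oplus> (c \<oplus> \<eta> c) \<oplus> (x \<otimes> (\<eta> u \<otimes> \<eta> y) \<oplus> \<eta> x \<otimes> (u \<otimes> y))"
    using F' by algebra
  also have "\<dots> = x \<otimes> \<eta> x \<oplus> (u \<otimes> \<eta> u) \<otimes> (y \<otimes> \<eta> y) \<oplus> (x \<otimes> (\<eta> u \<otimes> \<eta> y) \<oplus> \<eta> x \<otimes> (u \<otimes> y))"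
    using h(4) k(4) F' uu unfolding x_def y_def by simp
  also have "\<dots> = (x \<oplus> u \<otimes> y) \<otimes> (\<eta> x \<oplus> \<eta> u \<otimes> \<eta> y)" using F' by algebra
  also have "\<dots> = (x \<oplus> u \<otimes> y) \<otimes> \<eta> (x \<oplus> u \<otimes> y)" using F' by simp
  finally show ?thesis unfolding h(1) k(1) H_mult H_carrier using h k F' pr_mult[OF h(2) k(2)]
    by (simp add: x_def y_def u_def)
qed

lemma group_H: "group H"
proof (rule groupI)
  fix h k l assume hkl: "h \<in> carrier H" "k \<in> carrier H" "l \<in> carrier H"
  obtain g a where h: "h = (g, a)" "g \<in> carrier G" "a \<in> carrier F" using hkl H_carrier by (cases h) auto
  obtain g' a' where k: "k = (g', a')" "g' \<in> carrier G" "a' \<in> carrier F" using hkl H_carrier by (cases k) auto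
  obtain g'' a'' where l: "l = (g'', a'')" "g'' \<in> carrier G" "a'' \<in> carrier F" using hkl H_carrier by (cases l) auto
  define x y z u w where "x = pr g" and "y = pr g'" and "z = pr g''" and "u = \<chi> g" and "w = \<chi> g'"
  have F: "x \<in> carrier F" "y \<in> carrier F" "z \<in> carrier F" "u \<in> carrier F" "w \<in> carrier F"
    unfolding x_def y_def z_def u_def w_def using h k l by auto
  note F' = F F[THEN eta(1)] h(3) k(3) l(3)
  have uu: "u \<otimes> \<eta> u = \<one>" unfolding u_def using chi_unit h by simp
  have "a \<oplus> a' \<oplus> x \<otimes> \<eta> (u \<otimes> y) \<oplus> a'' \<oplus> (x \<oplus> u \<otimes> y) \<otimes> \<eta> (u \<otimes> w \<otimes> z)
    = a \<oplus> (a' \<oplus> a'' \<oplus> (u \<otimes> \<eta> u) \<otimes> (y \<otimes> (\<eta> w \<otimes> \<eta> z))) \<oplus> x \<otimes> (\<eta> u \<otimes> (\<eta> y \<oplus> \<eta> w \<otimes> \<eta> z))"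
  proof -
    have "\<eta> (u \<otimes> w \<otimes> z) = \<eta> u \<otimes> \<eta> w \<otimes> \<eta> z" "\<eta> (u \<otimes> y) = \<eta> u \<otimes> \<eta> y" using F' by simp_all
    then show ?thesis using F' by (simp only:) algebra
  qed
  also have "\<dots> = a \<oplus> (a' \<oplus> a'' \<oplus> y \<otimes> \<eta> (w \<otimes> z)) \<oplus> x \<otimes> \<eta> (u \<otimes> (y \<oplus> w \<otimes> z))"
    using F' uu by simp
  finally show "h \<otimes>\<^bsub>H\<^esub> k \<otimes>\<^bsub>H\<^esub> l = h \<otimes>\<^bsub>H\<^esub> (k \<otimes>\<^bsub>H\<^esub> l)"
    unfolding h(1) k(1) l(1) H_mult using h k l
    by (simp add: x_def y_def z_def u_def w_def pr_mult chi_mult G.m_assoc)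
next
  fix h assume "h \<in> carrier H"
  then obtain g a where h: "h = (g, a)" "g \<in> carrier G" "a \<in> carrier F" "a \<oplus> \<eta> a = pr g \<otimes> \<eta> (pr g)"
    using H_carrier by (cases h) auto
  have p1: "pr \<one>\<^bsub>G\<^esub> = \<zero>" using pr_F[OF zero_closed] zero_eq by simp
  show "\<one>\<^bsub>H\<^esub> \<otimes>\<^bsub>H\<^esub> h = h" unfolding h(1) H_one H_mult using h p1 by simp
  define g' where "g' = gi g"
  have g': "g' \<in> carrier G" "g' \<cdot>\<^sub>G g = \<one>\<^bsub>G\<^esub>" unfolding g'_def using h by auto
  define x y u where "x = pr g" and "y = pr g'" and "u = \<chi> g'"
  have F: "x \<in> carrier F" "y \<in> carrier F" "u \<in> carrier F" unfolding x_def y_def u_def using h g' by auto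
  have "y \<oplus> u \<otimes> x = \<zero>" using pr_mult[OF g'(1) h(2)] g' p1 unfolding x_def y_def u_def by simp
  then have y: "y = \<ominus> (u \<otimes> x)" using F by (simp add: minus_equality)
  have uu: "u \<otimes> \<eta> u = \<one>" unfolding u_def using chi_unit g' by simp
  note F' = F F[THEN eta(1)] h(3) h(3)[THEN eta(1)]
  have yy: "y \<otimes> \<eta> (u \<otimes> x) = \<ominus> (x \<otimes> \<eta> x)"
  proof -
    have "y \<otimes> \<eta> (u \<otimes> x) = \<ominus> ((u \<otimes> \<eta> u) \<otimes> (x \<otimes> \<eta> x))"
    proof -
      have "\<eta> (u \<otimes> x) = \<eta> u \<otimes> \<eta> x" using F' by simp
      then show ?thesis unfolding y using F' by (simp only:) algebra
    qed
    then show ?thesis using uu F' by simp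
  qed
  have nn: "y \<otimes> \<eta> y = x \<otimes> \<eta> x"
  proof -
    have "y \<otimes> \<eta> y = \<ominus> (y \<otimes> \<eta> (u \<otimes> x))" unfolding y using F' by (simp add: r_minus)
    then show ?thesis unfolding yy using F' by simp
  qed
  have "(g', \<eta> a) \<in> carrier H" unfolding H_carrier using g' h nn F'
    by (simp add: x_def y_def a_comm)
  moreover have "(g', \<eta> a) \<otimes>\<^bsub>H\<^esub> h = \<one>\<^bsub>H\<^esub>"
  proof -
    have "\<eta> a \<oplus> a \<oplus> y \<otimes> \<eta> (u \<otimes> x) = (a \<oplus> \<eta> a) \<oplus> \<ominus> (x \<otimes> \<eta> x)" unfolding yy using F' by (simp add: a_comm)
    also have "\<dots> = \<zero>" unfolding h(4) using F' by (simp add: x_def[symmetric] r_neg)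
    finally show ?thesis unfolding h(1) H_one H_mult using g' by (simp add: x_def y_def u_def)
  qed
  ultimately show "\<exists>k\<in>carrier H. k \<otimes>\<^bsub>H\<^esub> h = \<one>\<^bsub>H\<^esub>" by blast
next
  have "pr \<one>\<^bsub>G\<^esub> = \<zero>" using pr_F[OF zero_closed] zero_eq by simp
  then show "\<one>\<^bsub>H\<^esub> \<in> carrier H" unfolding H_one H_carrier by simp
qed (rule H_closed)

sublocale H: group H by (rule group_H)

lemma fst_hom: "fst \<in> hom H G"
  by (rule homI) (auto simp: H_def)

lemma lift_exists: "g \<in> carrier G \<Longrightarrow> \<exists>a. (g, a) \<in> carrier H"
proof -
  assume g: "g \<in> carrier G"
  have "pr g \<otimes> \<eta> (pr g) \<in> inv.fixed" unfolding inv.fixed_def using g by (simp add: m_comm)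
  then show ?thesis using inv.trace_surj[of "pr g \<otimes> \<eta> (pr g)"] H_carrier g by blast
qed

lemma fst_surj: "fst ` carrier H = carrier G"
proof (intro equalityI subsetI)
  fix g assume "g \<in> carrier G"
  then obtain a where "(g, a) \<in> carrier H" using lift_exists by blast
  then show "g \<in> fst ` carrier H" by (rule image_eqI[rotated]) simp
qed (auto simp: H_carrier)

lemma zero_pr [simp]: "pr \<one>\<^bsub>G\<^esub> = \<zero>" and chi_one_G [simp]: "\<chi> \<one>\<^bsub>G\<^esub> = \<one>"
  using pr_F[OF zero_closed] chi_F[OF zero_closed] zero_eq by auto

lemma ker_central:
  assumes "(\<one>\<^bsub>G\<^esub>, a) \<in> carrier H" "h \<in> carrier H"
  shows "(\<one>\<^bsub>G\<^esub>, a) \<otimes>\<^bsub>H\<^esub> h = h \<otimes>\<^bsub>H\<^esub> (\<one>\<^bsub>G\<^esub>, a)"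
  using assms by (cases h) (auto simp: H_carrier H_mult a_comm)

lemma ker_mult_power:
  assumes "(\<one>\<^bsub>G\<^esub>, a) \<in> carrier H"
  shows "(\<one>\<^bsub>G\<^esub>, a) [^]\<^bsub>H\<^esub> (k::nat) = (\<one>\<^bsub>G\<^esub>, add_pow F k a)"
  by (induction k) (use assms in \<open>auto simp: H_carrier H_mult H_one\<close>)

lemma ker_p: "(\<one>\<^bsub>G\<^esub>, a) \<in> carrier H \<Longrightarrow> (\<one>\<^bsub>G\<^esub>, a) [^]\<^bsub>H\<^esub> p = \<one>\<^bsub>H\<^esub>"
  using ker_mult_power char_p H_one H_carrier by simp

lemma same_fst:
  assumes "h \<in> carrier H" "k \<in> carrier H" "fst h = fst k"
  shows "\<exists>a. (\<one>\<^bsub>G\<^esub>, a) \<in> carrier H \<and> h = (\<one>\<^bsub>G\<^esub>, a) \<otimes>\<^bsub>H\<^esub> k"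
proof -
  interpret f: group_hom H G fst by unfold_locales (rule fst_hom)
  define z where "z = h \<otimes>\<^bsub>H\<^esub> inv\<^bsub>H\<^esub> k"
  have "z \<in> carrier H" "fst z = \<one>\<^bsub>G\<^esub>" unfolding z_def using assms f.hom_mult[of h "inv\<^bsub>H\<^esub> k"] f.hom_closed by simp_all
  moreover have "h = z \<otimes>\<^bsub>H\<^esub> k" unfolding z_def using assms by (simp add: H.group_normalize)
  ultimately show ?thesis by (cases z) auto
qed

lemma commutator_F:
  assumes "x \<in> carrier F" "y \<in> carrier F" "(x, a) \<in> carrier H" "(y, c) \<in> carrier H"
  shows "(x, a) \<otimes>\<^bsub>H\<^esub> (y, c) = (\<one>\<^bsub>G\<^esub>, x \<otimes> \<eta> y \<ominus> y \<otimes> \<eta> x) \<otimes>\<^bsub>H\<^esub> ((y, c) \<otimes>\<^bsub>H\<^esub> (x, a))"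
proof -
  have F: "a \<in> carrier F" "c \<in> carrier F" using assms H_carrier by auto
  note F' = F assms(1,2) assms(1,2)[THEN eta(1)]
  have 1: "a \<oplus> c \<oplus> x \<otimes> \<eta> y = (x \<otimes> \<eta> y \<ominus> y \<otimes> \<eta> x) \<oplus> (c \<oplus> a \<oplus> y \<otimes> \<eta> x)" using F' by algebra
  have 2: "x \<cdot>\<^sub>G y = y \<cdot>\<^sub>G x" using F_comm assms by blast
  show ?thesis unfolding H_mult using assms(1,2) F_closed[OF assms(2,1)] 1 2 F' by (simp add: chi_F)
qed

text \<open>
  An element of trace zero is \<open>z \<ominus> \<eta> z\<close> for some \<open>z\<close>, which is the commutator of elements over \<open>z\<close>
  and \<open>\<one>\<close>.
\<close>

lemma ker_commutator:
  assumes "(\<one>\<^bsub>G\<^esub>, a) \<in> carrier H"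
  shows "\<exists>u\<in>carrier H. \<exists>w\<in>carrier H. fst u \<in> carrier F \<and> fst w \<in> carrier F \<and>
    u \<otimes>\<^bsub>H\<^esub> w = (\<one>\<^bsub>G\<^esub>, a) \<otimes>\<^bsub>H\<^esub> (w \<otimes>\<^bsub>H\<^esub> u)"
proof -
  have a: "a \<in> carrier F" "a \<oplus> \<eta> a = \<zero>" using assms by (auto simp: H_carrier)
  then have "\<eta> a = \<ominus> a" using sum_zero_eq_neg[of "\<eta> a" a] by (simp add: a_comm)
  then obtain z where z: "z \<in> carrier F" "a = z \<ominus> \<eta> z" using inv.anti_fixed_is_difference a by blast
  obtain c c' where c: "(z, c) \<in> carrier H" "(\<one>, c') \<in> carrier H" using lift_exists[of z] lift_exists[of \<one>] z by auto
  have "(z, c) \<otimes>\<^bsub>H\<^esub> (\<one>, c') = (\<one>\<^bsub>G\<^esub>, a) \<otimes>\<^bsub>H\<^esub> ((\<one>, c') \<otimes>\<^bsub>H\<^esub> (z, c))"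
    using commutator_F[OF z(1) one_closed c] z by simp
  then show ?thesis using c z(1) by (intro bexI[of _ "(z, c)"] bexI[of _ "(\<one>, c')"]) auto
qed

text \<open>
  An element over \<open>F\<close> has order dividing \<open>p\<^sup>2\<close>: its \<open>p\<close>-th power is in the kernel, which has
  exponent \<open>p\<close>.
\<close>

lemma hom_preserves_F:
  assumes f: "f \<in> hom H H" and u: "u \<in> carrier H" "fst u \<in> carrier F"
  shows "fst (f u) \<in> carrier F"
proof -
  interpret f: group_hom H H f by unfold_locales (rule f)
  interpret s: group_hom H G fst by unfold_locales (rule fst_hom)
  have "fst (u [^]\<^bsub>H\<^esub> p) = \<one>\<^bsub>G\<^esub>" using s.hom_nat_pow[OF u(1), of p] F_p u by simp
  moreover have "u [^]\<^bsub>H\<^esub> p \<in> carrier H" using u by simp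
  ultimately obtain a where a: "u [^]\<^bsub>H\<^esub> p = (\<one>\<^bsub>G\<^esub>, a)" "(\<one>\<^bsub>G\<^esub>, a) \<in> carrier H" by (metis prod.collapse)
  have "u [^]\<^bsub>H\<^esub> (p ^ 2) = (u [^]\<^bsub>H\<^esub> p) [^]\<^bsub>H\<^esub> p" using u by (simp add: H.nat_pow_pow power2_eq_square)
  then have "u [^]\<^bsub>H\<^esub> (p ^ 2) = \<one>\<^bsub>H\<^esub>" using a ker_p by simp
  then have "f u [^]\<^bsub>H\<^esub> (p ^ 2) = \<one>\<^bsub>H\<^esub>" using f.hom_nat_pow[OF u(1), of "p ^ 2"] by simp
  then have "fst (f u) [^]\<^bsub>G\<^esub> (p ^ 2) = \<one>\<^bsub>G\<^esub>" using s.hom_nat_pow[of "f u" "p ^ 2"] u by simp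
  then show ?thesis using pow_p_in_F[of "fst (f u)" 2] s.hom_closed[of "f u"] u by simp
qed

text \<open>
  The kernel consists of commutators of elements over \<open>F\<close>; their images are again over \<open>F\<close>, and \<open>F\<close> is
  commutative.
\<close>

lemma hom_preserves_ker:
  assumes f: "f \<in> hom H H" and z: "z \<in> carrier H" "fst z = \<one>\<^bsub>G\<^esub>"
  shows "fst (f z) = \<one>\<^bsub>G\<^esub>"
proof -
  interpret f: group_hom H H f by unfold_locales (rule f)
  interpret s: group_hom H G fst by unfold_locales (rule fst_hom)
  obtain u w where u: "u \<in> carrier H" "w \<in> carrier H" "fst u \<in> carrier F" "fst w \<in> carrier F"
    "u \<otimes>\<^bsub>H\<^esub> w = z \<otimes>\<^bsub>H\<^esub> (w \<otimes>\<^bsub>H\<^esub> u)" using ker_commutator[of "snd z"] z by (metis prod.collapse)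
  have F: "fst (f u) \<in> carrier F" "fst (f w) \<in> carrier F" using hom_preserves_F[OF f] u by auto
  have "fst (f (u \<otimes>\<^bsub>H\<^esub> w)) = fst (f (z \<otimes>\<^bsub>H\<^esub> (w \<otimes>\<^bsub>H\<^esub> u)))" using u by simp
  then have "fst (f u) \<cdot>\<^sub>G fst (f w) = fst (f z) \<cdot>\<^sub>G (fst (f w) \<cdot>\<^sub>G fst (f u))" using u(1,2) z by (simp del: fst_conv)
  then have "fst (f u) \<cdot>\<^sub>G fst (f w) = fst (f z) \<cdot>\<^sub>G (fst (f u) \<cdot>\<^sub>G fst (f w))" using F_comm F by metis
  then show ?thesis using F s.hom_closed[of "f z"] z by (metis F_G G.m_closed G.r_cancel_one' f.hom_closed)
qed

lemma H_generated:
  assumes "h \<in> carrier H"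
  obtains a x c i where "(\<one>\<^bsub>G\<^esub>, a) \<in> carrier H" "(x, c) \<in> carrier H" "x \<in> carrier F"
    "h = (\<one>\<^bsub>G\<^esub>, a) \<otimes>\<^bsub>H\<^esub> ((x, c) \<otimes>\<^bsub>H\<^esub> (b, \<zero>) [^]\<^bsub>H\<^esub> (i::nat))"
proof -
  have bH: "(b, \<zero>) \<in> carrier H" using b by (simp add: H_carrier)
  interpret s: group_hom H G fst by unfold_locales (rule fst_hom)
  have "fst h \<in> carrier G" using s.hom_closed assms by blast
  then obtain x i where x: "x \<in> carrier F" "fst h = x \<cdot>\<^sub>G b [^]\<^bsub>G\<^esub> (i::nat)" using decE by blast
  obtain c where c: "(x, c) \<in> carrier H" using lift_exists x by blast
  have "fst ((x, c) \<otimes>\<^bsub>H\<^esub> (b, \<zero>) [^]\<^bsub>H\<^esub> i) = fst h"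
    using s.hom_mult[OF c, of "(b, \<zero>) [^]\<^bsub>H\<^esub> i"] s.hom_nat_pow[OF bH, of i] x bH by simp
  then show thesis using same_fst[OF assms, of "(x, c) \<otimes>\<^bsub>H\<^esub> (b, \<zero>) [^]\<^bsub>H\<^esub> i"] that x c bH by auto
qed

lemma b_lift_order: "(b, \<zero>) [^]\<^bsub>H\<^esub> (q ^ v) = \<one>\<^bsub>H\<^esub>"
proof -
  have "(b, \<zero>) [^]\<^bsub>H\<^esub> i = (b [^]\<^bsub>G\<^esub> i, \<zero>)" for i :: nat
    by (induction i) (auto simp: H_one H_mult b zeta chi_b)
  then show ?thesis using bpow_order H_one by simp
qed

text \<open>
  Two lifts differ by a homomorphism \<open>c\<close> into the central kernel. It is trivial on commutators, hence on
  the kernel and on everything over \<open>F\<close>. It is trivial at \<open>(b, \<zero>)\<close> because the orders \<open>q\<^sup>v\<close> and \<open>p\<close> are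
  coprime.
\<close>

lemma lift_unique:
  assumes f: "f \<in> hom H H" and f': "f' \<in> hom H H"
    and eq: "\<And>x. x \<in> carrier H \<Longrightarrow> fst (f x) = fst (f' x)" and h: "h \<in> carrier H"
  shows "f h = f' h"
proof -
  interpret f: group_hom H H f by unfold_locales (rule f)
  interpret f': group_hom H H f' by unfold_locales (rule f')
  define c where "c h = f h \<otimes>\<^bsub>H\<^esub> inv\<^bsub>H\<^esub> (f' h)" for h
  have ker: "\<exists>a. c h = (\<one>\<^bsub>G\<^esub>, a) \<and> (\<one>\<^bsub>G\<^esub>, a) \<in> carrier H" if h: "h \<in> carrier H" for h
  proof -
    obtain a where a: "(\<one>\<^bsub>G\<^esub>, a) \<in> carrier H" "f h = (\<one>\<^bsub>G\<^esub>, a) \<otimes>\<^bsub>H\<^esub> f' h"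
      using same_fst[of "f h" "f' h"] eq h by auto
    then have "c h = (\<one>\<^bsub>G\<^esub>, a)" unfolding c_def using h by (simp add: H.group_normalize)
    then show ?thesis using a by blast
  qed
  have cc: "c h \<in> carrier H" if "h \<in> carrier H" for h using ker[OF that] by auto
  have cen: "c h \<otimes>\<^bsub>H\<^esub> k = k \<otimes>\<^bsub>H\<^esub> c h" if "h \<in> carrier H" "k \<in> carrier H" for h k
    using ker[OF that(1)] ker_central that(2) by metis
  have c_hom: "c \<in> hom H H"
  proof (rule homI)
    fix h k assume hk: "h \<in> carrier H" "k \<in> carrier H"
    have "c (h \<otimes>\<^bsub>H\<^esub> k) = f h \<otimes>\<^bsub>H\<^esub> (c k \<otimes>\<^bsub>H\<^esub> inv\<^bsub>H\<^esub> (f' h))"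
      unfolding c_def using hk by (simp add: H.group_normalize)
    also have "\<dots> = c h \<otimes>\<^bsub>H\<^esub> c k" using cen[OF hk(2), of "inv\<^bsub>H\<^esub> (f' h)"] hk cc
      unfolding c_def[of h] by (simp add: H.m_assoc)
    finally show "c (h \<otimes>\<^bsub>H\<^esub> k) = c h \<otimes>\<^bsub>H\<^esub> c k" .
  qed (rule cc)
  interpret c: group_hom H H c by unfold_locales (rule c_hom)
  have cker: "c (\<one>\<^bsub>G\<^esub>, a) = \<one>\<^bsub>H\<^esub>" if a: "(\<one>\<^bsub>G\<^esub>, a) \<in> carrier H" for a
  proof -
    obtain u w where u: "u \<in> carrier H" "w \<in> carrier H" "u \<otimes>\<^bsub>H\<^esub> w = (\<one>\<^bsub>G\<^esub>, a) \<otimes>\<^bsub>H\<^esub> (w \<otimes>\<^bsub>H\<^esub> u)"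
      using ker_commutator[OF a] by blast
    have "c u \<otimes>\<^bsub>H\<^esub> c w = c (\<one>\<^bsub>G\<^esub>, a) \<otimes>\<^bsub>H\<^esub> (c w \<otimes>\<^bsub>H\<^esub> c u)"
      using arg_cong[OF u(3), of c] u(1,2) a by simp
    then have "c (\<one>\<^bsub>G\<^esub>, a) \<otimes>\<^bsub>H\<^esub> (c w \<otimes>\<^bsub>H\<^esub> c u) = c w \<otimes>\<^bsub>H\<^esub> c u" using cen[OF u(1) cc[OF u(2)]] by simp
    then show ?thesis using u cc a by simp
  qed
  have bH: "(b, \<zero>) \<in> carrier H" using b by (simp add: H_carrier)
  have cF: "c (x, a) = \<one>\<^bsub>H\<^esub>" if xa: "(x, a) \<in> carrier H" "x \<in> carrier F" for x a
  proof -
    have z1: "\<zeta> \<ominus> \<one> \<in> carrier F" "\<zeta> \<ominus> \<one> \<noteq> \<zero>" using zeta by (simp, metis r_right_minus_eq one_closed)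
    \<comment> \<open>With this \<open>y\<close>, the element \<open>x\<close> is the commutator of \<open>b\<close> and \<open>y\<close>.\<close>
    define y where "y = m_inv F (\<zeta> \<ominus> \<one>) \<otimes> x"
    have y: "y \<in> carrier F" "(\<zeta> \<ominus> \<one>) \<otimes> y = x" unfolding y_def using unit_inv[OF z1] xa z1 by auto
    have "x \<oplus> y = (\<zeta> \<ominus> \<one>) \<otimes> y \<oplus> y" using y by simp
    also have "\<dots> = \<zeta> \<otimes> y" using y(1) zeta(1) by algebra
    finally have zy: "\<zeta> \<otimes> y = x \<cdot>\<^sub>G y" using add_eq xa y by simp
    have by': "b \<cdot>\<^sub>G y = x \<cdot>\<^sub>G y \<cdot>\<^sub>G b"
      unfolding zy[symmetric] conj_b[OF y(1), symmetric] using b y by (simp add: G.group_normalize)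
    obtain d where d: "(y, d) \<in> carrier H" using lift_exists y by blast
    have "fst ((b, \<zero>) \<otimes>\<^bsub>H\<^esub> (y, d)) = fst ((x, a) \<otimes>\<^bsub>H\<^esub> (y, d) \<otimes>\<^bsub>H\<^esub> (b, \<zero>))"
      unfolding H_mult using by' by simp
    then obtain k where k: "(\<one>\<^bsub>G\<^esub>, k) \<in> carrier H"
      "(b, \<zero>) \<otimes>\<^bsub>H\<^esub> (y, d) = (\<one>\<^bsub>G\<^esub>, k) \<otimes>\<^bsub>H\<^esub> ((x, a) \<otimes>\<^bsub>H\<^esub> (y, d) \<otimes>\<^bsub>H\<^esub> (b, \<zero>))"
      using same_fst[of "(b, \<zero>) \<otimes>\<^bsub>H\<^esub> (y, d)" "(x, a) \<otimes>\<^bsub>H\<^esub> (y, d) \<otimes>\<^bsub>H\<^esub> (b, \<zero>)"] bH d xa by auto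
    have "c (b, \<zero>) \<otimes>\<^bsub>H\<^esub> c (y, d) = c (x, a) \<otimes>\<^bsub>H\<^esub> (c (y, d) \<otimes>\<^bsub>H\<^esub> c (b, \<zero>))"
      using arg_cong[OF k(2), of c] bH d xa k(1) cker by (simp add: H.m_assoc)
    also have "c (y, d) \<otimes>\<^bsub>H\<^esub> c (b, \<zero>) = c (b, \<zero>) \<otimes>\<^bsub>H\<^esub> c (y, d)" using cen[OF d] cc[OF bH] by blast
    finally show ?thesis using cc bH d xa by (metis H.m_closed H.r_cancel_one' )
  qed
  have cb: "c (b, \<zero>) = \<one>\<^bsub>H\<^esub>"
  proof -
    have "c (b, \<zero>) [^]\<^bsub>H\<^esub> (q ^ v) = \<one>\<^bsub>H\<^esub>" using c.hom_nat_pow[OF bH, of "q ^ v"] b_lift_order by simp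
    moreover have "c (b, \<zero>) [^]\<^bsub>H\<^esub> p = \<one>\<^bsub>H\<^esub>" using ker[OF bH] ker_p by metis
    moreover have "coprime p (q ^ v)" using coprime_pq[of 1 v] by simp
    ultimately show ?thesis using coprime_pow_trivial[OF group_H cc[OF bH]] by blast
  qed
  obtain a x d i where g: "(\<one>\<^bsub>G\<^esub>, a) \<in> carrier H" "(x, d) \<in> carrier H" "x \<in> carrier F"
    "h = (\<one>\<^bsub>G\<^esub>, a) \<otimes>\<^bsub>H\<^esub> ((x, d) \<otimes>\<^bsub>H\<^esub> (b, \<zero>) [^]\<^bsub>H\<^esub> (i::nat))" using H_generated[OF h] by metis
  have "c h = \<one>\<^bsub>H\<^esub>" unfolding g(4) using g(1,2,3) bH cker cF cb c.hom_nat_pow[OF bH, of i] by simp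
  moreover have "f h = c h \<otimes>\<^bsub>H\<^esub> f' h" unfolding c_def using h by (simp add: H.group_normalize)
  ultimately show ?thesis using h by simp
qed

definition lifts :: "('a \<Rightarrow> 'a) \<Rightarrow> bool" where
  "lifts g \<longleftrightarrow> (\<exists>f\<in>hom H H. \<forall>x\<in>carrier H. fst (f x) = g (fst x))"

lemma lifts_comp:
  assumes "lifts g" "lifts g'" shows "lifts (\<lambda>x. g (g' x))"
proof -
  obtain f f' where f: "f \<in> hom H H" "\<forall>x\<in>carrier H. fst (f x) = g (fst x)"
    "f' \<in> hom H H" "\<forall>x\<in>carrier H. fst (f' x) = g' (fst x)" using assms unfolding lifts_def by blast
  have "(\<lambda>x. f (f' x)) \<in> hom H H" using f(1,3) by (auto simp: hom_def Pi_iff)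
  moreover have "\<forall>x\<in>carrier H. fst (f (f' x)) = g (g' (fst x))" using f by (auto simp: hom_def Pi_iff)
  ultimately show ?thesis unfolding lifts_def by (intro bexI[of _ "\<lambda>x. f (f' x)"])
qed

lemma lifts_conj:
  assumes s: "s \<in> carrier G" shows "lifts (\<lambda>x. s \<cdot>\<^sub>G x \<cdot>\<^sub>G gi s)"
proof -
  interpret s: group_hom H G fst by unfold_locales (rule fst_hom)
  obtain a where a: "(s, a) \<in> carrier H" using lift_exists s by blast
  let ?f = "\<lambda>x. (s, a) \<otimes>\<^bsub>H\<^esub> x \<otimes>\<^bsub>H\<^esub> inv\<^bsub>H\<^esub> (s, a)"
  have "?f \<in> hom H H" by (rule homI) (use a in \<open>auto simp: H.group_normalize\<close>)
  moreover have "fst (?f x) = s \<cdot>\<^sub>G fst x \<cdot>\<^sub>G gi s" if "x \<in> carrier H" for x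
    using that a by simp
  ultimately show ?thesis unfolding lifts_def by (intro bexI[of _ ?f] ballI)
qed

text \<open>
  On \<open>F\<close> the endomorphism is \<open>x \<mapsto> l \<otimes> t x\<close> with a field endomorphism \<open>t\<close>, which commutes with \<open>\<eta>\<close> since
  both images of \<open>\<eta> \<zeta>\<close> are inverse to \<open>t \<zeta>\<close>. The lift multiplies the second component by the norm of
  \<open>l\<close>. The case \<open>l = \<zero>\<close> covers the endomorphisms that are trivial on \<open>F\<close>.
\<close>

lemma lifts_normalized:
  assumes f: "f \<in> hom G G" and fb: "f b = b [^]\<^bsub>G\<^esub> (k::nat)"
  shows "lifts f"
proof -
  interpret f: group_hom G G f by unfold_locales (rule f)
  have "\<exists>l\<in>carrier F. \<exists>t\<in>ring_hom F F. (\<forall>x\<in>carrier F. f x = l \<otimes> t x)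
    \<and> (\<forall>x\<in>carrier F. t (\<eta> x) = \<eta> (t x)) \<and> (l = \<zero> \<or> t \<zeta> = \<zeta> [^] k)"
  proof (cases "f \<one> = \<zero>")
    case True
    have "f x = \<zero>" if x: "x \<in> carrier F" for x
    proof (rule ccontr)
      assume "f x \<noteq> \<zero>"
      then have "inj_on f (carrier G)" using hom_kill_or_inj[OF f] x by blast
      then have "\<one> = \<zero>" using True zero_eq by (metis F_G f.hom_one inj_onD one_closed zero_closed)
      then show False by simp
    qed
    moreover have "(\<lambda>x. x) \<in> ring_hom F F" by (rule ring_hom_memI) auto
    ultimately show ?thesis by (intro bexI[of _ \<zero>] bexI[of _ "\<lambda>x. x"]) auto
  next
    case False
    have chi: "\<chi> (f b) = \<zeta> [^] k" unfolding fb chi_b ..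
    obtain t where t: "t \<in> ring_hom F F" "t \<zeta> = \<zeta> [^] k" "\<forall>x\<in>carrier F. f x = f \<one> \<otimes> t x"
      using semilinear[of f "\<chi> (f b)", OF hom_F[OF f] hom_add[OF f] _ hom_zeta[OF f] False] b chi zeta by auto
    interpret t: ring_hom_cring F F t by unfold_locales (rule t(1))
    have e: "t (\<eta> \<zeta>) = \<eta> (t \<zeta>)"
    proof -
      have z: "\<zeta> \<in> carrier F" "t \<zeta> \<in> carrier F" using zeta by auto
      have "t \<zeta> \<otimes> t (\<eta> \<zeta>) = \<one>" using zeta_unit t.hom_mult[of \<zeta> "\<eta> \<zeta>"] z by simp
      moreover have "t \<zeta> \<otimes> \<eta> (t \<zeta>) = \<one>" unfolding t(2) using chi_unit[of "b [^]\<^bsub>G\<^esub> k"] b by (simp add: chi_b)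
      ultimately show ?thesis using z by (metis comm_inv_char eta(1) t.hom_closed)
    qed
    have "t (\<eta> x) = \<eta> (t x)" if x: "x \<in> carrier F" for x
      by (rule span_induct[where P = "\<lambda>x. t (\<eta> x) = \<eta> (t x)" and z = \<one>]) (use x e zeta in auto)
    then show ?thesis using t hom_F[OF f one_closed] by blast
  qed
  then obtain l t where l: "l \<in> carrier F" and t: "t \<in> ring_hom F F" and fx: "\<And>x. x \<in> carrier F \<Longrightarrow> f x = l \<otimes> t x"
    and te: "\<And>x. x \<in> carrier F \<Longrightarrow> t (\<eta> x) = \<eta> (t x)" and lz: "l = \<zero> \<or> t \<zeta> = \<zeta> [^] k" by blast
  interpret t: ring_hom_cring F F t by unfold_locales (rule t)
  have fdec: "f (x \<cdot>\<^sub>G b [^]\<^bsub>G\<^esub> i) = (l \<otimes> t x) \<cdot>\<^sub>G b [^]\<^bsub>G\<^esub> (k * i)" if "x \<in> carrier F" for x and i :: nat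
    using that b f.hom_nat_pow[OF b(1), of i] fx fb by (simp add: G.nat_pow_pow)
  have pr_f: "pr (f g) = l \<otimes> t (pr g)" if "g \<in> carrier G" for g
    using decE[OF that] fdec pr_dec l by (metis m_closed t.hom_closed)
  have chif: "l \<otimes> t (\<chi> g) = l \<otimes> \<chi> (f g)" if g: "g \<in> carrier G" for g
  proof -
    obtain x i where xi: "x \<in> carrier F" "g = x \<cdot>\<^sub>G b [^]\<^bsub>G\<^esub> (i::nat)" using decE g by blast
    have "\<chi> (f g) = \<zeta> [^] (k * i)" unfolding xi(2) fdec[OF xi(1)] using chi_dec l xi by simp
    moreover have "t (\<chi> g) = t \<zeta> [^] i" unfolding xi(2) chi_dec[OF xi(1)]
      by (induction i) (use zeta in auto)
    ultimately show ?thesis using lz l g zeta by (auto simp: nat_pow_pow)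
  qed
  define m where "m = l \<otimes> \<eta> l"
  have m: "m \<in> carrier F" "\<eta> m = m" unfolding m_def using l by (auto simp: m_comm)
  define f' where "f' = (\<lambda>(g, a). (f g, m \<otimes> t a))"
  have f'c: "f' h \<in> carrier H" if hH: "h \<in> carrier H" for h
  proof -
    obtain g a where h: "h = (g, a)" "g \<in> carrier G" "a \<in> carrier F" "a \<oplus> \<eta> a = pr g \<otimes> \<eta> (pr g)"
      using hH H_carrier by (cases h) auto
    have "m \<otimes> t a \<oplus> \<eta> (m \<otimes> t a) = m \<otimes> t (a \<oplus> \<eta> a)" using m h(3) te by (simp add: r_distr)
    also have "\<dots> = m \<otimes> (t (pr g) \<otimes> \<eta> (t (pr g)))" unfolding h(4) using te h by simp
    also have "\<dots> = (l \<otimes> t (pr g)) \<otimes> \<eta> (l \<otimes> t (pr g))" unfolding m_def using l h by (simp add: m_ac)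
    also have "\<dots> = pr (f g) \<otimes> \<eta> (pr (f g))" using pr_f h by simp
    finally show ?thesis unfolding h(1) f'_def using m h by (simp add: H_carrier)
  qed
  have "f' \<in> hom H H"
  proof (rule homI)
    fix h h' assume hh: "h \<in> carrier H" "h' \<in> carrier H"
    obtain g a where h: "h = (g, a)" "g \<in> carrier G" "a \<in> carrier F" using hh H_carrier by (cases h) auto
    obtain g' a' where h': "h' = (g', a')" "g' \<in> carrier G" "a' \<in> carrier F" using hh H_carrier by (cases h') auto
    define x y u w where "x = t (pr g)" and "y = t (pr g')" and "u = t (\<chi> g)" and "w = \<chi> (f g)"
    have c: "x \<in> carrier F" "y \<in> carrier F" "u \<in> carrier F" "w \<in> carrier F"
      unfolding x_def y_def u_def w_def using h h' by auto
    have lu: "l \<otimes> u = l \<otimes> w" unfolding u_def w_def using chif h by simp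
    have "m \<otimes> (x \<otimes> \<eta> (u \<otimes> y)) = (l \<otimes> x) \<otimes> \<eta> ((l \<otimes> u) \<otimes> y)"
      unfolding m_def using c l by (simp add: m_ac)
    also have "\<dots> = (l \<otimes> x) \<otimes> \<eta> (w \<otimes> (l \<otimes> y))" unfolding lu using c l by (simp add: m_ac)
    finally have *: "m \<otimes> (x \<otimes> \<eta> (u \<otimes> y)) = (l \<otimes> x) \<otimes> \<eta> (w \<otimes> (l \<otimes> y))" .
    have "m \<otimes> t (a \<oplus> a' \<oplus> pr g \<otimes> \<eta> (\<chi> g \<otimes> pr g')) = m \<otimes> t a \<oplus> m \<otimes> t a' \<oplus> m \<otimes> (x \<otimes> \<eta> (u \<otimes> y))"
      unfolding x_def y_def u_def using m h h' te by (simp add: r_distr)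
    then show "f' (h \<otimes>\<^bsub>H\<^esub> h') = f' h \<otimes>\<^bsub>H\<^esub> f' h'"
      unfolding * unfolding f'_def h(1) h'(1) H_mult prod.case
      using pr_f h h' by (simp add: x_def y_def w_def)
  qed (rule f'c)
  moreover have "\<forall>x\<in>carrier H. fst (f' x) = f (fst x)" unfolding f'_def by auto
  ultimately show ?thesis unfolding lifts_def by (intro bexI[of _ f'])
qed

text \<open>
  Conjugating by an element of \<open>F\<close> moves \<open>f b\<close> into \<open>\<langle>b\<rangle>\<close>. If \<open>f b\<close> lies over \<open>b [^] k\<close> and this acts
  trivially on \<open>F\<close>, the orders of \<open>x\<close> and of \<open>b\<close> leave only \<open>x = \<zero>\<close>; otherwise \<open>x\<close> is of the form
  \<open>s \<ominus> \<zeta> [^] k \<otimes> s\<close>.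
\<close>

lemma lifts_all:
  assumes f: "f \<in> hom G G"
  shows "lifts f"
proof -
  interpret f: group_hom G G f by unfold_locales (rule f)
  obtain x k where xk: "x \<in> carrier F" "f b = x \<cdot>\<^sub>G b [^]\<^bsub>G\<^esub> (k::nat)" using decE b f.hom_closed by metis
  have "\<exists>s\<in>carrier F. x = s \<ominus> \<zeta> [^] k \<otimes> s"
  proof (cases "\<zeta> [^] k = \<one>")
    case True
    have "x \<cdot>\<^sub>G b [^]\<^bsub>G\<^esub> k = b [^]\<^bsub>G\<^esub> k \<cdot>\<^sub>G x"
    proof -
      have "b [^]\<^bsub>G\<^esub> k \<cdot>\<^sub>G x \<cdot>\<^sub>G gi (b [^]\<^bsub>G\<^esub> k) = x" using conj_bpow[OF xk(1), of k] True xk by simp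
      then have "(b [^]\<^bsub>G\<^esub> k \<cdot>\<^sub>G x \<cdot>\<^sub>G gi (b [^]\<^bsub>G\<^esub> k)) \<cdot>\<^sub>G b [^]\<^bsub>G\<^esub> k = x \<cdot>\<^sub>G b [^]\<^bsub>G\<^esub> k" by simp
      then show ?thesis using xk(1) b by (simp add: G.group_normalize)
    qed
    then have "(f b) [^]\<^bsub>G\<^esub> (q ^ v) = x [^]\<^bsub>G\<^esub> (q ^ v) \<cdot>\<^sub>G (b [^]\<^bsub>G\<^esub> k) [^]\<^bsub>G\<^esub> (q ^ v)"
      unfolding xk(2) using xk(1) b by (intro G.pow_mult_distrib) auto
    moreover have "(f b) [^]\<^bsub>G\<^esub> (q ^ v) = \<one>\<^bsub>G\<^esub>" using f.hom_nat_pow[OF b(1), of "q ^ v"] bpow_order by simp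
    moreover have "(b [^]\<^bsub>G\<^esub> k) [^]\<^bsub>G\<^esub> (q ^ v) = \<one>\<^bsub>G\<^esub>" using e_pow_order[of "b [^]\<^bsub>G\<^esub> k"] b by simp
    ultimately have "x [^]\<^bsub>G\<^esub> (q ^ v) = \<one>\<^bsub>G\<^esub>" using xk by simp
    moreover have "coprime (q ^ v) p" using coprime_pq[of 1 v] by (simp add: coprime_commute)
    ultimately have "x = \<one>\<^bsub>G\<^esub>" using coprime_pow_trivial[OF G.is_group F_G[OF xk(1)] _ F_p[OF xk(1)]] by blast
    then have "x = \<zero>" using zero_eq by simp
    then show ?thesis using True by (intro bexI[of _ \<zero>]) (auto simp: a_minus_def)
  next
    case False
    have z: "\<zeta> [^] k \<in> carrier F" using zeta by simp
    have d: "\<one> \<ominus> \<zeta> [^] k \<in> carrier F" "\<one> \<ominus> \<zeta> [^] k \<noteq> \<zero>"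
      using False z by (simp, metis r_right_minus_eq one_closed)
    define s where "s = m_inv F (\<one> \<ominus> \<zeta> [^] k) \<otimes> x"
    have s: "s \<in> carrier F" "(\<one> \<ominus> \<zeta> [^] k) \<otimes> s = x" unfolding s_def using unit_inv[OF d] xk d by auto
    have "(\<one> \<ominus> \<zeta> [^] k) \<otimes> s = s \<ominus> \<zeta> [^] k \<otimes> s" using s(1) z by algebra
    then show ?thesis using s by auto
  qed
  then obtain s where s: "s \<in> carrier F" "x = s \<ominus> \<zeta> [^] k \<otimes> s" by blast
  define f0 where "f0 = (\<lambda>y. gi s \<cdot>\<^sub>G f y \<cdot>\<^sub>G gi (gi s))"
  have f0: "f0 \<in> hom G G" unfolding f0_def
    by (rule homI) (use s in \<open>auto simp: G.group_normalize\<close>)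
  have "s \<cdot>\<^sub>G b [^]\<^bsub>G\<^esub> k \<cdot>\<^sub>G gi s = f b"
  proof -
    have "s \<cdot>\<^sub>G b [^]\<^bsub>G\<^esub> k \<cdot>\<^sub>G gi s = s \<cdot>\<^sub>G (b [^]\<^bsub>G\<^esub> k \<cdot>\<^sub>G gi s \<cdot>\<^sub>G gi (b [^]\<^bsub>G\<^esub> k)) \<cdot>\<^sub>G b [^]\<^bsub>G\<^esub> k"
      using s(1) b by (simp add: G.group_normalize)
    also have "b [^]\<^bsub>G\<^esub> k \<cdot>\<^sub>G gi s \<cdot>\<^sub>G gi (b [^]\<^bsub>G\<^esub> k) = \<ominus> (\<zeta> [^] k \<otimes> s)"
      using conj_bpow[of "gi s" k] s(1) zeta minus_eq_inv[OF s(1)] by (metis F_inv_closed nat_pow_closed r_minus)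
    also have "s \<cdot>\<^sub>G \<ominus> (\<zeta> [^] k \<otimes> s) = x" unfolding s(2) a_minus_def using s(1) zeta by (intro add_eq[symmetric]) auto
    finally show ?thesis unfolding xk(2) .
  qed
  then have "f0 b = b [^]\<^bsub>G\<^esub> k" unfolding f0_def using s(1) b
    by (metis (no_types, lifting) F_G G.inv_closed G.inv_inv G.inv_mult_cancel_left(1) G.m_assoc G.m_closed G.nat_pow_closed G.l_inv G.r_one)
  then have "lifts f0" using lifts_normalized f0 by blast
  then obtain f' where f': "f' \<in> hom H H" "\<forall>y\<in>carrier H. fst (f' y) = s \<cdot>\<^sub>G f0 (fst y) \<cdot>\<^sub>G gi s"
    using lifts_comp[OF lifts_conj[of s]] s(1) unfolding lifts_def by blast
  have "s \<cdot>\<^sub>G f0 y \<cdot>\<^sub>G gi s = f y" if "y \<in> carrier G" for y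
    unfolding f0_def using s(1) that by (simp add: G.group_normalize)
  moreover have "fst y \<in> carrier G" if "y \<in> carrier H" for y using that by (cases y) (simp add: H_carrier)
  ultimately show ?thesis using f' unfolding lifts_def by metis
qed

lemma End_H_iso_End_G: "End H \<cong> End G"
proof (rule End_iso_of_unique_lifting[OF group_H G.is_group fst_hom fst_surj])
  fix g assume "g \<in> hom G G"
  then show "\<exists>f\<in>hom H H. \<forall>x\<in>carrier H. fst (f x) = g (fst x)" using lifts_all unfolding lifts_def by blast
qed (rule hom_preserves_ker lift_unique; assumption)+

lemma finite_H: "finite (carrier H)"
proof -
  have "carrier H \<subseteq> carrier G \<times> carrier F" by (auto simp: H_carrier)
  then show ?thesis using finite_G fin finite_subset by blast
qed

lemma card_H: "card (carrier H) \<noteq> card (carrier G)"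
proof
  assume "card (carrier H) = card (carrier G)"
  then have inj: "inj_on fst (carrier H)" using finite_H fst_surj by (metis eq_card_imp_inj_on)
  obtain w where w: "w \<in> carrier F" "w \<noteq> \<zero>" "\<eta> w = \<ominus> w" using inv.decompose by metis
  then have "(\<one>\<^bsub>G\<^esub>, w) \<in> carrier H" "(\<one>\<^bsub>G\<^esub>, \<zero>) \<in> carrier H" by (auto simp: H_carrier r_neg)
  then show False using inj_onD[OF inj, of "(\<one>\<^bsub>G\<^esub>, w)" "(\<one>\<^bsub>G\<^esub>, \<zero>)"] w by simp
qed

lemma not_determined:
  assumes "infinite (UNIV :: 'b set)"
  shows "\<not> determined_by_End G TYPE('b)"
proof -
  obtain B :: "'b set" where B: "finite B" "card B = card (carrier H)"
    using infinite_arbitrarily_large[OF assms, of "card (carrier H)"] by blast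
  then obtain h where h: "bij_betw h (carrier H) B" using finite_H by (metis finite_same_card_bij)
  define H' where "H' = image_group h H"
  have hi: "h \<in> iso H H'"
  proof -
    have inj: "inj_on h (carrier H)" using h by (simp add: bij_betw_def)
    have "h \<in> hom H H'" by (rule homI) (use inj in \<open>auto simp: H'_def image_group_def inv_into_f_f\<close>)
    then show ?thesis using inj by (simp add: iso_def bij_betw_def H'_def image_group_def)
  qed
  have HH': "H \<cong> H'" using hi unfolding is_iso_def by blast
  have "group H'" using H.iso_imp_img_group[OF hi] by (simp add: H'_def image_group_def)
  moreover have "End G \<cong> End H'"
    using iso_trans[OF End_iso_sym[OF End_H_iso_End_G group_H] End_iso_of_iso[OF group_H \<open>group H'\<close> HH']] .
  moreover have "\<not> G \<cong> H'"
    using iso_same_card[of G H'] iso_same_card[OF HH'] card_H by auto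
  ultimately show ?thesis unfolding determined_by_End_def by blast
qed

end

section \<open>Recovering a group from affine coordinates\<close>

text \<open>
  Each \<open>h\<close> in \<open>H\<close> has affine coordinates: it stands for the map \<open>x \<mapsto> \<Lambda> h \<otimes> x \<oplus> t h\<close> of \<open>F\<close>. The idempotent
  endomorphism \<open>\<epsilon>\<close> projects \<open>H\<close> onto \<open>\<langle>c\<rangle>\<close>, and endomorphisms of \<open>H\<close> satisfy the same alternative as those
  of \<open>G\<close>.
\<close>

locale affine_reconstruction = field_semidirect F \<zeta> p q n G b v + H: group H
  for F :: "('a, 'f) ring_scheme" (structure) and \<zeta> p q n and G :: "('a, 'm) monoid_scheme" and b v
    and H :: "('b, 'k) monoid_scheme" +
  fixes t \<Lambda> :: "'b \<Rightarrow> 'a" and \<epsilon> :: "'b \<Rightarrow> 'b" and c :: 'b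
  assumes t_closed [simp]: "\<And>h. h \<in> carrier H \<Longrightarrow> t h \<in> carrier F"
    and lam_closed [simp]: "\<And>h. h \<in> carrier H \<Longrightarrow> \<Lambda> h \<in> carrier F"
    and lam_nonzero: "\<And>h. h \<in> carrier H \<Longrightarrow> \<Lambda> h \<noteq> \<zero>"
    and t_mult: "\<And>h k. h \<in> carrier H \<Longrightarrow> k \<in> carrier H \<Longrightarrow> t (h \<otimes>\<^bsub>H\<^esub> k) = t h \<oplus> \<Lambda> h \<otimes> t k"
    and lam_mult: "\<And>h k. h \<in> carrier H \<Longrightarrow> k \<in> carrier H \<Longrightarrow> \<Lambda> (h \<otimes>\<^bsub>H\<^esub> k) = \<Lambda> h \<otimes> \<Lambda> k"
    and central: "\<And>h k. h \<in> carrier H \<Longrightarrow> k \<in> carrier H \<Longrightarrow> t h = \<zero> \<Longrightarrow> \<Lambda> h = \<one> \<Longrightarrow> h \<otimes>\<^bsub>H\<^esub> k = k \<otimes>\<^bsub>H\<^esub> h"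
    and eps_hom: "\<epsilon> \<in> hom H H"
    and eps_c: "\<epsilon> c = c" and eps_pow: "\<And>h. h \<in> carrier H \<Longrightarrow> \<exists>i::nat. \<epsilon> h = c [^]\<^bsub>H\<^esub> i"
    and c: "c \<in> carrier H" "H.ord c = q ^ v" "t c = \<zero>" "\<Lambda> c \<noteq> \<one>" "\<Lambda> c [^] q = \<one>"
    and inj_or_kill: "\<And>f. f \<in> hom H H \<Longrightarrow> inj_on f (carrier H) \<or> (\<forall>k\<in>carrier H. \<epsilon> k = \<one>\<^bsub>H\<^esub> \<longrightarrow> f k = \<one>\<^bsub>H\<^esub>)"
    and transl: "\<And>s. s \<in> carrier F \<Longrightarrow> \<exists>h\<in>carrier H. t h = s \<and> \<Lambda> h = \<one>"
begin

abbreviation hm (infixl \<open>\<cdot>\<^sub>H\<close> 70) where "hm \<equiv> monoid.mult H"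
abbreviation hi where "hi x \<equiv> inv\<^bsub>H\<^esub> x"

sublocale eps: group_hom H H \<epsilon>
  by unfold_locales (rule eps_hom)

lemma lam_one [simp]: "\<Lambda> \<one>\<^bsub>H\<^esub> = \<one>"
proof -
  have "\<Lambda> \<one>\<^bsub>H\<^esub> \<otimes> \<Lambda> \<one>\<^bsub>H\<^esub> = \<Lambda> \<one>\<^bsub>H\<^esub> \<otimes> \<one>" using lam_mult[of "\<one>\<^bsub>H\<^esub>" "\<one>\<^bsub>H\<^esub>"] by simp
  then show ?thesis
    using m_lcancel[OF lam_nonzero[OF H.one_closed], of "\<Lambda> \<one>\<^bsub>H\<^esub>" \<one>] by simp
qed

lemma t_one [simp]: "t \<one>\<^bsub>H\<^esub> = \<zero>"
  using t_mult[of "\<one>\<^bsub>H\<^esub>" "\<one>\<^bsub>H\<^esub>"] by simp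

lemma lam_inv: "h \<in> carrier H \<Longrightarrow> \<Lambda> (hi h) \<otimes> \<Lambda> h = \<one>" "h \<in> carrier H \<Longrightarrow> \<Lambda> h \<otimes> \<Lambda> (hi h) = \<one>"
  using lam_mult[of "hi h" h] lam_mult[of h "hi h"] by simp_all

lemma t_inv: "h \<in> carrier H \<Longrightarrow> t (hi h) = \<ominus> (\<Lambda> (hi h) \<otimes> t h)"
  using t_mult[of "hi h" h] by (simp add: minus_equality)

lemma lam_inv_one: "h \<in> carrier H \<Longrightarrow> \<Lambda> h = \<one> \<Longrightarrow> \<Lambda> (hi h) = \<one>"
  using lam_inv[of h] by simp

lemma lam_pow: "h \<in> carrier H \<Longrightarrow> \<Lambda> (h [^]\<^bsub>H\<^esub> (k::nat)) = \<Lambda> h [^] k"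
  by (induction k) (auto simp: lam_mult)

lemma t_pow_one: "h \<in> carrier H \<Longrightarrow> \<Lambda> h = \<one> \<Longrightarrow> t (h [^]\<^bsub>H\<^esub> (k::nat)) = add_pow F k (t h)"
  by (induction k) (auto simp: t_mult lam_pow)

lemma t_pow_zero: "h \<in> carrier H \<Longrightarrow> t h = \<zero> \<Longrightarrow> t (h [^]\<^bsub>H\<^esub> (k::nat)) = \<zero>"
  by (induction k) (auto simp: t_mult)

definition M where "M = p ^ n - 1"

lemma M_pos: "M > 0"
  unfolding M_def using one_less_power[OF prime_gt_1_nat[OF p] n_pos] by simp

lemma lam_M: "h \<in> carrier H \<Longrightarrow> \<Lambda> h [^] M = \<one>"
proof -
  assume h: "h \<in> carrier H"
  have "\<Lambda> h [^] M \<otimes> \<Lambda> h = \<one> \<otimes> \<Lambda> h"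
    unfolding M_def using fermat[OF lam_closed[OF h]] prime_gt_0_nat[OF p] h
    by (metis Suc_diff_1 l_one lam_closed nat_pow_Suc zero_less_power)
  then show ?thesis using m_rcancel[OF lam_nonzero[OF h] lam_closed[OF h], of "\<Lambda> h [^] M" \<one>] h by simp
qed

lemma nonabelian: "\<exists>h\<in>carrier H. \<exists>k\<in>carrier H. h \<cdot>\<^sub>H k \<noteq> k \<cdot>\<^sub>H h"
proof -
  obtain h where h: "h \<in> carrier H" "t h = \<one>" "\<Lambda> h = \<one>" using transl[of \<one>] by auto
  have "t (c \<cdot>\<^sub>H h) = \<Lambda> c" "t (h \<cdot>\<^sub>H c) = \<one>" using h c by (auto simp: t_mult)
  then have "c \<cdot>\<^sub>H h \<noteq> h \<cdot>\<^sub>H c" using c by metis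
  then show ?thesis using h c by blast
qed

text \<open>
  An endomorphism with commutative image cannot be injective, as \<open>H\<close> is not commutative.
\<close>

lemma commuting_image_kills:
  assumes f: "f \<in> hom H H" and comm: "\<And>h k. h \<in> carrier H \<Longrightarrow> k \<in> carrier H \<Longrightarrow> f h \<cdot>\<^sub>H f k = f k \<cdot>\<^sub>H f h"
    and k: "k \<in> carrier H" "\<epsilon> k = \<one>\<^bsub>H\<^esub>"
  shows "f k = \<one>\<^bsub>H\<^esub>"
proof -
  interpret f: group_hom H H f by unfold_locales (rule f)
  obtain h h' where h: "h \<in> carrier H" "h' \<in> carrier H" "h \<cdot>\<^sub>H h' \<noteq> h' \<cdot>\<^sub>H h" using nonabelian by blast
  have "f (h \<cdot>\<^sub>H h') = f (h' \<cdot>\<^sub>H h)" using h comm by simp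
  then have "\<not> inj_on f (carrier H)" using h by (meson H.m_closed inj_onD)
  then show ?thesis using inj_or_kill[OF f] k by blast
qed

text \<open>
  If \<open>\<Lambda> h = \<one>\<close>, then \<open>h [^] p\<close> is central; if \<open>t h = \<zero>\<close>, then \<open>h [^] M\<close> is central. The factor two is the
  one in \<open>pow_mult_class_two\<close>.
\<close>

definition N where "N = 2 * (p * M)"

lemma class_two_power:
  assumes x: "x \<in> carrier H" and y: "y \<in> carrier H"
    and z: "t (hi (x \<cdot>\<^sub>H y) \<cdot>\<^sub>H (y \<cdot>\<^sub>H x)) = \<zero>" and m: "t (x [^]\<^bsub>H\<^esub> (p * M)) = \<zero>"
  shows "(x \<cdot>\<^sub>H y) [^]\<^bsub>H\<^esub> N = x [^]\<^bsub>H\<^esub> N \<cdot>\<^sub>H y [^]\<^bsub>H\<^esub> N"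
  unfolding N_def
proof (rule H.pow_mult_class_two[OF x y])
  let ?z = "hi (x \<cdot>\<^sub>H y) \<cdot>\<^sub>H (y \<cdot>\<^sub>H x)"
  show zc: "?z \<in> carrier H" using x y by simp
  have "\<Lambda> ?z = \<Lambda> (hi (x \<cdot>\<^sub>H y)) \<otimes> \<Lambda> (x \<cdot>\<^sub>H y)" using x y by (simp add: lam_mult m_comm)
  then have "\<Lambda> ?z = \<one>" using lam_inv x y by simp
  then show "?z \<cdot>\<^sub>H x = x \<cdot>\<^sub>H ?z" "?z \<cdot>\<^sub>H y = y \<cdot>\<^sub>H ?z" using central[OF zc _ z] x y by auto
  show "y \<cdot>\<^sub>H x = x \<cdot>\<^sub>H y \<cdot>\<^sub>H ?z" using x y by (simp add: H.group_normalize)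
  have "\<Lambda> (x [^]\<^bsub>H\<^esub> (p * M)) = (\<Lambda> x [^] M) [^] p" using x by (simp add: lam_pow nat_pow_pow mult.commute)
  then have "\<Lambda> (x [^]\<^bsub>H\<^esub> (p * M)) = \<one>" using lam_M x by simp
  then show "y \<cdot>\<^sub>H x [^]\<^bsub>H\<^esub> (p * M) = x [^]\<^bsub>H\<^esub> (p * M) \<cdot>\<^sub>H y" using central[OF _ y m] x by simp
qed

lemma t_pM: "h \<in> carrier H \<Longrightarrow> \<Lambda> h = \<one> \<Longrightarrow> t (h [^]\<^bsub>H\<^esub> (p * k)) = \<zero>"
proof -
  assume h: "h \<in> carrier H" "\<Lambda> h = \<one>"
  have "add_pow F (p * k) (t h) = add_pow F k (add_pow F p (t h))"
    using add.nat_pow_pow[of "t h" k p] h by simp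
  then show ?thesis using h t_pow_one char_p by simp
qed

lemma power_central:
  assumes "h \<in> carrier H" "\<Lambda> h = \<one> \<or> t h = \<zero>" "k \<in> carrier H"
  shows "h [^]\<^bsub>H\<^esub> N \<cdot>\<^sub>H k = k \<cdot>\<^sub>H h [^]\<^bsub>H\<^esub> N"
proof (rule central)
  have N: "N = p * (2 * M)" "N = M * (2 * p)" unfolding N_def by auto
  show "t (h [^]\<^bsub>H\<^esub> N) = \<zero>" using assms t_pM[of h "2 * M"] t_pow_zero N(1) by metis
  show "\<Lambda> (h [^]\<^bsub>H\<^esub> N) = \<one>" unfolding N(2) using lam_M assms
    by (simp add: lam_pow nat_pow_pow[symmetric])
qed (use assms in auto)

lemma power_mult:
  assumes x: "x \<in> carrier H" and y: "y \<in> carrier H" and xy: "\<Lambda> x = \<one> \<and> \<Lambda> y = \<one> \<or> t x = \<zero> \<and> t y = \<zero>"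
  shows "(x \<cdot>\<^sub>H y) [^]\<^bsub>H\<^esub> N = x [^]\<^bsub>H\<^esub> N \<cdot>\<^sub>H y [^]\<^bsub>H\<^esub> N"
proof (rule class_two_power[OF x y])
  show "t (hi (x \<cdot>\<^sub>H y) \<cdot>\<^sub>H (y \<cdot>\<^sub>H x)) = \<zero>"
    using xy
  proof
    assume *: "\<Lambda> x = \<one> \<and> \<Lambda> y = \<one>"
    then have "\<Lambda> (x \<cdot>\<^sub>H y) = \<one>" using x y by (simp add: lam_mult)
    then have "\<Lambda> (hi (x \<cdot>\<^sub>H y)) = \<one>" using lam_inv_one x y by blast
    then show ?thesis using * x y by (simp add: t_mult t_inv a_comm r_neg)
  next
    assume "t x = \<zero> \<and> t y = \<zero>"
    then show ?thesis using x y by (simp add: t_mult t_inv)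
  qed
  show "t (x [^]\<^bsub>H\<^esub> (p * M)) = \<zero>" using xy t_pM t_pow_zero x by blast
qed

definition s where "s x = (SOME h. h \<in> carrier H \<and> t h = x \<and> \<Lambda> h = \<one>)"

lemma s: "x \<in> carrier F \<Longrightarrow> s x \<in> carrier H" "x \<in> carrier F \<Longrightarrow> t (s x) = x" "x \<in> carrier F \<Longrightarrow> \<Lambda> (s x) = \<one>"
proof -
  assume "x \<in> carrier F"
  then have "\<exists>h. h \<in> carrier H \<and> t h = x \<and> \<Lambda> h = \<one>" using transl by blast
  then have "s x \<in> carrier H \<and> t (s x) = x \<and> \<Lambda> (s x) = \<one>" unfolding s_def by (rule someI_ex)
  then show "s x \<in> carrier H" "t (s x) = x" "\<Lambda> (s x) = \<one>" by auto
qed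

lemma same_t:
  assumes "h \<in> carrier H" "k \<in> carrier H" "\<Lambda> h = \<one>" "t h = t k"
  shows "t (hi h \<cdot>\<^sub>H k) = \<zero>"
  using assms lam_inv_one[of h] by (simp add: t_mult t_inv l_neg)

text \<open>
  Each \<open>h\<close> is a product \<open>l \<cdot>\<^sub>H d\<close> with \<open>\<Lambda> l = \<one>\<close> and \<open>t d = \<zero>\<close>, unique up to a central element. On both
  kinds of factors the \<open>N\<close>-th power is a homomorphism into the centre, and \<open>\<psi>\<close> combines the two. It
  plays the role of the transfer into the centre.
\<close>

definition \<psi> where "\<psi> h = s (t h) [^]\<^bsub>H\<^esub> N \<cdot>\<^sub>H (hi (s (t h)) \<cdot>\<^sub>H h) [^]\<^bsub>H\<^esub> N"

lemma psi_dec: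
  assumes l: "l \<in> carrier H" "\<Lambda> l = \<one>" and d: "d \<in> carrier H" "t d = \<zero>"
  shows "\<psi> (l \<cdot>\<^sub>H d) = l [^]\<^bsub>H\<^esub> N \<cdot>\<^sub>H d [^]\<^bsub>H\<^esub> N"
proof -
  define m where "m = s (t l)"
  have m: "m \<in> carrier H" "t m = t l" "\<Lambda> m = \<one>" unfolding m_def using s l by auto
  define z where "z = hi m \<cdot>\<^sub>H l"
  have z: "z \<in> carrier H" "t z = \<zero>" "\<Lambda> z = \<one>"
    unfolding z_def using m l same_t lam_inv_one by (auto simp: lam_mult)
  have lm: "l = m \<cdot>\<^sub>H z" unfolding z_def using m l by (simp add: H.group_normalize)
  have tl: "t (l \<cdot>\<^sub>H d) = t l" using l d by (simp add: t_mult)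
  have "hi m \<cdot>\<^sub>H (l \<cdot>\<^sub>H d) = z \<cdot>\<^sub>H d" unfolding z_def using m l d by (simp add: H.m_assoc)
  then have "\<psi> (l \<cdot>\<^sub>H d) = m [^]\<^bsub>H\<^esub> N \<cdot>\<^sub>H (z \<cdot>\<^sub>H d) [^]\<^bsub>H\<^esub> N" unfolding \<psi>_def tl m_def[symmetric] by simp
  also have "(z \<cdot>\<^sub>H d) [^]\<^bsub>H\<^esub> N = z [^]\<^bsub>H\<^esub> N \<cdot>\<^sub>H d [^]\<^bsub>H\<^esub> N" using power_mult z d by blast
  also have "m [^]\<^bsub>H\<^esub> N \<cdot>\<^sub>H (z [^]\<^bsub>H\<^esub> N \<cdot>\<^sub>H d [^]\<^bsub>H\<^esub> N) = (m [^]\<^bsub>H\<^esub> N \<cdot>\<^sub>H z [^]\<^bsub>H\<^esub> N) \<cdot>\<^sub>H d [^]\<^bsub>H\<^esub> N"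
    using m z d by (simp add: H.m_assoc)
  also have "m [^]\<^bsub>H\<^esub> N \<cdot>\<^sub>H z [^]\<^bsub>H\<^esub> N = l [^]\<^bsub>H\<^esub> N" unfolding lm using power_mult m z by metis
  finally show ?thesis .
qed

lemma decomp:
  assumes "h \<in> carrier H"
  obtains l d where "l \<in> carrier H" "\<Lambda> l = \<one>" "d \<in> carrier H" "t d = \<zero>" "h = l \<cdot>\<^sub>H d"
proof -
  have *: "s (t h) \<in> carrier H" "t (s (t h)) = t h" "\<Lambda> (s (t h)) = \<one>" using s assms by auto
  show thesis
    by (rule that[of "s (t h)" "hi (s (t h)) \<cdot>\<^sub>H h"])
      (use * assms same_t[of "s (t h)" h] in \<open>auto simp: H.group_normalize\<close>)
qed

lemma psi_hom: "\<psi> \<in> hom H H"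
  and psi_comm: "h \<in> carrier H \<Longrightarrow> k \<in> carrier H \<Longrightarrow> \<psi> h \<cdot>\<^sub>H k = k \<cdot>\<^sub>H \<psi> h"
proof -
  have cl: "\<psi> h \<in> carrier H" if h: "h \<in> carrier H" for h
    using decomp[OF h] psi_dec by (metis H.m_closed H.nat_pow_closed)
  show "\<psi> h \<cdot>\<^sub>H k = k \<cdot>\<^sub>H \<psi> h" if hk: "h \<in> carrier H" "k \<in> carrier H" for h k
  proof -
    obtain l d where l: "l \<in> carrier H" "\<Lambda> l = \<one>" "d \<in> carrier H" "t d = \<zero>" "h = l \<cdot>\<^sub>H d" using decomp hk by metis
    have "l [^]\<^bsub>H\<^esub> N \<cdot>\<^sub>H d [^]\<^bsub>H\<^esub> N \<cdot>\<^sub>H k = l [^]\<^bsub>H\<^esub> N \<cdot>\<^sub>H (k \<cdot>\<^sub>H d [^]\<^bsub>H\<^esub> N)"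
      using power_central[of d k] l hk by (simp add: H.m_assoc)
    also have "\<dots> = (k \<cdot>\<^sub>H l [^]\<^bsub>H\<^esub> N) \<cdot>\<^sub>H d [^]\<^bsub>H\<^esub> N"
      using power_central[of l k] l hk by (simp flip: H.m_assoc)
    finally show ?thesis unfolding l(5) psi_dec[OF l(1-4)] using l hk by (simp add: H.m_assoc)
  qed
  show "\<psi> \<in> hom H H"
  proof (rule homI)
    fix h h' assume hh: "h \<in> carrier H" "h' \<in> carrier H"
    obtain l d where l: "l \<in> carrier H" "\<Lambda> l = \<one>" "d \<in> carrier H" "t d = \<zero>" "h = l \<cdot>\<^sub>H d" using decomp hh by metis
    obtain l' d' where l': "l' \<in> carrier H" "\<Lambda> l' = \<one>" "d' \<in> carrier H" "t d' = \<zero>" "h' = l' \<cdot>\<^sub>H d'" using decomp hh by metis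
    \<comment> \<open>Moving \<open>d\<close> past \<open>l'\<close> replaces \<open>l'\<close> by a conjugate with the same central power.\<close>
    define m where "m = d \<cdot>\<^sub>H l' \<cdot>\<^sub>H hi d"
    have m: "m \<in> carrier H" "\<Lambda> m = \<one>" unfolding m_def using l l' lam_inv by (auto simp: lam_mult)
    have mp: "m [^]\<^bsub>H\<^esub> (k::nat) = d \<cdot>\<^sub>H l' [^]\<^bsub>H\<^esub> k \<cdot>\<^sub>H hi d" for k
      by (induction k) (use l l' in \<open>auto simp: m_def H.group_normalize\<close>)
    have mN: "m [^]\<^bsub>H\<^esub> N = l' [^]\<^bsub>H\<^esub> N"
      unfolding mp using power_central[of l' d] l l' by (metis H.inv_solve_right' H.m_closed H.nat_pow_closed)
    have "h \<cdot>\<^sub>H h' = (l \<cdot>\<^sub>H m) \<cdot>\<^sub>H (d \<cdot>\<^sub>H d')" unfolding m_def l(5) l'(5) using l l' by (simp add: H.group_normalize)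
    moreover have "\<Lambda> (l \<cdot>\<^sub>H m) = \<one>" "t (d \<cdot>\<^sub>H d') = \<zero>" using l l' m by (auto simp: lam_mult t_mult)
    ultimately have "\<psi> (h \<cdot>\<^sub>H h') = (l \<cdot>\<^sub>H m) [^]\<^bsub>H\<^esub> N \<cdot>\<^sub>H (d \<cdot>\<^sub>H d') [^]\<^bsub>H\<^esub> N" using psi_dec l l' m by simp
    also have "\<dots> = (l [^]\<^bsub>H\<^esub> N \<cdot>\<^sub>H l' [^]\<^bsub>H\<^esub> N) \<cdot>\<^sub>H (d [^]\<^bsub>H\<^esub> N \<cdot>\<^sub>H d' [^]\<^bsub>H\<^esub> N)"
      using power_mult[of l m] power_mult[of d d'] l l' m mN by simp
    also have "\<dots> = l [^]\<^bsub>H\<^esub> N \<cdot>\<^sub>H (l' [^]\<^bsub>H\<^esub> N \<cdot>\<^sub>H d [^]\<^bsub>H\<^esub> N) \<cdot>\<^sub>H d' [^]\<^bsub>H\<^esub> N"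
      using l l' by (simp add: H.m_assoc)
    also have "l' [^]\<^bsub>H\<^esub> N \<cdot>\<^sub>H d [^]\<^bsub>H\<^esub> N = d [^]\<^bsub>H\<^esub> N \<cdot>\<^sub>H l' [^]\<^bsub>H\<^esub> N" using power_central[of l' "d [^]\<^bsub>H\<^esub> N"] l l' by simp
    finally show "\<psi> (h \<cdot>\<^sub>H h') = \<psi> h \<cdot>\<^sub>H \<psi> h'"
      unfolding l(5) l'(5) psi_dec[OF l(1-4)] psi_dec[OF l'(1-4)] using l l' by (simp add: H.m_assoc)
  qed (rule cl)
qed

definition K where "K = {h \<in> carrier H. \<epsilon> h = \<one>\<^bsub>H\<^esub>}"

lemma K_normal: "K \<lhd> H"
  using eps.normal_kernel unfolding kernel_def K_def .

lemma K_H: "k \<in> K \<Longrightarrow> k \<in> carrier H"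
  unfolding K_def by simp

text \<open>
  The endomorphism \<open>\<psi>\<close> has a commutative image, so it is trivial on \<open>K\<close>. At \<open>k [^] M\<close>, whose linear part is
  trivial, it is the \<open>N\<close>-th power.
\<close>

lemma K_exponent: "k \<in> K \<Longrightarrow> k [^]\<^bsub>H\<^esub> (M * N) = \<one>\<^bsub>H\<^esub>"
proof -
  assume k: "k \<in> K"
  interpret psi: group_hom H H \<psi> by unfold_locales (rule psi_hom)
  let ?k = "k [^]\<^bsub>H\<^esub> M"
  have kH: "k \<in> carrier H" using k K_H by blast
  have "\<psi> k = \<one>\<^bsub>H\<^esub>"
  proof (rule commuting_image_kills[OF psi_hom])
    fix h h' assume "h \<in> carrier H" "h' \<in> carrier H"
    then show "\<psi> h \<cdot>\<^sub>H \<psi> h' = \<psi> h' \<cdot>\<^sub>H \<psi> h" using psi_comm[of h "\<psi> h'"] psi.hom_closed by blast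
  qed (use k in \<open>auto simp: K_def\<close>)
  then have "\<psi> ?k = \<one>\<^bsub>H\<^esub>" using kH psi.hom_nat_pow[OF kH, of M] by simp
  moreover have "\<psi> ?k = ?k [^]\<^bsub>H\<^esub> N" using psi_dec[of ?k "\<one>\<^bsub>H\<^esub>"] kH lam_M by (simp add: lam_pow)
  ultimately show ?thesis using kH by (simp add: H.nat_pow_pow)
qed

text \<open>
  Otherwise choose the least \<open>m\<close> such that all \<open>m\<close>-th powers of elements of \<open>K\<close> lie in the derived
  subgroup, a prime \<open>r\<close> dividing \<open>m\<close>, and \<open>x\<close> in \<open>K\<close> with \<open>x [^] (m div r)\<close> outside it. The abelianization
  of \<open>H\<close> then has a quotient of order \<open>r\<close> in which \<open>x\<close> survives. As \<open>K\<close> is torsion, it contains an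
  element of order \<open>r\<close>, so this quotient embeds into \<open>H\<close>. The resulting endomorphism has a commutative
  image but is not trivial on \<open>K\<close>.
\<close>

lemma K_derived: "K \<subseteq> derived H (carrier H)"
proof (rule ccontr)
  assume notsub: "\<not> K \<subseteq> derived H (carrier H)"
  let ?D = "derived H (carrier H)"
  interpret D: normal ?D H by (rule H.derived_self_is_normal)
  interpret Kn: normal K H by (rule K_normal)
  let ?Q = "H Mod ?D"
  interpret Q: comm_group ?Q by (rule H.derived_quot_is_comm_group)
  have pi: "(#>\<^bsub>H\<^esub>) ?D \<in> hom H ?Q" by (rule D.r_coset_hom_Mod)
  interpret pi: group_hom H ?Q "(#>\<^bsub>H\<^esub>) ?D" by unfold_locales (rule pi)
  have pi_one: "?D #>\<^bsub>H\<^esub> h = \<one>\<^bsub>?Q\<^esub> \<longleftrightarrow> h \<in> ?D" if "h \<in> carrier H" for h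
  proof -
    have "\<one>\<^bsub>?Q\<^esub> = ?D" unfolding FactGroup_def by simp
    then show ?thesis using that H.coset_join1[of ?D h] H.coset_join2[of h ?D] D.subgroup_axioms by metis
  qed
  define P where "P = (\<lambda>m::nat. m > 0 \<and> (\<forall>k\<in>K. k [^]\<^bsub>H\<^esub> m \<in> ?D))"
  define m where "m = (LEAST m. P m)"
  have N0: "M * N > 0" unfolding N_def using M_pos prime_gt_0_nat[OF p] by simp
  have "P (M * N)" unfolding P_def using K_exponent N0 by simp
  then have Pm: "P m" unfolding m_def by (rule LeastI)
  have least: "\<not> P m'" if "m' < m" for m' using not_less_Least that unfolding m_def by blast
  have "m \<noteq> 1"
  proof
    assume "m = 1"
    then have "k \<in> ?D" if k: "k \<in> K" for k using Pm k K_H[OF k] unfolding P_def by auto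
    then show False using notsub by blast
  qed
  then obtain r where r: "Factorial_Ring.prime r" "r dvd m" using prime_factor_nat by blast
  then obtain m' where m': "m = m' * r" by (metis dvd_def mult.commute)
  have "m > 0" using Pm unfolding P_def by blast
  then have "m' > 0" using m' by simp
  then have "m' < m" using m' prime_gt_1_nat[OF r(1)] by simp
  then obtain x where x: "x \<in> K" "x [^]\<^bsub>H\<^esub> m' \<notin> ?D"
    using least[of m'] \<open>m' > 0\<close> unfolding P_def by blast
  have xH: "x \<in> carrier H" using x K_H by blast
  \<comment> \<open>The order of \<open>z\<close> is finite and divisible by \<open>r\<close>, so a power \<open>w\<close> of \<open>z\<close> has order \<open>r\<close>.\<close>
  define z where "z = x [^]\<^bsub>H\<^esub> m'"
  have z: "z \<in> carrier H" "z \<notin> ?D" "z [^]\<^bsub>H\<^esub> r \<in> ?D"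
    using x xH Pm unfolding z_def P_def m' by (auto simp: H.nat_pow_pow)
  have "z [^]\<^bsub>H\<^esub> (M * N) = (x [^]\<^bsub>H\<^esub> (M * N)) [^]\<^bsub>H\<^esub> m'" unfolding z_def using xH by (simp add: H.nat_pow_pow mult.commute)
  then have "z [^]\<^bsub>H\<^esub> (M * N) = \<one>\<^bsub>H\<^esub>" using K_exponent[OF x(1)] by simp
  then have "H.ord z dvd M * N" using H.pow_eq_id z by blast
  then have oz: "H.ord z > 0" using N0 by (metis dvd_0_left_iff gr0I less_numeral_extra(3))
  have "r dvd H.ord z"
  proof (rule ccontr)
    assume "\<not> r dvd H.ord z"
    then have "coprime r (H.ord z)" using r(1) by (simp add: prime_imp_coprime)
    then obtain j where j: "[r * j = 1] (mod H.ord z)" using cong_solve_coprime_nat by auto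
    then have "z [^]\<^bsub>H\<^esub> (r * j) = z [^]\<^bsub>H\<^esub> (1::nat)" using H.pow_eq_iff_cong_ord[OF z(1)] by blast
    then have "z = (z [^]\<^bsub>H\<^esub> r) [^]\<^bsub>H\<^esub> j" using z by (simp add: H.nat_pow_pow)
    moreover have "(z [^]\<^bsub>H\<^esub> r) [^]\<^bsub>H\<^esub> j \<in> ?D" using z(3) by (induction j) auto
    ultimately show False using z by simp
  qed
  then obtain o' where o': "H.ord z = o' * r" by (metis dvd_def mult.commute)
  define w where "w = z [^]\<^bsub>H\<^esub> o'"
  have w: "w \<in> carrier H" "w [^]\<^bsub>H\<^esub> r = \<one>\<^bsub>H\<^esub>"
    unfolding w_def using z H.pow_ord_eq_1[OF z(1)] by (auto simp: H.nat_pow_pow o'[symmetric])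
  have w1: "w \<noteq> \<one>\<^bsub>H\<^esub>"
  proof
    assume "w = \<one>\<^bsub>H\<^esub>"
    then have "H.ord z dvd o'" using H.pow_eq_id[OF z(1), of o'] unfolding w_def by simp
    moreover have "o' > 0" using oz o' by (cases o') auto
    ultimately have "o' * r \<le> o'" using o' dvd_imp_le by metis
    then show False using \<open>o' > 0\<close> prime_gt_1_nat[OF r(1)] by simp
  qed
  \<comment> \<open>The kernel of \<open>g\<close> contains all commutators and \<open>r\<close>-th powers but not \<open>x\<close>.\<close>
  define g where "g = (\<lambda>h. (?D #>\<^bsub>H\<^esub> (h \<cdot>\<^sub>H hi (\<epsilon> h))) [^]\<^bsub>?Q\<^esub> m')"
  have hK: "h \<cdot>\<^sub>H hi (\<epsilon> h) \<in> K" if hH: "h \<in> carrier H" for h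
  proof -
    obtain i where i: "\<epsilon> h = c [^]\<^bsub>H\<^esub> (i::nat)" using eps_pow[OF hH] by blast
    have "\<epsilon> (\<epsilon> h) = \<epsilon> h" unfolding i using eps.hom_nat_pow[OF c(1), of i] eps_c by simp
    then show ?thesis unfolding K_def using hH by simp
  qed
  have g_hom: "g \<in> hom H ?Q"
  proof (rule homI)
    fix h assume "h \<in> carrier H" then show "g h \<in> carrier ?Q"
      unfolding g_def using hK K_H by (intro Q.nat_pow_closed pi.hom_closed) blast
  next
    fix h k assume hk: "h \<in> carrier H" "k \<in> carrier H"
    let ?p = "\<lambda>h. ?D #>\<^bsub>H\<^esub> h"
    have c1: "?p h \<in> carrier ?Q" "?p k \<in> carrier ?Q" "?p (\<epsilon> h) \<in> carrier ?Q" "?p (\<epsilon> k) \<in> carrier ?Q"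
      using hk by (auto intro!: pi.hom_closed)
    have e: "?p (h \<cdot>\<^sub>H hi (\<epsilon> h)) = ?p h \<otimes>\<^bsub>?Q\<^esub> inv\<^bsub>?Q\<^esub> (?p (\<epsilon> h))" if "h \<in> carrier H" for h
      using that pi.hom_mult[of h "hi (\<epsilon> h)"] pi.hom_inv[of "\<epsilon> h"] by simp
    have "?p (h \<cdot>\<^sub>H k \<cdot>\<^sub>H hi (\<epsilon> (h \<cdot>\<^sub>H k))) = (?p h \<otimes>\<^bsub>?Q\<^esub> ?p k) \<otimes>\<^bsub>?Q\<^esub> inv\<^bsub>?Q\<^esub> (?p (\<epsilon> h) \<otimes>\<^bsub>?Q\<^esub> ?p (\<epsilon> k))"
      using e[of "h \<cdot>\<^sub>H k"] hk pi.hom_mult[of h k] pi.hom_mult[of "\<epsilon> h" "\<epsilon> k"] by simp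
    also have "\<dots> = ?p (h \<cdot>\<^sub>H hi (\<epsilon> h)) \<otimes>\<^bsub>?Q\<^esub> ?p (k \<cdot>\<^sub>H hi (\<epsilon> k))"
      unfolding e[OF hk(1)] e[OF hk(2)] using c1 by (simp only: Q.inv_mult Q.m_ac Q.m_closed Q.inv_closed)
    finally show "g (h \<cdot>\<^sub>H k) = g h \<otimes>\<^bsub>?Q\<^esub> g k"
      unfolding g_def using hk by (simp only: Q.nat_pow_distrib pi.hom_closed H.m_closed eps.hom_closed H.inv_closed)
  qed
  interpret g: group_hom H ?Q g by unfold_locales (rule g_hom)
  define M0 where "M0 = {h \<in> carrier H. g h = \<one>\<^bsub>?Q\<^esub>}"
  have M0: "subgroup M0 H" using g.subgroup_kernel unfolding kernel_def M0_def .
  have "x \<notin> M0"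
  proof
    assume "x \<in> M0"
    moreover have "x \<cdot>\<^sub>H hi (\<epsilon> x) = x" using x xH unfolding K_def by simp
    ultimately have "(?D #>\<^bsub>H\<^esub> x) [^]\<^bsub>?Q\<^esub> m' = \<one>\<^bsub>?Q\<^esub>"
      unfolding M0_def g_def by (simp only: mem_Collect_eq)
    then have "?D #>\<^bsub>H\<^esub> z = \<one>\<^bsub>?Q\<^esub>" unfolding z_def using pi.hom_nat_pow[OF xH, of m'] by simp
    then show False using pi_one z by blast
  qed
  have "\<exists>f\<in>hom H H. f x = w \<and> (\<forall>a\<in>carrier H. \<exists>i::nat. f a = w [^]\<^bsub>H\<^esub> i)"
  proof (rule H.exists_hom_of_prime_quotient[OF r(1) M0 _ _ xH \<open>x \<notin> M0\<close> w])
    fix a d assume ad: "a \<in> carrier H" "d \<in> carrier H"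
    have gc: "g a \<in> carrier ?Q" "g d \<in> carrier ?Q" using ad by (auto intro!: g.hom_closed)
    have "g (a \<cdot>\<^sub>H d \<cdot>\<^sub>H hi a \<cdot>\<^sub>H hi d) = g a \<otimes>\<^bsub>?Q\<^esub> g d \<otimes>\<^bsub>?Q\<^esub> inv\<^bsub>?Q\<^esub> g a \<otimes>\<^bsub>?Q\<^esub> inv\<^bsub>?Q\<^esub> g d"
      using ad by (simp only: g.hom_mult g.hom_inv H.m_closed H.inv_closed)
    also have "\<dots> = \<one>\<^bsub>?Q\<^esub>" by (rule Q.commutator_one[OF gc])
    finally show "a \<cdot>\<^sub>H d \<cdot>\<^sub>H hi a \<cdot>\<^sub>H hi d \<in> M0" unfolding M0_def using ad by simp
  next
    fix a assume a: "a \<in> carrier H"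
    let ?k = "a \<cdot>\<^sub>H hi (\<epsilon> a)"
    have kc: "?D #>\<^bsub>H\<^esub> ?k \<in> carrier ?Q" using hK[OF a] K_H by (intro pi.hom_closed) auto
    have "g (a [^]\<^bsub>H\<^esub> r) = g a [^]\<^bsub>?Q\<^esub> r" by (rule g.hom_nat_pow[OF a])
    also have "\<dots> = (?D #>\<^bsub>H\<^esub> ?k) [^]\<^bsub>?Q\<^esub> m" unfolding g_def m' by (rule Q.nat_pow_pow[OF kc])
    also have "\<dots> = ?D #>\<^bsub>H\<^esub> (?k [^]\<^bsub>H\<^esub> m)" using pi.hom_nat_pow[of ?k m] hK[OF a] K_H by metis
    also have "\<dots> = \<one>\<^bsub>?Q\<^esub>"
    proof -
      have "?k [^]\<^bsub>H\<^esub> m \<in> ?D" using Pm hK[OF a] unfolding P_def by blast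
      moreover have "?k [^]\<^bsub>H\<^esub> m \<in> carrier H" using hK[OF a] K_H by simp
      ultimately show ?thesis using pi_one by blast
    qed
    finally show "a [^]\<^bsub>H\<^esub> r \<in> M0" unfolding M0_def using a by simp
  qed
  then obtain f where f: "f \<in> hom H H" "f x = w" "\<And>a. a \<in> carrier H \<Longrightarrow> \<exists>i::nat. f a = w [^]\<^bsub>H\<^esub> i" by blast
  have "f x = \<one>\<^bsub>H\<^esub>"
  proof (rule commuting_image_kills[OF f(1)])
    fix h k assume "h \<in> carrier H" "k \<in> carrier H"
    then obtain i j where "f h = w [^]\<^bsub>H\<^esub> (i::nat)" "f k = w [^]\<^bsub>H\<^esub> (j::nat)" using f(3) by metis
    then show "f h \<cdot>\<^sub>H f k = f k \<cdot>\<^sub>H f h" using w by (simp add: H.nat_pow_mult add.commute)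
  next
    show "x \<in> carrier H" "\<epsilon> x = \<one>\<^bsub>H\<^esub>" using x(1) unfolding K_def by simp_all
  qed
  then show False using f(2) w1 by simp
qed

lemma lam_K: "k \<in> K \<Longrightarrow> \<Lambda> k = \<one>"
proof -
  assume "k \<in> K"
  let ?S = "{h \<in> carrier H. \<Lambda> h = \<one>}"
  have S: "subgroup ?S H"
    by (rule H.subgroupI) (auto simp: lam_mult lam_inv_one intro: exI[of _ "\<one>\<^bsub>H\<^esub>"])
  have "derived H (carrier H) \<subseteq> ?S"
    unfolding derived_def
  proof (rule H.generate_subgroup_incl[OF _ S], rule subsetI)
    fix x assume "x \<in> derived_set H (carrier H)"
    then obtain h k where hk: "h \<in> carrier H" "k \<in> carrier H" "x = h \<cdot>\<^sub>H k \<cdot>\<^sub>H hi h \<cdot>\<^sub>H hi k" by auto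
    have "\<Lambda> (h \<cdot>\<^sub>H k \<cdot>\<^sub>H hi h \<cdot>\<^sub>H hi k) = (\<Lambda> h \<otimes> \<Lambda> (hi h)) \<otimes> (\<Lambda> k \<otimes> \<Lambda> (hi k))"
      using hk by (simp add: lam_mult m_ac)
    then show "x \<in> ?S" using hk lam_inv by simp
  qed
  then show ?thesis using K_derived \<open>k \<in> K\<close> by blast
qed

text \<open>
  Commutators with \<open>c\<close> lie in \<open>K\<close>, and forming them multiplies \<open>t\<close> by \<open>\<one> \<ominus> \<Lambda> c\<close>.
\<close>

lemma t_K_surj:
  assumes x: "x \<in> carrier F"
  shows "\<exists>k\<in>K. t k = x"
proof -
  have z: "\<one> \<ominus> \<Lambda> c \<in> carrier F" "\<one> \<ominus> \<Lambda> c \<noteq> \<zero>" using c by (simp, metis r_right_minus_eq one_closed lam_closed)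
  define y where "y = m_inv F (\<one> \<ominus> \<Lambda> c) \<otimes> x"
  have y: "y \<in> carrier F" "(\<one> \<ominus> \<Lambda> c) \<otimes> y = x" unfolding y_def using unit_inv[OF z] x z by auto
  define h where "h = s y"
  have h: "h \<in> carrier H" "t h = y" "\<Lambda> h = \<one>" unfolding h_def using s y by auto
  let ?k = "h \<cdot>\<^sub>H c \<cdot>\<^sub>H hi h \<cdot>\<^sub>H hi c"
  obtain i where i: "\<epsilon> h = c [^]\<^bsub>H\<^esub> (i::nat)" using eps_pow h by blast
  have "\<epsilon> ?k = c [^]\<^bsub>H\<^esub> i \<cdot>\<^sub>H c \<cdot>\<^sub>H hi (c [^]\<^bsub>H\<^esub> i) \<cdot>\<^sub>H hi c" using h c i eps_c by simp
  also have "c [^]\<^bsub>H\<^esub> i \<cdot>\<^sub>H c = c \<cdot>\<^sub>H c [^]\<^bsub>H\<^esub> i" using c H.pow_commute by blast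
  finally have "\<epsilon> ?k = \<one>\<^bsub>H\<^esub>" using c by (simp add: H.group_normalize)
  then have "?k \<in> K" unfolding K_def using h c by simp
  moreover have "t ?k = y \<oplus> \<ominus> (\<Lambda> c \<otimes> y)"
    using h c y(1) lam_inv_one[OF h(1,3)] by (simp add: t_mult t_inv lam_mult r_minus)
  moreover have "y \<oplus> \<ominus> (\<Lambda> c \<otimes> y) = (\<one> \<ominus> \<Lambda> c) \<otimes> y" using y(1) lam_closed[OF c(1)] by algebra
  ultimately show ?thesis using y by metis
qed

definition Z where "Z = {z \<in> carrier H. t z = \<zero> \<and> \<Lambda> z = \<one>}"

lemma Z_comm_group: "comm_group (H\<lparr>carrier := Z\<rparr>)"
proof -
  have "subgroup Z H" unfolding Z_def
    by (rule H.subgroupI) (auto simp: lam_mult lam_inv_one t_mult t_inv intro: exI[of _ "\<one>\<^bsub>H\<^esub>"])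
  then interpret Z: group "H\<lparr>carrier := Z\<rparr>" by (rule H.subgroup_imp_group)
  show ?thesis by (rule Z.group_comm_groupI) (auto simp: Z_def central)
qed

definition cm where "cm k l = k \<cdot>\<^sub>H l \<cdot>\<^sub>H hi k \<cdot>\<^sub>H hi l"

lemma cm_Z: "k \<in> carrier H \<Longrightarrow> l \<in> carrier H \<Longrightarrow> \<Lambda> k = \<one> \<Longrightarrow> \<Lambda> l = \<one> \<Longrightarrow> cm k l \<in> Z"
proof -
  assume kl: "k \<in> carrier H" "l \<in> carrier H" "\<Lambda> k = \<one>" "\<Lambda> l = \<one>"
  have "t (cm k l) = t k \<oplus> t l \<oplus> \<ominus> t k \<oplus> \<ominus> t l" "\<Lambda> (cm k l) = \<one>"
    unfolding cm_def using kl lam_inv_one[of k] lam_inv_one[of l] by (simp_all add: t_mult lam_mult t_inv)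
  moreover have "t k \<oplus> t l \<oplus> \<ominus> t k \<oplus> \<ominus> t l = \<zero>" using t_closed[OF kl(1)] t_closed[OF kl(2)] by algebra
  ultimately show ?thesis unfolding Z_def using kl by (simp add: cm_def)
qed

lemma cm_mult_left:
  assumes "k \<in> carrier H" "k' \<in> carrier H" "l \<in> carrier H" "\<Lambda> k = \<one>" "\<Lambda> k' = \<one>" "\<Lambda> l = \<one>"
  shows "cm (k \<cdot>\<^sub>H k') l = cm k l \<cdot>\<^sub>H cm k' l"
proof -
  have z: "cm k' l \<in> carrier H" "cm k l \<in> carrier H" using cm_Z assms unfolding Z_def by auto
  have "cm (k \<cdot>\<^sub>H k') l = k \<cdot>\<^sub>H cm k' l \<cdot>\<^sub>H (l \<cdot>\<^sub>H hi k \<cdot>\<^sub>H hi l)"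
    unfolding cm_def using assms by (simp add: H.group_normalize)
  also have "k \<cdot>\<^sub>H cm k' l = cm k' l \<cdot>\<^sub>H k" using central[of "cm k' l" k] cm_Z[of k' l] assms unfolding Z_def by auto
  also have "cm k' l \<cdot>\<^sub>H k \<cdot>\<^sub>H (l \<cdot>\<^sub>H hi k \<cdot>\<^sub>H hi l) = cm k' l \<cdot>\<^sub>H cm k l"
    unfolding cm_def[of k l] using assms z by (simp add: H.m_assoc)
  also have "\<dots> = cm k l \<cdot>\<^sub>H cm k' l" using central[of "cm k' l" "cm k l"] cm_Z[of k' l] assms z unfolding Z_def by auto
  finally show ?thesis .
qed

lemma cm_inv: "k \<in> carrier H \<Longrightarrow> l \<in> carrier H \<Longrightarrow> cm l k = hi (cm k l)"
  unfolding cm_def by (simp add: H.group_normalize)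

lemma cm_cong:
  assumes "k \<in> carrier H" "k' \<in> carrier H" "l \<in> carrier H" "l' \<in> carrier H"
    "\<Lambda> k = \<one>" "\<Lambda> k' = \<one>" "\<Lambda> l = \<one>" "\<Lambda> l' = \<one>" "t k = t k'" "t l = t l'"
  shows "cm k l = cm k' l'"
proof -
  have left: "cm k l = cm k' l" if "k \<in> carrier H" "k' \<in> carrier H" "l \<in> carrier H"
    "\<Lambda> k = \<one>" "\<Lambda> k' = \<one>" "\<Lambda> l = \<one>" "t k = t k'" for k k' l
  proof -
    define z where "z = hi k' \<cdot>\<^sub>H k"
    have z: "z \<in> carrier H" "t z = \<zero>" "\<Lambda> z = \<one>"
      unfolding z_def using that same_t[of k' k] lam_inv_one[of k'] by (auto simp: lam_mult)
    have k: "k = k' \<cdot>\<^sub>H z" unfolding z_def using that by (simp add: H.group_normalize)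
    have "cm z l = \<one>\<^bsub>H\<^esub>" unfolding cm_def central[OF z(1) that(3) z(2,3)] using z that by (simp add: H.group_normalize)
    then show ?thesis unfolding k using cm_mult_left[of k' z l] that z cm_Z[of k' l] unfolding Z_def by simp
  qed
  have "cm k l = hi (cm l k')" using left[of k k' l] cm_inv[of l k'] assms by simp
  also have "\<dots> = hi (cm l' k')" using left[of l l' k'] assms by simp
  also have "\<dots> = cm k' l'" using cm_inv[of l' k'] assms by simp
  finally show ?thesis .
qed

lemma cm_conj: "k \<in> carrier H \<Longrightarrow> l \<in> carrier H \<Longrightarrow> g \<in> carrier H \<Longrightarrow>
   cm (g \<cdot>\<^sub>H k \<cdot>\<^sub>H hi g) (g \<cdot>\<^sub>H l \<cdot>\<^sub>H hi g) = g \<cdot>\<^sub>H cm k l \<cdot>\<^sub>H hi g"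
  unfolding cm_def by (simp add: H.group_normalize)

text \<open>
  Commutators of elements with trivial linear part are central and depend only on the translation
  parts, so they define a biadditive map on \<open>F\<close>.
\<close>

definition form where "form x y = cm (s x) (s y)"

lemma coprime_q: "\<not> q dvd j \<Longrightarrow> coprime j (q ^ k)"
  using prime_imp_coprime[OF q, of j] by (simp add: coprime_commute[of j])

lemma lam_c_zeta: "\<exists>i::nat. \<Lambda> c = \<zeta> [^] i \<and> \<not> q dvd i"
  using roots_of_unity[of "\<Lambda> c"] c zeta_pow_one by auto

text \<open>
  Conjugation by \<open>c\<close> gives invariance under \<open>\<Lambda> c\<close>. This is a power of \<open>\<zeta>\<close> of the same order \<open>q\<close>, so
  \<open>\<zeta>\<close> is a power of it.
\<close>

lemma form_zeta:
  assumes xy: "x \<in> carrier F" "y \<in> carrier F"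
  shows "form (\<zeta> \<otimes> x) (\<zeta> \<otimes> y) = form x y"
proof -
  have 1: "form (\<Lambda> c \<otimes> x) (\<Lambda> c \<otimes> y) = form x y" if xy: "x \<in> carrier F" "y \<in> carrier F" for x y
  proof -
    define u where "u x = c \<cdot>\<^sub>H s x \<cdot>\<^sub>H hi c" for x
    have sx: "u x \<in> carrier H" "t (u x) = \<Lambda> c \<otimes> x" "\<Lambda> (u x) = \<one>" if "x \<in> carrier F" for x
      unfolding u_def using s[OF that] c that lam_inv[of c] by (auto simp: t_mult t_inv lam_mult)
    have "form (\<Lambda> c \<otimes> x) (\<Lambda> c \<otimes> y) = cm (u x) (u y)"
      unfolding form_def by (rule cm_cong) (use s sx xy c in auto)
    also have "\<dots> = c \<cdot>\<^sub>H cm (s x) (s y) \<cdot>\<^sub>H hi c" unfolding u_def using cm_conj s xy c by simp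
    also have "c \<cdot>\<^sub>H cm (s x) (s y) = cm (s x) (s y) \<cdot>\<^sub>H c"
      using central[of "cm (s x) (s y)" c] cm_Z[of "s x" "s y"] s xy c unfolding Z_def by auto
    finally show ?thesis unfolding form_def using cm_Z[of "s x" "s y"] s xy c unfolding Z_def by (simp add: H.group_normalize)
  qed
  have 2: "form (\<Lambda> c [^] j \<otimes> x) (\<Lambda> c [^] j \<otimes> y) = form x y" for j :: nat
  proof (induction j)
    case (Suc j)
    have "\<Lambda> c [^] Suc j \<otimes> x = \<Lambda> c \<otimes> (\<Lambda> c [^] j \<otimes> x)" if "x \<in> carrier F" for x using that c by (simp add: m_ac)
    then show ?case using 1[of "\<Lambda> c [^] j \<otimes> x" "\<Lambda> c [^] j \<otimes> y"] Suc xy c by simp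
  qed (use xy in simp)
  obtain i where i: "\<Lambda> c = \<zeta> [^] (i::nat)" "\<not> q dvd i" using lam_c_zeta by blast
  have "coprime i q" using coprime_q[of i 1] i by simp
  then obtain j where "[i * j = 1] (mod q)" using cong_solve_coprime_nat by auto
  then have "\<zeta> [^] (i * j) = \<zeta> [^] (1::nat)" using zeta_pow by blast
  then have "\<Lambda> c [^] j = \<zeta>" unfolding i using zeta by (simp add: nat_pow_pow)
  then show ?thesis using 2[of j] by simp
qed

lemma K_abelian:
  assumes n: "odd n" and kl: "k \<in> K" "l \<in> K"
  shows "k \<cdot>\<^sub>H l = l \<cdot>\<^sub>H k"
proof -
  have inZ: "form x y \<in> Z" if "x \<in> carrier F" "y \<in> carrier F" for x y
    unfolding form_def using that s by (intro cm_Z) auto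
  have left: "form (x \<oplus> x') y = form x y \<cdot>\<^sub>H form x' y"
    if "x \<in> carrier F" "x' \<in> carrier F" "y \<in> carrier F" for x x' y
  proof -
    have "form (x \<oplus> x') y = cm (s x \<cdot>\<^sub>H s x') (s y)"
      unfolding form_def by (rule cm_cong) (use s that in \<open>auto simp: t_mult lam_mult\<close>)
    then show ?thesis unfolding form_def using cm_mult_left s that by simp
  qed
  have flip: "form y x = hi (form x y)" if "x \<in> carrier F" "y \<in> carrier F" for x y
    unfolding form_def by (rule cm_inv[OF s(1)[OF that(1)] s(1)[OF that(2)]])
  have right: "form x (y \<oplus> y') = form x y \<cdot>\<^sub>H form x y'"
    if xy: "x \<in> carrier F" "y \<in> carrier F" "y' \<in> carrier F" for x y y'
  proof -
    have z: "form y x \<in> Z" "form y' x \<in> Z" using inZ xy by auto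
    have "form x (y \<oplus> y') = hi (form y x \<cdot>\<^sub>H form y' x)" using flip[of "y \<oplus> y'" x] left[OF xy(2,3,1)] xy by simp
    also have "\<dots> = hi (form y' x \<cdot>\<^sub>H form y x)" using z central unfolding Z_def by simp
    also have "\<dots> = hi (form y x) \<cdot>\<^sub>H hi (form y' x)" using z unfolding Z_def by (simp add: H.inv_mult_group)
    finally show ?thesis using flip[of y x] flip[of y' x] xy by simp
  qed
  have "form (t k) (t l) = \<one>\<^bsub>H\<lparr>carrier := Z\<rparr>\<^esub>"
  proof (rule odd_form_trivial[OF n Z_comm_group])
    show "form x x = \<one>\<^bsub>H\<lparr>carrier := Z\<rparr>\<^esub>" if "x \<in> carrier F" for x
      unfolding form_def cm_def using s that by (simp add: H.group_normalize)
  qed (use inZ left right form_zeta kl K_H in auto)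
  moreover have "form (t k) (t l) = cm k l"
    unfolding form_def by (rule cm_cong) (use s kl K_H lam_K in auto)
  ultimately have cm1: "cm k l = \<one>\<^bsub>H\<^esub>" by simp
  have c: "k \<in> carrier H" "l \<in> carrier H" using kl K_H by auto
  have "k \<cdot>\<^sub>H l = cm k l \<cdot>\<^sub>H (l \<cdot>\<^sub>H k)" unfolding cm_def using c by (simp add: H.group_normalize)
  then show ?thesis using cm1 c by simp
qed

lemma eps_decomp: "h \<in> carrier H \<Longrightarrow> \<exists>k\<in>K. \<exists>i::nat. h = k \<cdot>\<^sub>H c [^]\<^bsub>H\<^esub> i \<and> \<epsilon> h = c [^]\<^bsub>H\<^esub> i"
proof -
  assume h: "h \<in> carrier H"
  obtain i where i: "\<epsilon> h = c [^]\<^bsub>H\<^esub> (i::nat)" using eps_pow h by blast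
  have "\<epsilon> (\<epsilon> h) = \<epsilon> h" unfolding i using eps.hom_nat_pow[OF c(1), of i] eps_c by simp
  then have "h \<cdot>\<^sub>H hi (\<epsilon> h) \<in> K" unfolding K_def using h by simp
  moreover have "h = (h \<cdot>\<^sub>H hi (\<epsilon> h)) \<cdot>\<^sub>H c [^]\<^bsub>H\<^esub> i" unfolding i[symmetric] using h by (simp add: H.group_normalize)
  ultimately show ?thesis using i by blast
qed

text \<open>
  As \<open>K\<close> is abelian, \<open>k = [l, c]\<close> for some \<open>l\<close> in \<open>K\<close>, and \<open>t k = (\<one> \<ominus> \<Lambda> c) \<otimes> t l\<close>. If this vanishes, \<open>l\<close> is
  central and the commutator is trivial.
\<close>

lemma t_K_inj:
  assumes n: "odd n" and k: "k \<in> K" "t k = \<zero>"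
  shows "k = \<one>\<^bsub>H\<^esub>"
proof -
  have "derived H (carrier H) \<subseteq> {k \<cdot>\<^sub>H c \<cdot>\<^sub>H hi k \<cdot>\<^sub>H hi c |k. k \<in> K}"
    using K_abelian[OF n] eps_decomp
    by (intro H.derived_of_cyclic_by_abelian[OF K_normal _ c(1)]) blast+
  then obtain l where l: "l \<in> K" "k = l \<cdot>\<^sub>H c \<cdot>\<^sub>H hi l \<cdot>\<^sub>H hi c" using K_derived k by blast
  have lH: "l \<in> carrier H" "\<Lambda> l = \<one>" "\<Lambda> (hi l) = \<one>" using l K_H lam_K lam_inv_one by auto
  have "t k = t l \<oplus> \<ominus> (\<Lambda> c \<otimes> t l)" unfolding l(2) using lH c by (simp add: t_mult t_inv lam_mult r_minus)
  also have "\<dots> = (\<one> \<ominus> \<Lambda> c) \<otimes> t l" using lam_closed[OF c(1)] t_closed[OF lH(1)] by algebra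
  finally have "(\<one> \<ominus> \<Lambda> c) \<otimes> t l = \<zero>" using k by simp
  moreover have "\<one> \<ominus> \<Lambda> c \<noteq> \<zero>" using c by (metis r_right_minus_eq one_closed lam_closed)
  ultimately have "t l = \<zero>" using lH c integral_iff[of "\<one> \<ominus> \<Lambda> c" "t l"] by auto
  then have "l \<cdot>\<^sub>H c = c \<cdot>\<^sub>H l" using central lH c by blast
  then show ?thesis unfolding l(2) using lH c by (simp add: H.group_normalize)
qed

text \<open>
  The element \<open>k \<cdot>\<^sub>H c [^] i\<close> is sent to \<open>t k \<cdot>\<^sub>G b [^] (j * i)\<close>, where \<open>j\<close> is chosen so that \<open>b [^] j\<close> acts on \<open>F\<close>
  as \<open>\<Lambda> c\<close>.
\<close>

lemma iso_of_affine_coordinates: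
  assumes n: "odd n"
  shows "G \<cong> H"
proof -
  obtain j where j: "\<Lambda> c = \<zeta> [^] (j::nat)" "\<not> q dvd j" using lam_c_zeta by blast
  define ix where "ix h = (SOME i::nat. \<epsilon> h = c [^]\<^bsub>H\<^esub> i)" for h
  have ix: "\<epsilon> h = c [^]\<^bsub>H\<^esub> (ix h)" if "h \<in> carrier H" for h
    unfolding ix_def using someI_ex[OF eps_pow[OF that]] .
  define \<Psi> where "\<Psi> h = t h \<cdot>\<^sub>G b [^]\<^bsub>G\<^esub> (j * ix h)" for h
  have ceq: "c [^]\<^bsub>H\<^esub> (i::nat) = c [^]\<^bsub>H\<^esub> i' \<longleftrightarrow> [i = i'] (mod q ^ v)" for i i'
    using H.pow_eq_iff_cong_ord[OF c(1)] c(2) by simp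
  have bj: "b [^]\<^bsub>G\<^esub> (j * i) = b [^]\<^bsub>G\<^esub> (j * i') \<longleftrightarrow> c [^]\<^bsub>H\<^esub> (i::nat) = c [^]\<^bsub>H\<^esub> i'" for i i'
  proof -
    have "coprime j (q ^ v)" using j(2) by (rule coprime_q)
    then show ?thesis unfolding bpow_eq ceq using cong_mult_lcancel_nat by blast
  qed
  have lam: "\<Lambda> h = \<zeta> [^] (j * ix h)" if h: "h \<in> carrier H" for h
  proof -
    obtain k i where ki: "k \<in> K" "h = k \<cdot>\<^sub>H c [^]\<^bsub>H\<^esub> (i::nat)" "\<epsilon> h = c [^]\<^bsub>H\<^esub> i" using eps_decomp h by blast
    have "b [^]\<^bsub>G\<^esub> (j * i) = b [^]\<^bsub>G\<^esub> (j * ix h)" using bj ki(3) ix[OF h] by simp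
    then have "\<zeta> [^] (j * i) = \<zeta> [^] (j * ix h)" using chi_b by metis
    moreover have "\<Lambda> h = \<zeta> [^] (j * i)" unfolding ki(2) using ki(1) K_H lam_K c j zeta by (simp add: lam_mult lam_pow nat_pow_pow)
    ultimately show ?thesis by simp
  qed
  have hom: "\<Psi> \<in> hom H G"
  proof (rule homI)
    fix h assume "h \<in> carrier H" then show "\<Psi> h \<in> carrier G" unfolding \<Psi>_def using b by simp
  next
    fix h k assume hk: "h \<in> carrier H" "k \<in> carrier H"
    have "c [^]\<^bsub>H\<^esub> ix (h \<cdot>\<^sub>H k) = c [^]\<^bsub>H\<^esub> (ix h + ix k)"
      using ix[of "h \<cdot>\<^sub>H k", symmetric] ix[OF hk(1)] ix[OF hk(2)] hk c
      by (simp add: H.nat_pow_mult[symmetric])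
    then have e: "b [^]\<^bsub>G\<^esub> (j * ix (h \<cdot>\<^sub>H k)) = b [^]\<^bsub>G\<^esub> (j * ix h + j * ix k)"
      using bj[of "ix (h \<cdot>\<^sub>H k)" "ix h + ix k"] by (simp add: distrib_left)
    show "\<Psi> (h \<cdot>\<^sub>H k) = \<Psi> h \<cdot>\<^sub>G \<Psi> k"
      unfolding \<Psi>_def e mult_dec[OF t_closed[OF hk(1)] t_closed[OF hk(2)]] t_mult[OF hk] lam[OF hk(1)] ..
  qed
  interpret Psi: group_hom H G \<Psi> by unfold_locales (rule hom)
  have "inj_on \<Psi> (carrier H)"
    unfolding Psi.inj_on_one_iff
  proof (intro allI impI)
    fix h assume h: "h \<in> carrier H" "\<Psi> h = \<one>\<^bsub>G\<^esub>"
    then have *: "t h \<cdot>\<^sub>G b [^]\<^bsub>G\<^esub> (j * ix h) = \<zero> \<cdot>\<^sub>G b [^]\<^bsub>G\<^esub> (j * 0)" unfolding \<Psi>_def using zero_eq by simp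
    have 1: "b [^]\<^bsub>G\<^esub> (j * ix h) = b [^]\<^bsub>G\<^esub> (j * 0)"
      by (rule dec_unique(1)[OF t_closed[OF h(1)] zero_closed *])
    have 2: "t h = \<zero>" by (rule dec_unique(2)[OF t_closed[OF h(1)] zero_closed *])
    have "c [^]\<^bsub>H\<^esub> ix h = c [^]\<^bsub>H\<^esub> (0::nat)" using bj 1 by blast
    then have "h \<in> K" using ix[OF h(1)] h(1) unfolding K_def by simp
    then show "h = \<one>\<^bsub>H\<^esub>" using t_K_inj[OF n _ 2] by blast
  qed
  moreover have "\<Psi> ` carrier H = carrier G"
  proof (intro equalityI subsetI)
    fix g assume "g \<in> carrier G"
    then obtain x i where g: "x \<in> carrier F" "g = x \<cdot>\<^sub>G b [^]\<^bsub>G\<^esub> (i::nat)" using decE by blast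
    obtain k where k: "k \<in> K" "t k = x" using t_K_surj g by blast
    have kH: "k \<in> carrier H" using k K_H by blast
    have "coprime j (q ^ v)" using j(2) by (rule coprime_q)
    then obtain m where "[j * m = 1] (mod q ^ v)" using cong_solve_coprime_nat[of j "q ^ v"] by (metis One_nat_def)
    then have "[j * m * i = 1 * i] (mod q ^ v)" by (intro cong_scalar_right)
    then have bi: "b [^]\<^bsub>G\<^esub> (j * (m * i)) = b [^]\<^bsub>G\<^esub> i" unfolding bpow_eq by (simp add: mult.assoc)
    let ?h = "k \<cdot>\<^sub>H c [^]\<^bsub>H\<^esub> (m * i)"
    have hH: "?h \<in> carrier H" using kH c by simp
    have "\<epsilon> ?h = c [^]\<^bsub>H\<^esub> (m * i)" using k kH c eps.hom_nat_pow[OF c(1)] eps_c unfolding K_def by simp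
    then have "b [^]\<^bsub>G\<^esub> (j * ix ?h) = b [^]\<^bsub>G\<^esub> i" using bj[of "ix ?h" "m * i"] ix[OF hH] bi by simp
    moreover have "t ?h = x" using kH k g(1) c t_pow_zero[OF c(1,3)] by (simp add: t_mult)
    ultimately have "\<Psi> ?h = g" unfolding \<Psi>_def g by simp
    then show "g \<in> \<Psi> ` carrier H" using hH by blast
  qed auto
  ultimately have "\<Psi> \<in> iso H G" using hom by (simp add: iso_def bij_betw_def)
  then show ?thesis using H.iso_sym unfolding is_iso_def by blast
qed

end

section \<open>Affine coordinates from an isomorphism of endomorphism semigroups\<close>

locale field_semidirect_End_iso = field_semidirect F \<zeta> p q n G b v + H: group H
  for F :: "('a, 'f) ring_scheme" (structure) and \<zeta> p q n and G :: "('a, 'm) monoid_scheme" and b v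
    and H :: "('b, 'k) monoid_scheme" +
  fixes \<theta> :: "('a \<Rightarrow> 'a) \<Rightarrow> ('b \<Rightarrow> 'b)"
  assumes theta: "\<theta> \<in> iso (End G) (End H)"
begin

abbreviation hm (infixl \<open>\<cdot>\<^sub>H\<close> 70) where "hm \<equiv> monoid.mult H"
abbreviation hi where "hi x \<equiv> inv\<^bsub>H\<^esub> x"

text \<open>
  Elements of \<open>End G\<close> are extensional functions. Restricting first allows to apply the isomorphism to any
  function that is a homomorphism on \<open>G\<close>.
\<close>

definition T where "T f = \<theta> (restrict f (carrier G))"

lemma restrict_End: "f \<in> hom G G \<Longrightarrow> restrict f (carrier G) \<in> carrier (End G)"
  by (auto simp: End_def hom_def)

lemma T_End: "f \<in> hom G G \<Longrightarrow> T f \<in> carrier (End H)"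
  unfolding T_def using restrict_End theta by (auto simp: iso_def hom_def)

lemma T_hom: "f \<in> hom G G \<Longrightarrow> T f \<in> hom H H"
  using T_End by (simp add: End_def)

lemma T_cong: "(\<And>x. x \<in> carrier G \<Longrightarrow> f x = g x) \<Longrightarrow> T f = T g"
  unfolding T_def by (metis restrict_ext)

lemma T_comp:
  assumes f: "f \<in> hom G G" and g: "g \<in> hom G G" and h: "h \<in> carrier H"
  shows "T (\<lambda>x. f (g x)) h = T f (T g h)"
proof -
  let ?r = "\<lambda>f. restrict f (carrier G)"
  have "?r (\<lambda>x. f (g x)) = ?r g \<otimes>\<^bsub>End G\<^esub> ?r f"
    using g by (auto simp: End_def compose_def hom_def restrict_def fun_eq_iff)
  then have "T (\<lambda>x. f (g x)) = T g \<otimes>\<^bsub>End H\<^esub> T f"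
    unfolding T_def using theta restrict_End[OF f] restrict_End[OF g] by (simp add: iso_def hom_mult)
  then show ?thesis using h by (simp add: End_def compose_def)
qed

lemma T_inj:
  assumes "f \<in> hom G G" "g \<in> hom G G" "\<And>h. h \<in> carrier H \<Longrightarrow> T f h = T g h" "x \<in> carrier G"
  shows "f x = g x"
proof -
  have "T f = T g"
    by (rule extensionalityI[of _ "carrier H"]) (use T_End assms in \<open>auto simp: End_def\<close>)
  then have "restrict f (carrier G) = restrict g (carrier G)"
    unfolding T_def using theta restrict_End assms by (auto simp: iso_def bij_betw_def inj_on_def)
  then show ?thesis using assms(4) by (metis restrict_apply')
qed

lemma T_surj:
  assumes "f' \<in> hom H H"
  shows "\<exists>f\<in>hom G G. \<forall>h\<in>carrier H. T f h = f' h"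
proof -
  have "restrict f' (carrier H) \<in> carrier (End H)" using assms by (auto simp: End_def hom_def)
  then have "restrict f' (carrier H) \<in> \<theta> ` carrier (End G)" using theta by (simp add: iso_def bij_betw_def)
  then obtain f where f: "f \<in> carrier (End G)" "\<theta> f = restrict f' (carrier H)" by auto
  then have fh: "f \<in> hom G G" "f \<in> extensional (carrier G)" by (auto simp: End_def)
  then have "T f = restrict f' (carrier H)" unfolding T_def using f by (simp add: extensional_restrict)
  then show ?thesis using fh by (intro bexI[of _ f]) auto
qed

lemma T_id: "h \<in> carrier H \<Longrightarrow> T (\<lambda>x. x) h = h"
proof -
  assume h: "h \<in> carrier H"
  have id: "(\<lambda>x. x) \<in> hom G G" "(\<lambda>x. x) \<in> hom H H" by (auto simp: hom_def)
  obtain f where f: "f \<in> hom G G" "\<forall>h\<in>carrier H. T f h = h" using T_surj[OF id(2)] by auto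
  show ?thesis using T_comp[OF id(1) f(1) h] f(2) h by simp
qed

definition \<epsilon> where "\<epsilon> = T e"

lemma eps_hom: "\<epsilon> \<in> hom H H"
  unfolding \<epsilon>_def by (rule T_hom[OF e_hom])

lemma eps_closed [simp]: "h \<in> carrier H \<Longrightarrow> \<epsilon> h \<in> carrier H"
  using eps_hom by (auto simp: hom_def)

lemma e_e: "g \<in> carrier G \<Longrightarrow> e (e g) = e g"
  using e_bpow[of g] by auto

lemma eps_eps: "h \<in> carrier H \<Longrightarrow> \<epsilon> (\<epsilon> h) = \<epsilon> h"
  using T_comp[OF e_hom e_hom, of h] T_cong[of "\<lambda>x. e (e x)" e] e_e unfolding \<epsilon>_def by simp

text \<open>
  The endomorphisms that are trivial on \<open>F\<close> are thus recognized inside the semigroup: they are the \<open>f\<close>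
  with \<open>f \<circ> e = f\<close>.
\<close>

lemma kill_factor:
  assumes f: "f \<in> hom G G" "\<forall>x\<in>carrier F. f x = \<zero>" and g: "g \<in> carrier G"
  shows "f (e g) = f g"
proof -
  have "f g = f (pr g) \<cdot>\<^sub>G f (e g)" using hom_mult[OF f(1), of "pr g" "e g"] pr_e[OF g] g by simp
  also have "f (pr g) = \<one>\<^bsub>G\<^esub>" using f(2) g zero_eq by simp
  finally show ?thesis using hom_in_carrier[OF f(1) e_closed[OF g]] by simp
qed

text \<open>
  An injective endomorphism of the finite group \<open>G\<close> is invertible, and so is its image under the
  isomorphism. All other endomorphisms of \<open>G\<close> factor through \<open>e\<close>, and their images through \<open>\<epsilon>\<close>.
\<close>

lemma inj_or_kill:
  assumes f': "f' \<in> hom H H"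
  shows "inj_on f' (carrier H) \<or> (\<forall>k\<in>carrier H. \<epsilon> k = \<one>\<^bsub>H\<^esub> \<longrightarrow> f' k = \<one>\<^bsub>H\<^esub>)"
proof -
  obtain f where f: "f \<in> hom G G" "\<And>h. h \<in> carrier H \<Longrightarrow> T f h = f' h" using T_surj[OF f'] by blast
  show ?thesis using hom_kill_or_inj[OF f(1)]
  proof
    assume k: "\<forall>x\<in>carrier F. f x = \<zero>"
    have "f' h = f' (\<epsilon> h)" if h: "h \<in> carrier H" for h
      using T_comp[OF f(1) e_hom h] T_cong[of "\<lambda>x. f (e x)" f] kill_factor[OF f(1) k] f(2) h
      unfolding \<epsilon>_def[symmetric] by simp
    then show ?thesis using hom_one[OF f' H.is_group H.is_group] by auto
  next
    assume inj: "inj_on f (carrier G)"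
    have "f ` carrier G \<subseteq> carrier G" using f(1) by (auto simp: hom_def)
    then have "f ` carrier G = carrier G" using inj finite_G by (simp add: endo_inj_surj)
    then have iso: "f \<in> iso G G" using f(1) inj by (simp add: iso_def bij_betw_def)
    define g where "g = inv_into (carrier G) f"
    have g: "g \<in> hom G G" using G.iso_set_sym[OF iso] unfolding g_def iso_def by simp
    have "g (f x) = x" if "x \<in> carrier G" for x unfolding g_def using inj that by simp
    then have "T g (f' h) = h" if "h \<in> carrier H" for h
      using T_comp[OF g f(1) that] T_cong[of "\<lambda>x. g (f x)" "\<lambda>x. x"] T_id f(2) that by simp
    then have "inj_on f' (carrier H)" by (metis inj_onI)
    then show ?thesis by blast
  qed
qed

lemma e_pow_hom: "(\<lambda>g. e g [^]\<^bsub>G\<^esub> (k::nat)) \<in> hom G G"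
proof (rule homI)
  fix g h assume gh: "g \<in> carrier G" "h \<in> carrier G"
  obtain i j where ij: "e g = b [^]\<^bsub>G\<^esub> (i::nat)" "e h = b [^]\<^bsub>G\<^esub> (j::nat)" using e_bpow gh by metis
  show "e (g \<cdot>\<^sub>G h) [^]\<^bsub>G\<^esub> k = e g [^]\<^bsub>G\<^esub> k \<cdot>\<^sub>G e h [^]\<^bsub>G\<^esub> k"
    unfolding e_mult[OF gh] ij using b by (simp add: G.nat_pow_mult G.nat_pow_pow algebra_simps)
qed simp

definition \<kappa> where "\<kappa> k = T (\<lambda>g. e g [^]\<^bsub>G\<^esub> (k::nat))"

definition B where "B = {x \<in> carrier H. \<epsilon> x = x}"

lemma B_subgroup: "subgroup B H"
proof -
  interpret eps: group_hom H H \<epsilon> by unfold_locales (rule eps_hom)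
  show ?thesis unfolding B_def by (rule H.subgroupI) (auto intro: exI[of _ "\<one>\<^bsub>H\<^esub>"])
qed

lemma e_e_pow: "g \<in> carrier G \<Longrightarrow> e (e g [^]\<^bsub>G\<^esub> (k::nat)) = e g [^]\<^bsub>G\<^esub> k"
proof -
  assume "g \<in> carrier G"
  then obtain i where i: "e g = b [^]\<^bsub>G\<^esub> (i::nat)" using e_bpow by blast
  show ?thesis unfolding i using b by (simp add: G.nat_pow_pow)
qed

lemma kappa_closed: "h \<in> carrier H \<Longrightarrow> \<kappa> k h \<in> B"
proof -
  assume h: "h \<in> carrier H"
  have "\<epsilon> (\<kappa> k h) = \<kappa> k h"
    using T_comp[OF e_hom e_pow_hom[of k] h] T_cong[of "\<lambda>g. e (e g [^]\<^bsub>G\<^esub> k)" "\<lambda>g. e g [^]\<^bsub>G\<^esub> k"] e_e_pow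
    unfolding \<epsilon>_def \<kappa>_def by simp
  moreover have "\<kappa> k h \<in> carrier H" using T_hom[OF e_pow_hom[of k]] h unfolding \<kappa>_def by (auto simp: hom_def)
  ultimately show ?thesis unfolding B_def by simp
qed

lemma kappa_eps: "h \<in> carrier H \<Longrightarrow> \<kappa> k (\<epsilon> h) = \<kappa> k h"
  using T_comp[OF e_pow_hom[of k] e_hom, of h] T_cong[of "\<lambda>g. e (e g) [^]\<^bsub>G\<^esub> k" "\<lambda>g. e g [^]\<^bsub>G\<^esub> k"] e_e
  unfolding \<epsilon>_def \<kappa>_def by simp

lemma two_sided_factor:
  assumes g: "g \<in> hom G G" and eq: "\<And>x. x \<in> carrier G \<Longrightarrow> g x = e (g (e x))"
  shows "\<exists>k::nat. \<forall>x\<in>carrier G. g x = e x [^]\<^bsub>G\<^esub> k"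
proof -
  interpret g: group_hom G G g by unfold_locales (rule g)
  interpret e: group_hom G G e by unfold_locales (rule e_hom)
  obtain k where k: "e (g b) = b [^]\<^bsub>G\<^esub> (k::nat)" using e_bpow[OF g.hom_closed[OF b(1)]] by blast
  have "g x = e x [^]\<^bsub>G\<^esub> k" if x: "x \<in> carrier G" for x
  proof -
    obtain i where i: "e x = b [^]\<^bsub>G\<^esub> (i::nat)" using e_bpow[OF x] by blast
    have "g x = e (g b) [^]\<^bsub>G\<^esub> i"
      unfolding eq[OF x] i using g.hom_nat_pow[OF b(1), of i] e.hom_nat_pow[of "g b" i] b by simp
    then show ?thesis unfolding i k using b by (simp add: G.nat_pow_pow mult.commute)
  qed
  then show ?thesis by blast
qed

text \<open>
  Extending an endomorphism of \<open>B\<close> by \<open>\<epsilon>\<close> identifies the monoid of endomorphisms of \<open>B\<close> with that of the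
  endomorphisms \<open>\<epsilon> \<circ> f \<circ> \<epsilon>\<close> of \<open>H\<close>. It corresponds to the endomorphisms \<open>e \<circ> g \<circ> e\<close> of \<open>G\<close>, which are the
  power maps of \<open>\<langle>b\<rangle>\<close> preceded by \<open>e\<close>.
\<close>

lemma B_cyclic: "\<exists>c\<in>B. H.ord c = q ^ v \<and> (\<forall>y\<in>B. \<exists>i::nat. y = c [^]\<^bsub>H\<^esub> i)"
proof -
  let ?B = "H\<lparr>carrier := B\<rparr>"
  interpret B: group ?B by (rule H.subgroup_imp_group[OF B_subgroup])
  have BH: "x \<in> B \<Longrightarrow> x \<in> carrier H" for x unfolding B_def by simp
  have "\<exists>c\<in>carrier ?B. B.ord c = q ^ v \<and> (\<forall>y\<in>carrier ?B. \<exists>i::nat. y = c [^]\<^bsub>?B\<^esub> i)"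
  proof (rule B.cyclic_of_End_cyclic[OF q v])
    fix i show "\<kappa> i \<in> hom ?B ?B"
      using T_hom[OF e_pow_hom[of i]] kappa_closed BH unfolding \<kappa>_def by (auto simp: hom_def)
  next
    fix i j :: nat and x assume "x \<in> carrier ?B"
    then have x: "x \<in> carrier H" using BH by simp
    have "(\<lambda>g. e (e g [^]\<^bsub>G\<^esub> j) [^]\<^bsub>G\<^esub> i) g = e g [^]\<^bsub>G\<^esub> (i * j)" if "g \<in> carrier G" for g
      using that e_e_pow by (simp add: G.nat_pow_pow mult.commute)
    then show "\<kappa> (i * j) x = \<kappa> i (\<kappa> j x)"
      using T_comp[OF e_pow_hom[of i] e_pow_hom[of j] x]
        T_cong[of "\<lambda>g. e (e g [^]\<^bsub>G\<^esub> j) [^]\<^bsub>G\<^esub> i" "\<lambda>g. e g [^]\<^bsub>G\<^esub> (i * j)"]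
      unfolding \<kappa>_def by simp
  next
    fix f assume "f \<in> hom ?B ?B"
    then have f: "\<And>x. x \<in> B \<Longrightarrow> f x \<in> B" "\<And>x y. x \<in> B \<Longrightarrow> y \<in> B \<Longrightarrow> f (x \<cdot>\<^sub>H y) = f x \<cdot>\<^sub>H f y"
      by (auto simp: hom_def)
    have eB: "\<epsilon> h \<in> B" if "h \<in> carrier H" for h unfolding B_def using that eps_eps by simp
    have "(\<lambda>h. f (\<epsilon> h)) \<in> hom H H"
      by (rule homI) (use f eB BH eps_hom in \<open>auto simp: hom_mult\<close>)
    then obtain g where g: "g \<in> hom G G" "\<And>h. h \<in> carrier H \<Longrightarrow> T g h = f (\<epsilon> h)" using T_surj by blast
    have ge: "(\<lambda>x. g (e x)) \<in> hom G G" using g(1) e_hom by (auto simp: hom_def Pi_iff)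
    have ege: "(\<lambda>x. e (g (e x))) \<in> hom G G" using ge e_hom by (auto simp: hom_def Pi_iff)
    have "g x = e (g (e x))" if x: "x \<in> carrier G" for x
    proof (rule T_inj[OF g(1) ege _ x])
      fix h assume h: "h \<in> carrier H"
      have "T (\<lambda>x. e (g (e x))) h = \<epsilon> (T g (\<epsilon> h))"
        using T_comp[OF e_hom ge h] T_comp[OF g(1) e_hom h] unfolding \<epsilon>_def by simp
      also have "\<dots> = f (\<epsilon> h)" using g(2) h eps_eps f(1)[OF eB[OF h]] unfolding B_def by simp
      finally show "T g h = T (\<lambda>x. e (g (e x))) h" using g(2) h by simp
    qed
    then obtain k where k: "\<forall>x\<in>carrier G. g x = e x [^]\<^bsub>G\<^esub> (k::nat)" using two_sided_factor[OF g(1)] by blast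
    have "f x = \<kappa> k x" if "x \<in> B" for x
      using g(2)[of x] T_cong[of g "\<lambda>x. e x [^]\<^bsub>G\<^esub> k"] k that unfolding \<kappa>_def B_def by simp
    then show "\<exists>i. \<forall>x\<in>carrier ?B. f x = \<kappa> i x" by auto
  next
    fix i j
    have "\<epsilon> x \<in> B" if "x \<in> carrier H" for x unfolding B_def using that eps_eps by simp
    then have "(\<forall>x\<in>B. \<kappa> i x = \<kappa> j x) \<longleftrightarrow> (\<forall>x\<in>carrier H. \<kappa> i x = \<kappa> j x)"
      using kappa_eps BH by metis
    also have "\<dots> \<longleftrightarrow> (\<forall>g\<in>carrier G. e g [^]\<^bsub>G\<^esub> i = e g [^]\<^bsub>G\<^esub> j)"
      using T_inj[OF e_pow_hom[of i] e_pow_hom[of j]]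
        T_cong[of "\<lambda>g. e g [^]\<^bsub>G\<^esub> i" "\<lambda>g. e g [^]\<^bsub>G\<^esub> j"] unfolding \<kappa>_def by metis
    also have "\<dots> \<longleftrightarrow> [i = j] (mod q ^ v)"
    proof
      assume "\<forall>g\<in>carrier G. e g [^]\<^bsub>G\<^esub> i = e g [^]\<^bsub>G\<^esub> j"
      then have "b [^]\<^bsub>G\<^esub> i = b [^]\<^bsub>G\<^esub> j" using b by (metis e_b(2))
      then show "[i = j] (mod q ^ v)" using bpow_eq by simp
    next
      assume ij: "[i = j] (mod q ^ v)"
      show "\<forall>g\<in>carrier G. e g [^]\<^bsub>G\<^esub> i = e g [^]\<^bsub>G\<^esub> j"
        using G.pow_cong[OF e_closed e_pow_order ij] by blast
    qed
    finally show "(\<forall>x\<in>carrier ?B. \<kappa> i x = \<kappa> j x) = [i = j] (mod q ^ v)" by simp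
  qed
  then obtain c where c: "c \<in> B" "B.ord c = q ^ v" "\<And>y. y \<in> B \<Longrightarrow> \<exists>i::nat. y = c [^]\<^bsub>?B\<^esub> i" by auto
  have pow: "c [^]\<^bsub>?B\<^esub> i = c [^]\<^bsub>H\<^esub> i" for i :: nat by (simp add: nat_pow_def)
  have "H.ord c = q ^ v"
    using H.ord_unique[OF BH[OF c(1)], of "q ^ v"] B.pow_eq_id[of c] c pow by simp
  then show ?thesis using c pow by auto
qed

definition c where "c = (SOME c. c \<in> B \<and> H.ord c = q ^ v \<and> (\<forall>y\<in>B. \<exists>i::nat. y = c [^]\<^bsub>H\<^esub> i))"

lemma c: "c \<in> carrier H" "\<epsilon> c = c" "H.ord c = q ^ v" "\<And>h. h \<in> carrier H \<Longrightarrow> \<exists>i::nat. \<epsilon> h = c [^]\<^bsub>H\<^esub> i"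
proof -
  have "\<exists>c. c \<in> B \<and> H.ord c = q ^ v \<and> (\<forall>y\<in>B. \<exists>i::nat. y = c [^]\<^bsub>H\<^esub> i)" using B_cyclic by blast
  then have *: "c \<in> B \<and> H.ord c = q ^ v \<and> (\<forall>y\<in>B. \<exists>i::nat. y = c [^]\<^bsub>H\<^esub> i)" unfolding c_def by (rule someI_ex)
  then show "c \<in> carrier H" "\<epsilon> c = c" "H.ord c = q ^ v" unfolding B_def by auto
  show "\<exists>i::nat. \<epsilon> h = c [^]\<^bsub>H\<^esub> i" if "h \<in> carrier H" for h
    using * eps_eps[OF that] that unfolding B_def by simp
qed

lemma conj_hom: "h \<in> carrier H \<Longrightarrow> (\<lambda>x. h \<cdot>\<^sub>H x \<cdot>\<^sub>H hi h) \<in> hom H H"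
  by (rule homI) (auto simp: H.group_normalize)

definition hat where "hat h = (SOME f. f \<in> hom G G \<and> (\<forall>x\<in>carrier H. T f x = h \<cdot>\<^sub>H x \<cdot>\<^sub>H hi h))"

lemma hat:
  assumes "h \<in> carrier H"
  shows hat_hom: "hat h \<in> hom G G" and T_hat: "\<And>x. x \<in> carrier H \<Longrightarrow> T (hat h) x = h \<cdot>\<^sub>H x \<cdot>\<^sub>H hi h"
proof -
  have "\<exists>f. f \<in> hom G G \<and> (\<forall>x\<in>carrier H. T f x = h \<cdot>\<^sub>H x \<cdot>\<^sub>H hi h)"
    using T_surj[OF conj_hom[OF assms]] by blast
  then have "hat h \<in> hom G G \<and> (\<forall>x\<in>carrier H. T (hat h) x = h \<cdot>\<^sub>H x \<cdot>\<^sub>H hi h)" unfolding hat_def by (rule someI_ex)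
  then show "hat h \<in> hom G G" "\<And>x. x \<in> carrier H \<Longrightarrow> T (hat h) x = h \<cdot>\<^sub>H x \<cdot>\<^sub>H hi h" by auto
qed

lemma hat_closed: "h \<in> carrier H \<Longrightarrow> x \<in> carrier G \<Longrightarrow> hat h x \<in> carrier G"
  using hat_hom by (auto simp: hom_def)

lemma comp_hom: "f \<in> hom G G \<Longrightarrow> g \<in> hom G G \<Longrightarrow> (\<lambda>x. f (g x)) \<in> hom G G"
  by (auto simp: hom_def Pi_iff)

lemma hat_eqI:
  assumes "h \<in> carrier H" "f \<in> hom G G" "\<And>x. x \<in> carrier H \<Longrightarrow> T f x = h \<cdot>\<^sub>H x \<cdot>\<^sub>H hi h" "x \<in> carrier G"
  shows "hat h x = f x"
  using T_inj[OF hat_hom[OF assms(1)] assms(2) _ assms(4)] T_hat[OF assms(1)] assms(3) by simp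

lemma hat_mult: "h \<in> carrier H \<Longrightarrow> k \<in> carrier H \<Longrightarrow> x \<in> carrier G \<Longrightarrow> hat (h \<cdot>\<^sub>H k) x = hat h (hat k x)"
proof (rule hat_eqI)
  assume hk: "h \<in> carrier H" "k \<in> carrier H"
  show "(\<lambda>x. hat h (hat k x)) \<in> hom G G" using hk hat_hom comp_hom by blast
  fix y assume y: "y \<in> carrier H"
  show "T (\<lambda>x. hat h (hat k x)) y = (h \<cdot>\<^sub>H k) \<cdot>\<^sub>H y \<cdot>\<^sub>H hi (h \<cdot>\<^sub>H k)"
    using T_comp[OF hat_hom[OF hk(1)] hat_hom[OF hk(2)] y] T_hat hk y by (simp add: H.group_normalize)
qed auto

lemma hat_one: "x \<in> carrier G \<Longrightarrow> hat \<one>\<^bsub>H\<^esub> x = x"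
  by (rule hat_eqI) (auto simp: T_id hom_def)

text \<open>
  Conjugation does not change the image under \<open>\<epsilon>\<close>, which lies in a commutative group.
\<close>

lemma e_hat: "h \<in> carrier H \<Longrightarrow> x \<in> carrier G \<Longrightarrow> e (hat h x) = e x"
proof (rule T_inj[OF comp_hom[OF e_hom hat_hom] e_hom])
  fix y assume h: "h \<in> carrier H" and y: "y \<in> carrier H"
  interpret eps: group_hom H H \<epsilon> by unfold_locales (rule eps_hom)
  obtain i j where ij: "\<epsilon> h = c [^]\<^bsub>H\<^esub> (i::nat)" "\<epsilon> y = c [^]\<^bsub>H\<^esub> (j::nat)" using c h y by metis
  have "\<epsilon> h \<cdot>\<^sub>H \<epsilon> y = \<epsilon> y \<cdot>\<^sub>H \<epsilon> h" unfolding ij using c by (simp add: H.nat_pow_mult add.commute)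
  moreover have "\<epsilon> (h \<cdot>\<^sub>H y \<cdot>\<^sub>H hi h) = (\<epsilon> h \<cdot>\<^sub>H \<epsilon> y) \<cdot>\<^sub>H hi (\<epsilon> h)" using h y by simp
  ultimately have "\<epsilon> (h \<cdot>\<^sub>H y \<cdot>\<^sub>H hi h) = \<epsilon> y" using h y by (simp add: H.group_normalize)
  then show "T (\<lambda>x. e (hat h x)) y = T e y"
    using T_comp[OF e_hom hat_hom[OF h] y] T_hat h y unfolding \<epsilon>_def by simp
qed auto

text \<open>
  The endomorphism \<open>hat h\<close> sends \<open>b\<close> to \<open>t h \<cdot>\<^sub>G b\<close> and acts on \<open>F\<close> as multiplication by \<open>\<Lambda> h\<close>.
\<close>

definition t where "t h = pr (hat h b)"
definition \<Lambda> where "\<Lambda> h = hat h \<one>"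

lemma hat_b: "h \<in> carrier H \<Longrightarrow> hat h b = t h \<cdot>\<^sub>G b"
  unfolding t_def using pr_e[OF hat_closed[OF _ b(1)], of h] e_hat[of h b] b by simp

lemma t_closed: "h \<in> carrier H \<Longrightarrow> t h \<in> carrier F"
  unfolding t_def using hat_closed b by simp

lemma lam_closed: "h \<in> carrier H \<Longrightarrow> \<Lambda> h \<in> carrier F"
  unfolding \<Lambda>_def using hom_F[OF hat_hom] by simp

lemma hat_F:
  assumes h: "h \<in> carrier H" and x: "x \<in> carrier F"
  shows "hat h x = \<Lambda> h \<otimes> x"
proof -
  note f = hat_hom[OF h]
  have chi: "\<chi> (hat h b) = \<zeta>" using chi_e[OF hat_closed[OF h b(1)]] e_hat[OF h b(1)] chi_b by simp
  show ?thesis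
    by (rule span_induct[where z = \<one> and P = "\<lambda>x. hat h x = \<Lambda> h \<otimes> x"])
      (use lam_closed[OF h] x hom_add[OF f] additive_zero_neg(2)[of "hat h", OF hom_F[OF f] hom_add[OF f]]
        hom_zeta[OF f] chi zeta in \<open>auto simp: \<Lambda>_def r_distr r_minus m_lcomm\<close>)
qed

lemma lam_mult: "h \<in> carrier H \<Longrightarrow> k \<in> carrier H \<Longrightarrow> \<Lambda> (h \<cdot>\<^sub>H k) = \<Lambda> h \<otimes> \<Lambda> k"
proof -
  assume hk: "h \<in> carrier H" "k \<in> carrier H"
  have "\<Lambda> (h \<cdot>\<^sub>H k) = hat h (\<Lambda> k)" unfolding \<Lambda>_def by (rule hat_mult[OF hk]) simp
  then show ?thesis using hat_F[OF hk(1)] lam_closed hk by simp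
qed

lemma t_mult: "h \<in> carrier H \<Longrightarrow> k \<in> carrier H \<Longrightarrow> t (h \<cdot>\<^sub>H k) = t h \<oplus> \<Lambda> h \<otimes> t k"
proof -
  assume hk: "h \<in> carrier H" "k \<in> carrier H"
  have tk: "t k \<in> carrier F" "t h \<in> carrier F" using t_closed hk by auto
  have "hat (h \<cdot>\<^sub>H k) b = hat h (t k) \<cdot>\<^sub>G hat h b"
    using hat_mult[OF hk b(1)] hat_b[OF hk(2)] hom_mult[OF hat_hom[OF hk(1)], of "t k" b] tk b by simp
  also have "\<dots> = (\<Lambda> h \<otimes> t k \<oplus> t h) \<cdot>\<^sub>G b"
    using hat_F hat_b hk tk lam_closed b by (simp add: add_eq G.m_assoc)
  finally have "hat (h \<cdot>\<^sub>H k) b = (\<Lambda> h \<otimes> t k \<oplus> t h) \<cdot>\<^sub>G b [^]\<^bsub>G\<^esub> (1::nat)" using b by simp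
  then show ?thesis unfolding t_def[of "h \<cdot>\<^sub>H k"] using pr_dec[of "\<Lambda> h \<otimes> t k \<oplus> t h" 1] tk lam_closed hk
    by (simp add: a_comm)
qed

lemma lam_one: "\<Lambda> \<one>\<^bsub>H\<^esub> = \<one>"
  unfolding \<Lambda>_def by (rule hat_one) simp

lemma lam_nonzero: "h \<in> carrier H \<Longrightarrow> \<Lambda> h \<noteq> \<zero>"
proof
  assume h: "h \<in> carrier H" and z: "\<Lambda> h = \<zero>"
  have "\<Lambda> (h \<cdot>\<^sub>H hi h) = \<zero>" using lam_mult[of h "hi h"] h z lam_closed by simp
  then show False using h lam_one by simp
qed

lemma central:
  assumes h: "h \<in> carrier H" and k: "k \<in> carrier H" and z: "t h = \<zero>" "\<Lambda> h = \<one>"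
  shows "h \<cdot>\<^sub>H k = k \<cdot>\<^sub>H h"
proof -
  have "hat h x = x" if "x \<in> carrier G" for x
    by (rule hom_ext[OF G.is_group hat_hom[OF h] _ _ _ that])
      (use hat_F[OF h] hat_b[OF h] z b zero_eq in \<open>auto simp: hom_def\<close>)
  then have "T (hat h) k = k" using T_cong[of "hat h" "\<lambda>x. x"] T_id[OF k] by simp
  then have "h \<cdot>\<^sub>H k \<cdot>\<^sub>H hi h = k" using T_hat[OF h k] by simp
  then have "(h \<cdot>\<^sub>H k \<cdot>\<^sub>H hi h) \<cdot>\<^sub>H h = k \<cdot>\<^sub>H h" by simp
  then show ?thesis using h k by (simp add: H.group_normalize)
qed

lemma t_c: "t c = \<zero>"
proof -
  have "hat c (e x) = e x" if "x \<in> carrier G" for x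
  proof (rule T_inj[OF comp_hom[OF hat_hom[OF c(1)] e_hom] e_hom _ that])
    fix h assume h: "h \<in> carrier H"
    obtain i where i: "\<epsilon> h = c [^]\<^bsub>H\<^esub> (i::nat)" using c h by blast
    have "c \<cdot>\<^sub>H \<epsilon> h = \<epsilon> h \<cdot>\<^sub>H c" unfolding i using H.pow_commute[of c c i] c by simp
    then have "c \<cdot>\<^sub>H \<epsilon> h \<cdot>\<^sub>H hi c = \<epsilon> h" using c h by (simp add: H.group_normalize)
    then show "T (\<lambda>x. hat c (e x)) h = T e h"
      using T_comp[OF hat_hom[OF c(1)] e_hom h] T_hat[OF c(1)] h unfolding \<epsilon>_def[symmetric] by simp
  qed
  then have "hat c b = b" using e_b(2) b(1) by metis
  then show ?thesis unfolding t_def by simp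
qed

text \<open>
  If \<open>H\<close> were commutative, \<open>h \<mapsto> h \<cdot>\<^sub>H hi (\<epsilon> h)\<close> would be an endomorphism \<open>f\<close> with \<open>f \<circ> \<epsilon>\<close> trivial. The
  corresponding endomorphism of \<open>G\<close> would be trivial at \<open>b\<close>, hence not injective, hence trivial; so \<open>\<epsilon>\<close>
  would be the identity, and then \<open>e\<close> as well.
\<close>

lemma nonabelian: "\<exists>h\<in>carrier H. \<exists>k\<in>carrier H. h \<cdot>\<^sub>H k \<noteq> k \<cdot>\<^sub>H h"
proof (rule ccontr)
  assume "\<not> ?thesis"
  then have "comm_group H" by (intro H.group_comm_groupI) blast
  then interpret Hc: comm_group H .
  interpret eps: group_hom H H \<epsilon> by unfold_locales (rule eps_hom)
  let ?f = "\<lambda>h. h \<cdot>\<^sub>H hi (\<epsilon> h)"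
  have "?f \<in> hom H H" by (rule homI) (auto simp: Hc.inv_mult Hc.m_ac)
  then obtain f where f: "f \<in> hom G G" "\<And>h. h \<in> carrier H \<Longrightarrow> T f h = ?f h" using T_surj by blast
  interpret f: group_hom G G f by unfold_locales (rule f)
  have one: "(\<lambda>x. \<one>\<^bsub>G\<^esub>) \<in> hom G G" by (auto simp: hom_def)
  have T1: "T (\<lambda>x. \<one>\<^bsub>G\<^esub>) h = \<one>\<^bsub>H\<^esub>" if h: "h \<in> carrier H" for h
  proof -
    obtain g where g: "g \<in> hom G G" "\<And>h. h \<in> carrier H \<Longrightarrow> T g h = \<one>\<^bsub>H\<^esub>"
      using T_surj[of "\<lambda>h. \<one>\<^bsub>H\<^esub>"] by (auto simp: hom_def)
    have "T (\<lambda>x. \<one>\<^bsub>G\<^esub>) (T g h) = T (\<lambda>x. \<one>\<^bsub>G\<^esub>) h" using T_comp[OF one g(1) h] by simp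
    then show ?thesis using g(2)[OF h] hom_one[OF T_hom[OF one] H.is_group H.is_group] by simp
  qed
  have fe: "f (e x) = \<one>\<^bsub>G\<^esub>" if "x \<in> carrier G" for x
    by (rule T_inj[OF comp_hom[OF f(1) e_hom] one _ that])
      (use T_comp[OF f(1) e_hom] f(2) T1 eps_eps in \<open>simp add: \<epsilon>_def[symmetric]\<close>)
  then have fb: "f b = \<one>\<^bsub>G\<^esub>" using b e_b(2) by metis
  have "b \<noteq> \<one>\<^bsub>G\<^esub>" using conj_b[of \<one>] zeta by auto
  then have "\<not> inj_on f (carrier G)" using fb b by (metis G.one_closed f.hom_one inj_onD)
  then have "\<forall>x\<in>carrier F. f x = \<zero>" using hom_kill_or_inj[OF f(1)] by blast
  then have "f x = \<one>\<^bsub>G\<^esub>" if "x \<in> carrier G" for x using kill_factor[OF f(1)] fe that by metis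
  then have "?f h = \<one>\<^bsub>H\<^esub>" if "h \<in> carrier H" for h
    using T_cong[of f "\<lambda>x. \<one>\<^bsub>G\<^esub>"] T1 f(2) that by simp
  then have "\<epsilon> h = h" if "h \<in> carrier H" for h using that by (metis H.inv_equality H.inv_inv eps_closed H.inv_closed)
  then have "T e h = T (\<lambda>x. x) h" if "h \<in> carrier H" for h using that T_id unfolding \<epsilon>_def by simp
  then have "e \<one> = \<one>" using T_inj[OF e_hom, of "\<lambda>x. x" \<one>] by (auto simp: hom_def)
  then show False using e_F[OF one_closed] zero_eq one_not_zero by simp
qed

text \<open>
  An inner automorphism of \<open>G\<close> corresponds to an automorphism of \<open>H\<close>, and the latter permutes the inner
  automorphisms of \<open>H\<close>. So the affine maps that occur are stable under conjugation by elements of \<open>G\<close>.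
\<close>

lemma hat_transport:
  assumes g: "g \<in> carrier G" and h: "h \<in> carrier H"
  obtains k where "k \<in> carrier H" "\<And>x. x \<in> carrier G \<Longrightarrow> hat k (g \<cdot>\<^sub>G x \<cdot>\<^sub>G gi g) = g \<cdot>\<^sub>G hat h x \<cdot>\<^sub>G gi g" "\<Lambda> k = \<Lambda> h"
proof -
  let ?a = "\<lambda>x. g \<cdot>\<^sub>G x \<cdot>\<^sub>G gi g"
  have a: "?a \<in> hom G G" by (rule homI) (use g in \<open>auto simp: G.group_normalize\<close>)
  interpret Ta: group_hom H H "T ?a" by unfold_locales (rule T_hom[OF a])
  define k where "k = T ?a h"
  have k: "k \<in> carrier H" unfolding k_def using h by simp
  have eq: "hat k (?a x) = ?a (hat h x)" if x: "x \<in> carrier G" for x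
  proof (rule T_inj[OF comp_hom[OF hat_hom[OF k] a] comp_hom[OF a hat_hom[OF h]] _ x])
    fix y assume y: "y \<in> carrier H"
    show "T (\<lambda>x. hat k (?a x)) y = T (\<lambda>x. ?a (hat h x)) y"
      using T_comp[OF hat_hom[OF k] a y] T_comp[OF a hat_hom[OF h] y] T_hat[OF k] T_hat[OF h] y h
      by (simp add: k_def)
  qed
  have "\<Lambda> k \<otimes> \<chi> g = \<chi> g \<otimes> \<Lambda> h"
    using eq[of \<one>] hat_F[OF k, of "\<chi> g"] conj_chi[OF g] g lam_closed[OF h] by (simp add: \<Lambda>_def)
  then have "\<Lambda> k \<otimes> \<chi> g = \<Lambda> h \<otimes> \<chi> g" using g h lam_closed by (simp add: m_comm)
  then have "\<Lambda> k = \<Lambda> h" using m_rcancel[OF chi_nonzero[OF g] chi_closed[OF g]] lam_closed k h by simp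
  then show thesis using that k eq by blast
qed

lemma translate_t:
  assumes x: "x \<in> carrier F" and h: "h \<in> carrier H"
  shows "\<exists>k\<in>carrier H. \<Lambda> k = \<Lambda> h \<and> t k = t h \<oplus> (\<one> \<ominus> \<Lambda> h) \<otimes> ((\<one> \<ominus> \<zeta>) \<otimes> x)"
proof -
  obtain k where k: "k \<in> carrier H" "\<And>y. y \<in> carrier G \<Longrightarrow> hat k (x \<cdot>\<^sub>G y \<cdot>\<^sub>G gi x) = x \<cdot>\<^sub>G hat h y \<cdot>\<^sub>G gi x" "\<Lambda> k = \<Lambda> h"
    using hat_transport[OF F_G[OF x] h] by metis
  have c: "t h \<in> carrier F" "t k \<in> carrier F" "\<Lambda> h \<in> carrier F" using t_closed lam_closed h k by auto
  have bx: "b \<cdot>\<^sub>G gi x = \<ominus> (\<zeta> \<otimes> x) \<cdot>\<^sub>G b"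
  proof -
    have "b \<cdot>\<^sub>G gi x \<cdot>\<^sub>G gi b = \<ominus> (\<zeta> \<otimes> x)"
      using conj_b[of "gi x"] x zeta by (metis F_inv_closed minus_eq_inv r_minus)
    then have "(b \<cdot>\<^sub>G gi x \<cdot>\<^sub>G gi b) \<cdot>\<^sub>G b = \<ominus> (\<zeta> \<otimes> x) \<cdot>\<^sub>G b" by simp
    then show ?thesis using b x by (simp add: G.group_normalize)
  qed
  have conj: "x \<cdot>\<^sub>G (y \<cdot>\<^sub>G b) \<cdot>\<^sub>G gi x = (x \<oplus> y \<oplus> \<ominus> (\<zeta> \<otimes> x)) \<cdot>\<^sub>G b" if y: "y \<in> carrier F" for y
  proof -
    have "x \<cdot>\<^sub>G (y \<cdot>\<^sub>G b) \<cdot>\<^sub>G gi x = x \<cdot>\<^sub>G y \<cdot>\<^sub>G (b \<cdot>\<^sub>G gi x)" using x y b by (simp add: G.group_normalize)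
    also have "\<dots> = (x \<oplus> y \<oplus> \<ominus> (\<zeta> \<otimes> x)) \<cdot>\<^sub>G b" unfolding bx using x y b zeta by (simp add: add_eq F_closed G.m_assoc)
    finally show ?thesis .
  qed
  let ?d = "x \<oplus> \<ominus> (\<zeta> \<otimes> x)"
  have d: "?d \<in> carrier F" using x zeta by simp
  have "x \<cdot>\<^sub>G b \<cdot>\<^sub>G gi x = ?d \<cdot>\<^sub>G b" using conj[OF zero_closed] x b zeta zero_eq by simp
  then have "hat k (?d \<cdot>\<^sub>G b) = x \<cdot>\<^sub>G (t h \<cdot>\<^sub>G b) \<cdot>\<^sub>G gi x" using k(2)[OF b(1)] hat_b[OF h] by simp
  then have "hat k ?d \<cdot>\<^sub>G hat k b = (x \<oplus> t h \<oplus> \<ominus> (\<zeta> \<otimes> x)) \<cdot>\<^sub>G b"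
    using conj[OF c(1)] hom_mult[OF hat_hom[OF k(1)], of ?d b] d b by simp
  then have "(\<Lambda> h \<otimes> ?d \<oplus> t k) \<cdot>\<^sub>G b = (x \<oplus> t h \<oplus> \<ominus> (\<zeta> \<otimes> x)) \<cdot>\<^sub>G b"
    using hat_F[OF k(1) d] hat_b[OF k(1)] k(3) c d b by (simp add: add_eq G.m_assoc)
  then have 1: "\<Lambda> h \<otimes> ?d \<oplus> t k = x \<oplus> t h \<oplus> \<ominus> (\<zeta> \<otimes> x)" using b c d x zeta by simp
  have "t k = (\<Lambda> h \<otimes> ?d \<oplus> t k) \<ominus> \<Lambda> h \<otimes> ?d" using c d by algebra
  also have "\<dots> = t h \<oplus> (\<one> \<ominus> \<Lambda> h) \<otimes> ((\<one> \<ominus> \<zeta>) \<otimes> x)" unfolding 1 using c x zeta(1) by algebra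
  finally show ?thesis using k by blast
qed

lemma zeta_t:
  assumes h: "h \<in> carrier H"
  shows "\<exists>k\<in>carrier H. \<Lambda> k = \<Lambda> h \<and> t k = \<zeta> \<otimes> t h"
proof -
  obtain k where k: "k \<in> carrier H" "\<And>y. y \<in> carrier G \<Longrightarrow> hat k (b \<cdot>\<^sub>G y \<cdot>\<^sub>G gi b) = b \<cdot>\<^sub>G hat h y \<cdot>\<^sub>G gi b" "\<Lambda> k = \<Lambda> h"
    using hat_transport[OF b(1) h] by metis
  have c: "t h \<in> carrier F" using t_closed h by auto
  have "hat k b = b \<cdot>\<^sub>G (t h \<cdot>\<^sub>G b) \<cdot>\<^sub>G gi b" using k(2)[OF b(1)] hat_b[OF h] b by (simp add: G.group_normalize)
  also have "\<dots> = (b \<cdot>\<^sub>G t h \<cdot>\<^sub>G gi b) \<cdot>\<^sub>G b [^]\<^bsub>G\<^esub> (1::nat)" using b c by (simp add: G.group_normalize)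
  also have "b \<cdot>\<^sub>G t h \<cdot>\<^sub>G gi b = \<zeta> \<otimes> t h" using conj_b c by simp
  finally have "t k = \<zeta> \<otimes> t h" unfolding t_def[of k] using pr_dec[of "\<zeta> \<otimes> t h" 1] c zeta by simp
  then show ?thesis using k by blast
qed

lemma t_one: "t \<one>\<^bsub>H\<^esub> = \<zero>"
  unfolding t_def using hat_one b by simp

lemma inv_coords:
  assumes h: "h \<in> carrier H"
  shows "\<Lambda> (hi h) \<otimes> \<Lambda> h = \<one>" "t (hi h) = \<ominus> (\<Lambda> (hi h) \<otimes> t h)"
proof -
  show "\<Lambda> (hi h) \<otimes> \<Lambda> h = \<one>" using lam_mult[of "hi h" h] h lam_one by simp
  have "t (hi h) \<oplus> \<Lambda> (hi h) \<otimes> t h = \<zero>" using t_mult[of "hi h" h] h t_one by simp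
  then show "t (hi h) = \<ominus> (\<Lambda> (hi h) \<otimes> t h)" using h t_closed lam_closed by (simp add: minus_equality)
qed

text \<open>
  The translations that occur form a subgroup of \<open>F\<close> invariant under \<open>\<zeta>\<close>, so one nontrivial translation
  is enough. If some linear part is not \<open>\<one>\<close>, it comes from a commutator with a translation of \<open>F\<close>;
  otherwise from a noncentral element.
\<close>

lemma translations_occur:
  assumes x: "x \<in> carrier F"
  shows "\<exists>h\<in>carrier H. t h = x \<and> \<Lambda> h = \<one>"
proof -
  let ?S = "{t h |h. h \<in> carrier H \<and> \<Lambda> h = \<one>}"
  have sub: "subgroup ?S (add_monoid F)"
  proof (rule add.subgroupI)
    show "?S \<subseteq> carrier F" using t_closed by auto
    show "?S \<noteq> {}" using lam_one by auto
  next
    fix a assume "a \<in> ?S"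
    then obtain h where h: "h \<in> carrier H" "\<Lambda> h = \<one>" "a = t h" by blast
    have l: "\<Lambda> (hi h) = \<one>" using inv_coords(1)[OF h(1)] h lam_closed[of "hi h"] by simp
    then have "t (hi h) = \<ominus> a" using inv_coords(2)[OF h(1)] h t_closed by simp
    then show "\<ominus> a \<in> ?S" using l h(1) by (metis (mono_tags, lifting) H.inv_closed mem_Collect_eq)
  next
    fix a d assume "a \<in> ?S" "d \<in> ?S"
    then obtain h k where h: "h \<in> carrier H" "\<Lambda> h = \<one>" "a = t h" "k \<in> carrier H" "\<Lambda> k = \<one>" "d = t k" by auto
    have "t (h \<cdot>\<^sub>H k) = a \<oplus> d" "\<Lambda> (h \<cdot>\<^sub>H k) = \<one>" using h t_mult lam_mult t_closed by auto
    then show "a \<oplus> d \<in> ?S" using h by (metis (mono_tags, lifting) H.m_closed mem_Collect_eq)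
  qed
  have zS: "\<zeta> \<otimes> a \<in> ?S" if aS: "a \<in> ?S" for a
  proof -
    obtain h where h: "h \<in> carrier H" "\<Lambda> h = \<one>" "a = t h" using aS by blast
    then show ?thesis using zeta_t[OF h(1)] by (metis (mono_tags, lifting) mem_Collect_eq)
  qed
  have "\<exists>a\<in>?S. a \<noteq> \<zero>"
  proof (cases "\<exists>h\<in>carrier H. \<Lambda> h \<noteq> \<one>")
    case True
    then obtain h where h: "h \<in> carrier H" "\<Lambda> h \<noteq> \<one>" by blast
    obtain k where k: "k \<in> carrier H" "\<Lambda> k = \<Lambda> h" "t k = t h \<oplus> (\<one> \<ominus> \<Lambda> h) \<otimes> ((\<one> \<ominus> \<zeta>) \<otimes> \<one>)"
      using translate_t[OF one_closed h(1)] by blast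
    define u where "u = (\<one> \<ominus> \<Lambda> h) \<otimes> (\<one> \<ominus> \<zeta>)"
    have nz: "\<one> \<ominus> \<Lambda> h \<noteq> \<zero>" "\<one> \<ominus> \<zeta> \<noteq> \<zero>"
      using h zeta lam_closed by (metis r_right_minus_eq one_closed)+
    have u: "u \<in> carrier F" "u \<noteq> \<zero>" unfolding u_def using nz h zeta lam_closed by (auto simp: integral_iff)
    have li: "\<Lambda> (hi h) \<in> carrier F" "\<Lambda> (hi h) \<otimes> \<Lambda> h = \<one>" "\<Lambda> h \<otimes> \<Lambda> (hi h) = \<one>"
      using inv_coords(1)[OF h(1)] lam_closed h by (auto simp: m_comm)
    have th: "t h \<in> carrier F" "\<Lambda> h \<in> carrier F" using h t_closed lam_closed by auto
    have "t (k \<cdot>\<^sub>H hi h) = t h \<oplus> u \<oplus> \<Lambda> h \<otimes> \<ominus> (\<Lambda> (hi h) \<otimes> t h)"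
      using t_mult[OF k(1), of "hi h"] k inv_coords(2)[OF h(1)] h zeta unfolding u_def by simp
    also have "\<Lambda> h \<otimes> \<ominus> (\<Lambda> (hi h) \<otimes> t h) = \<ominus> ((\<Lambda> h \<otimes> \<Lambda> (hi h)) \<otimes> t h)" using th li(1) by algebra
    also have "t h \<oplus> u \<oplus> \<ominus> ((\<Lambda> h \<otimes> \<Lambda> (hi h)) \<otimes> t h) = u" unfolding li(3) using th u(1) by algebra
    finally have "t (k \<cdot>\<^sub>H hi h) = u" .
    moreover have "\<Lambda> (k \<cdot>\<^sub>H hi h) = \<one>" using lam_mult[OF k(1), of "hi h"] k h li by simp
    moreover have "k \<cdot>\<^sub>H hi h \<in> carrier H" using k h by simp
    ultimately show ?thesis using u by blast
  next
    case False
    obtain h k where hk: "h \<in> carrier H" "k \<in> carrier H" "h \<cdot>\<^sub>H k \<noteq> k \<cdot>\<^sub>H h" using nonabelian by blast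
    then have "t h \<noteq> \<zero>" using central False by blast
    then show ?thesis using False hk(1) by blast
  qed
  then have "?S = carrier F" using irr[OF sub zS] by blast
  then have "x \<in> ?S" using x by simp
  then show ?thesis by auto
qed

text \<open>
  If \<open>\<Lambda> c = \<one>\<close>, then \<open>c\<close> is central. An element \<open>h\<close> acting as a translation then commutes with
  \<open>\<langle>c\<rangle>\<close>, so \<open>hat h\<close> fixes \<open>b\<close> and the translation is trivial.
\<close>

lemma lam_c: "\<Lambda> c \<noteq> \<one>"
proof
  assume l: "\<Lambda> c = \<one>"
  obtain h where h: "h \<in> carrier H" "t h = \<one>" "\<Lambda> h = \<one>" using translations_occur[OF one_closed] by blast
  have com: "c \<cdot>\<^sub>H h = h \<cdot>\<^sub>H c" using central[OF c(1) h(1) t_c l] .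
  have "hat h (e x) = e x" if "x \<in> carrier G" for x
  proof (rule T_inj[OF comp_hom[OF hat_hom[OF h(1)] e_hom] e_hom _ that])
    fix y assume y: "y \<in> carrier H"
    obtain i where i: "\<epsilon> y = c [^]\<^bsub>H\<^esub> (i::nat)" using c y by blast
    have "\<epsilon> y \<cdot>\<^sub>H h = h \<cdot>\<^sub>H \<epsilon> y" unfolding i using H.pow_commute[OF c(1) h(1) com] by simp
    then have "h \<cdot>\<^sub>H \<epsilon> y \<cdot>\<^sub>H hi h = \<epsilon> y \<cdot>\<^sub>H h \<cdot>\<^sub>H hi h" by simp
    also have "\<dots> = \<epsilon> y" using h y by (simp add: H.group_normalize)
    finally show "T (\<lambda>x. hat h (e x)) y = T e y"
      using T_comp[OF hat_hom[OF h(1)] e_hom y] T_hat[OF h(1)] y unfolding \<epsilon>_def[symmetric] by simp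
  qed
  then have "hat h b = b" using e_b(2) b(1) by metis
  then have "t h = \<zero>" unfolding t_def by simp
  then show False using h one_not_zero by simp
qed

text \<open>
  The endomorphism \<open>h \<mapsto> \<epsilon> h [^] q\<close> corresponds to \<open>x \<mapsto> e x [^] k\<close> for some \<open>k\<close> divisible by \<open>q\<close>, because
  neither can be inverted on the respective cyclic group. As \<open>b [^] k\<close> commutes with \<open>F\<close>, the element
  \<open>c [^] q\<close> commutes with an element that acts as a translation, and this forces its linear part to be \<open>\<one>\<close>.
\<close>

lemma lam_c_q: "\<Lambda> c [^] q = \<one>"
proof -
  obtain h where h: "h \<in> carrier H" "t h = \<one>" "\<Lambda> h = \<one>" using translations_occur[OF one_closed] by blast
  have "(\<lambda>h. \<epsilon> h [^]\<^bsub>H\<^esub> q) \<in> hom H H"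
  proof (rule homI)
    fix x y assume xy: "x \<in> carrier H" "y \<in> carrier H"
    obtain i j where ij: "\<epsilon> x = c [^]\<^bsub>H\<^esub> (i::nat)" "\<epsilon> y = c [^]\<^bsub>H\<^esub> (j::nat)" using c xy by metis
    have "\<epsilon> (x \<cdot>\<^sub>H y) = \<epsilon> x \<cdot>\<^sub>H \<epsilon> y" using eps_hom xy by (simp add: hom_mult)
    then show "\<epsilon> (x \<cdot>\<^sub>H y) [^]\<^bsub>H\<^esub> q = \<epsilon> x [^]\<^bsub>H\<^esub> q \<cdot>\<^sub>H \<epsilon> y [^]\<^bsub>H\<^esub> q"
      unfolding ij using c by (simp add: H.nat_pow_mult H.nat_pow_pow algebra_simps)
  qed simp
  then obtain g where g: "g \<in> hom G G" "\<And>x. x \<in> carrier H \<Longrightarrow> T g x = \<epsilon> x [^]\<^bsub>H\<^esub> q" using T_surj by blast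
  have ge: "(\<lambda>x. g (e x)) \<in> hom G G" "(\<lambda>x. e (g (e x))) \<in> hom G G" using g(1) e_hom comp_hom by auto
  have ecq: "\<epsilon> (c [^]\<^bsub>H\<^esub> (i::nat)) = c [^]\<^bsub>H\<^esub> i" for i
  proof -
    interpret eps: group_hom H H \<epsilon> by unfold_locales (rule eps_hom)
    show ?thesis using eps.hom_nat_pow[OF c(1), of i] c(2) by simp
  qed
  have "g x = e (g (e x))" if x: "x \<in> carrier G" for x
  proof (rule T_inj[OF g(1) ge(2) _ x])
    fix y assume y: "y \<in> carrier H"
    obtain i where i: "\<epsilon> y = c [^]\<^bsub>H\<^esub> (i::nat)" using c y by blast
    have "T (\<lambda>x. e (g (e x))) y = \<epsilon> (T g (\<epsilon> y))"
      using T_comp[OF e_hom ge(1) y] T_comp[OF g(1) e_hom y] unfolding \<epsilon>_def by simp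
    also have "\<dots> = \<epsilon> (\<epsilon> y [^]\<^bsub>H\<^esub> q)" using g(2)[of "\<epsilon> y"] eps_eps y by simp
    also have "\<dots> = \<epsilon> y [^]\<^bsub>H\<^esub> q" unfolding i using c ecq by (simp add: H.nat_pow_pow)
    finally show "T g y = T (\<lambda>x. e (g (e x))) y" using g(2)[OF y] by simp
  qed
  then obtain k where k: "\<forall>x\<in>carrier G. g x = e x [^]\<^bsub>G\<^esub> (k::nat)" using two_sided_factor[OF g(1)] by blast
  have gk: "T g = \<kappa> k" unfolding \<kappa>_def by (rule T_cong) (use k in blast)
  have qk: "q dvd k"
  proof (rule ccontr)
    assume "\<not> q dvd k"
    then have "coprime k (q ^ v)" using prime_imp_coprime[OF q, of k] by (simp add: coprime_commute[of k])
    then obtain j where j: "[k * j = 1] (mod q ^ v)" using cong_solve_coprime_nat[of k "q ^ v"] by (metis One_nat_def)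
    have "e (e x [^]\<^bsub>G\<^esub> k) [^]\<^bsub>G\<^esub> j = e x" if x: "x \<in> carrier G" for x
      using e_e_pow[OF x, of k] G.pow_cong[OF e_closed[OF x] e_pow_order[OF x] j] x by (simp add: G.nat_pow_pow)
    then have "\<kappa> j (\<kappa> k c) = \<epsilon> c"
      using T_comp[OF e_pow_hom[of j] e_pow_hom[of k] c(1)] T_cong[of "\<lambda>x. e (e x [^]\<^bsub>G\<^esub> k) [^]\<^bsub>G\<^esub> j" e]
      unfolding \<kappa>_def \<epsilon>_def by simp
    then have 1: "\<kappa> j (c [^]\<^bsub>H\<^esub> q) = c" using g(2)[OF c(1)] gk c by simp
    interpret kj: group_hom H H "\<kappa> j" unfolding \<kappa>_def by unfold_locales (rule T_hom[OF e_pow_hom])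
    obtain i where i: "\<kappa> j c = c [^]\<^bsub>H\<^esub> (i::nat)"
      using kappa_closed[OF c(1), of j] c(4)[of "\<kappa> j c"] unfolding B_def by auto
    have "c [^]\<^bsub>H\<^esub> (i * q) = c [^]\<^bsub>H\<^esub> (1::nat)"
      using kj.hom_nat_pow[OF c(1), of q] 1 i c by (simp add: H.nat_pow_pow)
    then have "[i * q = 1] (mod H.ord c)" using H.pow_eq_iff_cong_ord[OF c(1)] by blast
    then have "[i * q = 1] (mod q ^ v)" unfolding c(3) .
    moreover have "q dvd q ^ v" using v by (simp add: dvd_power)
    ultimately have "[i * q = 1] (mod q)" by (rule cong_dvd_modulus_nat)
    then have "[0 = 1] (mod q)" by (metis cong_mult_self_right cong_sym cong_trans)
    then show False using prime_gt_1_nat[OF q] by (simp add: unique_euclidean_semiring_class.cong_def)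
  qed
  have zk: "\<zeta> [^] k = \<one>" using qk zeta_pow_one by blast
  have bk: "hat h (b [^]\<^bsub>G\<^esub> k) = b [^]\<^bsub>G\<^esub> k"
  proof -
    have d: "\<one> \<ominus> \<zeta> \<in> carrier F" "\<one> \<ominus> \<zeta> \<noteq> \<zero>" using zeta by (simp, metis r_right_minus_eq one_closed)
    define x where "x = m_inv F (\<one> \<ominus> \<zeta>)"
    have x: "x \<in> carrier F" "(\<one> \<ominus> \<zeta>) \<otimes> x = \<one>" unfolding x_def using unit_inv[OF d] by auto
    have "x \<cdot>\<^sub>G b \<cdot>\<^sub>G gi x = \<one> \<cdot>\<^sub>G b"
    proof -
      have "x \<cdot>\<^sub>G b \<cdot>\<^sub>G gi x = x \<cdot>\<^sub>G (b \<cdot>\<^sub>G gi x \<cdot>\<^sub>G gi b) \<cdot>\<^sub>G b" using x b by (simp add: G.group_normalize)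
      also have "b \<cdot>\<^sub>G gi x \<cdot>\<^sub>G gi b = \<ominus> (\<zeta> \<otimes> x)"
        using conj_b[of "gi x"] x zeta by (metis F_inv_closed minus_eq_inv r_minus)
      also have "x \<cdot>\<^sub>G \<ominus> (\<zeta> \<otimes> x) = x \<oplus> \<ominus> (\<zeta> \<otimes> x)" using x zeta by (simp add: add_eq)
      also have "\<dots> = (\<one> \<ominus> \<zeta>) \<otimes> x" using x(1) zeta(1) by algebra
      finally show ?thesis using x by simp
    qed
    then have hb: "hat h b = x \<cdot>\<^sub>G b \<cdot>\<^sub>G gi x" using hat_b[OF h(1)] h by simp
    interpret hh: group_hom G G "hat h" by unfold_locales (rule hat_hom[OF h(1)])
    have "(x \<cdot>\<^sub>G b \<cdot>\<^sub>G gi x) [^]\<^bsub>G\<^esub> i = x \<cdot>\<^sub>G b [^]\<^bsub>G\<^esub> i \<cdot>\<^sub>G gi x" for i :: nat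
      by (induction i) (use x b in \<open>auto simp: G.group_normalize\<close>)
    then have 1: "hat h (b [^]\<^bsub>G\<^esub> k) = x \<cdot>\<^sub>G b [^]\<^bsub>G\<^esub> k \<cdot>\<^sub>G gi x" using hh.hom_nat_pow[OF b(1), of k] hb by simp
    have "b [^]\<^bsub>G\<^esub> k \<cdot>\<^sub>G gi x \<cdot>\<^sub>G gi (b [^]\<^bsub>G\<^esub> k) = gi x" using conj_bpow[of "gi x" k] x zk F_inv_closed by simp
    then have "x \<cdot>\<^sub>G (b [^]\<^bsub>G\<^esub> k \<cdot>\<^sub>G gi x \<cdot>\<^sub>G gi (b [^]\<^bsub>G\<^esub> k)) \<cdot>\<^sub>G b [^]\<^bsub>G\<^esub> k = b [^]\<^bsub>G\<^esub> k" using x b by simp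
    then show ?thesis unfolding 1 using x b by (simp add: G.group_normalize)
  qed
  have "hat h (e x [^]\<^bsub>G\<^esub> k) = e x [^]\<^bsub>G\<^esub> k" if x: "x \<in> carrier G" for x
  proof -
    interpret hh: group_hom G G "hat h" by unfold_locales (rule hat_hom[OF h(1)])
    obtain i where i: "e x = b [^]\<^bsub>G\<^esub> (i::nat)" using e_bpow[OF x] by blast
    have "e x [^]\<^bsub>G\<^esub> k = (b [^]\<^bsub>G\<^esub> k) [^]\<^bsub>G\<^esub> i" unfolding i using b by (simp add: G.nat_pow_pow mult.commute)
    then show ?thesis using hh.hom_nat_pow[of "b [^]\<^bsub>G\<^esub> k" i] bk b by simp
  qed
  then have "T (hat h) (\<kappa> k c) = \<kappa> k c"
    using T_comp[OF hat_hom[OF h(1)] e_pow_hom[of k] c(1)]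
      T_cong[of "\<lambda>x. hat h (e x [^]\<^bsub>G\<^esub> k)" "\<lambda>x. e x [^]\<^bsub>G\<^esub> k"] unfolding \<kappa>_def by simp
  moreover have "\<kappa> k c = c [^]\<^bsub>H\<^esub> q" using g(2)[OF c(1)] gk c by simp
  ultimately have "h \<cdot>\<^sub>H c [^]\<^bsub>H\<^esub> q \<cdot>\<^sub>H hi h = c [^]\<^bsub>H\<^esub> q" using T_hat[OF h(1)] c by simp
  then have "(h \<cdot>\<^sub>H c [^]\<^bsub>H\<^esub> q \<cdot>\<^sub>H hi h) \<cdot>\<^sub>H h = c [^]\<^bsub>H\<^esub> q \<cdot>\<^sub>H h" by simp
  then have com: "h \<cdot>\<^sub>H c [^]\<^bsub>H\<^esub> q = c [^]\<^bsub>H\<^esub> q \<cdot>\<^sub>H h" using h c by (simp add: H.group_normalize)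
  have cq: "c [^]\<^bsub>H\<^esub> q \<in> carrier H" using c by simp
  have "t (c [^]\<^bsub>H\<^esub> (i::nat)) = \<zero>" "\<Lambda> (c [^]\<^bsub>H\<^esub> i) = \<Lambda> c [^] i" for i
    by (induction i) (use c t_one lam_one t_mult lam_mult t_c lam_closed in auto)
  then have "t (h \<cdot>\<^sub>H c [^]\<^bsub>H\<^esub> q) = \<one>" "t (c [^]\<^bsub>H\<^esub> q \<cdot>\<^sub>H h) = \<Lambda> c [^] q"
    using t_mult[OF h(1) cq] t_mult[OF cq h(1)] h c lam_closed by simp_all
  then show ?thesis using com by simp
qed

lemma iso_if_odd: "odd n \<Longrightarrow> G \<cong> H"
proof -
  interpret R: affine_reconstruction F \<zeta> p q n G b v H t \<Lambda> \<epsilon> c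
    by unfold_locales
      (use t_closed lam_closed lam_nonzero t_mult lam_mult central eps_hom c t_c lam_c lam_c_q inj_or_kill
        translations_occur in auto)
  show "odd n \<Longrightarrow> G \<cong> H" by (rule R.iso_of_affine_coordinates)
qed

end

section \<open>Determination by the endomorphism semigroup\<close>

theorem theorem3p3:
  fixes G :: "('a, 'm) monoid_scheme" and p q v :: nat
  assumes "Factorial_Ring.prime p" and "Factorial_Ring.prime q" and "p \<noteq> q" and "v \<ge> 1"
    and "miller_moreno_with_parameters G p q v"
    and "infinite (UNIV :: 'b set)"
  shows "determined_by_End G TYPE('b) \<longleftrightarrow>
    odd (group.ord (units_of (residue_ring (int q))) (int p mod int q))"
proof -
  obtain F :: "'a ring" and \<zeta> n b where "field_semidirect F \<zeta> p q n G b v"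
    using miller_moreno_field[OF assms(5)] by blast
  then interpret field_semidirect F \<zeta> p q n G b v .
  have "determined_by_End G TYPE('b) \<longleftrightarrow> odd n"
  proof
    assume det: "determined_by_End G TYPE('b)"
    show "odd n"
    proof
      assume "even n"
      then obtain \<eta> where eta: "field_involution F \<eta>" "\<zeta> \<otimes>\<^bsub>F\<^esub> \<eta> \<zeta> = \<one>\<^bsub>F\<^esub>" using even_involution by blast
      interpret eta: field_involution F \<eta> by (rule eta)
      interpret field_semidirect_involution F \<zeta> p q n G b v \<eta> by unfold_locales (rule eta)
      show False using not_determined[OF assms(6)] det by blast
    qed
  next
    assume n: "odd n"
    show "determined_by_End G TYPE('b)"
      unfolding determined_by_End_def
    proof (intro allI impI)
      fix H :: "'b monoid" assume H: "group H" "End G \<cong> End H"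
      interpret H: group H by (rule H)
      obtain \<theta> where "\<theta> \<in> iso (End G) (End H)" using H(2) unfolding is_iso_def by blast
      then interpret field_semidirect_End_iso F \<zeta> p q n G b v H \<theta> by unfold_locales
      show "G \<cong> H" by (rule iso_if_odd[OF n])
    qed
  qed
  then show ?thesis using n_is_order by simp
qed

end
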